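(* Let $R=\mathbb{K}[x_1,\dots,x_n]$ with $\mathbb{K}$ a field of characteristic $0$ and let $I\subseteq R$ be an ideal. Suppose that for each associated prime $\mathfrak{p}\in\operatorname{Ass}(R/I)$ we are given (1) elements $\mathbf{t}=(t_1,\dots,t_k)$, $\mathbf{y}=(y_1,\dots,y_{n-k})$ of $R$ forming a regular system of parameters for $R$ (so that $R=\mathbb{K}[\mathbf{t},\mathbf{y}]$), such that the images of $\mathbf{t}$ in $R/\mathfrak{p}$ form a maximal algebraically independent set (the free variables for $\mathfrak{p}$), and (2) a finite set $A_{\mathfrak{p}}\subseteq D_{\mathbb{K}(\mathbf{t})\mathfrak{p}}[\mathbb{K}(\mathbf{t})I]\subseteq\kappa(\mathbb{K}(\mathbf{t})\mathfrak{p})\langle\partial_{\mathbf{y}}\rangle$ whose cosets span the excess dual space $E_{\mathbb{K}(\mathbf{t})\mathfrak{p}}[\mathbb{K}(\mathbf{t})I]$. Then the ideal $I$ can be recovered from $\operatorname{Ass}(R/I)$ together with this data; that is, $I$ is uniquely determined by $\operatorname{Ass}(R/I)$ and the data (1)–(2) for each associated prime.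
   Context: For a prime $\mathfrak{p}$ and $\mathbf{t},\mathbf{y}$ as in (1), write $\mathbb{K}(\mathbf{t})M:=\mathbb{K}(\mathbf{t})\otimes_{\mathbb{K}[\mathbf{t}]}M$ (localization at $\mathbb{K}[\mathbf{t}]\setminus\{0\}$). Thus $S:=\mathbb{K}(\mathbf{t})R\cong\mathbb{K}(\mathbf{t})[\mathbf{y}]$ is a polynomial ring over the field $\mathbb{K}(\mathbf{t})$, $\mathbb{K}(\mathbf{t})I$ and $\mathbb{K}(\mathbf{t})\mathfrak{p}$ are the extended ideals, and $\mathfrak{M}:=\mathbb{K}(\mathbf{t})\mathfrak{p}$ is a maximal ideal of $S$ with residue field $\kappa(\mathfrak{M})=S/\mathfrak{M}$. Local dual spaces over $S$: $\kappa(\mathfrak{M})\langle\partial_{\mathbf{y}}\rangle$ denotes finite sums $D=\sum_\alpha c_\alpha\partial_{\mathbf{y}}^\alpha$ with $c_\alpha\in\kappa(\mathfrak{M})$; for $g\in S$, $D\cdot g=\sum_\alpha c_\alpha\,\overline{\partial_{\mathbf{y}}^\alpha g}\in\kappa(\mathfrak{M})$ (bar = reduction mod $\mathfrak{M}$), and "$D\cdot g\in\mathfrak{M}$" means $D\cdot g=0$. For an ideal $J\subseteq S$, $D_{\mathfrak{M}}[J]=\{D\mid D\cdot g\in\mathfrak{M}\ \forall g\in J\}$, a $\kappa(\mathfrak{M})$-vector space. The excess dual space is $E_{\mathfrak{M}}[J]=D_{\mathfrak{M}}[J]/D_{\mathfrak{M}}[J:\mathfrak{M}^\infty]$, where $J:\mathfrak{M}^\infty$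 is the saturation. *)

theory Defs
  imports "HOL-Library.Poly_Mapping" "HOL-Computational_Algebra.Fraction_Field"
begin

text \<open>Polynomial ring R = K[x_v | v in 'v] over a field K, with finitely many
  variables (the finite linearly ordered type 'v; n = CARD('v)).
  Polynomials are finitely supported maps from monomials (exponent vectors) to
  coefficients.\<close>

type_synonym ('w, 'k) mpol = "('w \<Rightarrow>\<^sub>0 nat) \<Rightarrow>\<^sub>0 'k"

definition pconst :: "'k::zero \<Rightarrow> ('w, 'k) mpol" where
  "pconst c = Poly_Mapping.single 0 c"

definition pvars :: "('w, 'k::zero) mpol \<Rightarrow> 'w set" where
  "pvars F = (\<Union>m\<in>Poly_Mapping.keys F. Poly_Mapping.keys m)"

definition peval :: "('w \<Rightarrow> ('v, 'k::comm_ring_1) mpol) \<Rightarrow> ('w, 'k) mpol \<Rightarrow> ('v, 'k) mpol" where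
  "peval u F = (\<Sum>m\<in>Poly_Mapping.keys F. pconst (Poly_Mapping.lookup F m) * (\<Prod>i\<in>Poly_Mapping.keys m. u i ^ Poly_Mapping.lookup m i))"

definition is_ideal :: "'a::comm_ring_1 set \<Rightarrow> bool" where
  "is_ideal I \<longleftrightarrow> 0 \<in> I \<and> (\<forall>a\<in>I. \<forall>b\<in>I. a + b \<in> I) \<and> (\<forall>a\<in>I. \<forall>r. r * a \<in> I)"

definition is_prime_ideal :: "'a::comm_ring_1 set \<Rightarrow> bool" where
  "is_prime_ideal P \<longleftrightarrow> is_ideal P \<and> P \<noteq> UNIV \<and> (\<forall>a b. a * b \<in> P \<longrightarrow> a \<in> P \<or> b \<in> P)"

definition Ass :: "'a::comm_ring_1 set \<Rightarrow> 'a set set" where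
  "Ass I = {P. is_prime_ideal P \<and> (\<exists>f. P = {g. g * f \<in> I})}"

text \<open>(1) u is a coordinate system of R: the elements u v (v in 'v) generate R as
  a K-algebra freely, i.e. the substitution x_v |-> u v is a K-algebra automorphism
  of R, so R = K[t,y] with t = (u v)_{v in T} and y = (u v)_{v not in T}.\<close>
definition coord_system :: "('v \<Rightarrow> ('v, 'k::comm_ring_1) mpol) \<Rightarrow> bool" where
  "coord_system u \<longleftrightarrow> bij (peval u)"

text \<open>The images of t = (u v)_{v in T} in R/p form a maximal algebraically
  independent (over K) family: no nonzero polynomial in the t vanishes modulo p,
  and adjoining any further element z of R gives an algebraically dependent family.\<close>
definition free_vars :: "('v, 'k::comm_ring_1) mpol set \<Rightarrow> ('v \<Rightarrow> ('v, 'k) mpol) \<Rightarrow> 'v set \<Rightarrow> bool" where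
  "free_vars P u T \<longleftrightarrow>
     (\<forall>F. pvars F \<subseteq> T \<and> F \<noteq> 0 \<longrightarrow> peval u F \<notin> P) \<and>
     (\<forall>z. \<exists>F :: ('v option, 'k) mpol. F \<noteq> 0 \<and> pvars F \<subseteq> Some ` T \<union> {None} \<and>
            peval (\<lambda>w. case w of None \<Rightarrow> z | Some i \<Rightarrow> u i) F \<in> P)"

definition Kt :: "('v \<Rightarrow> ('v, 'k::comm_ring_1) mpol) \<Rightarrow> 'v set \<Rightarrow> ('v, 'k) mpol set" where
  "Kt u T = {peval u F | F. pvars F \<subseteq> T}"

text \<open>The localization S = K(t) R, realized inside the fraction field of R.\<close>
definition Sloc :: "('v::linorder \<Rightarrow> ('v, 'k::field) mpol) \<Rightarrow> 'v set \<Rightarrow> ('v, 'k) mpol fract set" where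
  "Sloc u T = {Fract f h | f h. h \<in> Kt u T \<and> h \<noteq> 0}"

definition ext_ideal :: "('v::linorder \<Rightarrow> ('v, 'k::field) mpol) \<Rightarrow> 'v set \<Rightarrow> ('v, 'k) mpol set \<Rightarrow> ('v, 'k) mpol fract set" where
  "ext_ideal u T J = {Fract f h | f h. f \<in> J \<and> h \<in> Kt u T \<and> h \<noteq> 0}"

definition saturation :: "'a::comm_ring_1 set \<Rightarrow> 'a set \<Rightarrow> 'a set \<Rightarrow> 'a set" where
  "saturation S J M = {g \<in> S. \<exists>m. \<forall>qs. length qs = m \<longrightarrow> set qs \<subseteq> M \<longrightarrow> g * prod_list qs \<in> J}"

text \<open>Partial derivative with respect to y_j = u j (j not in T) in the coordinates
  (t,y): the unique K-derivation of the fraction field of R killing the t_i and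
  sending y_l to delta_{jl}.\<close>
definition is_yderiv :: "('v::linorder \<Rightarrow> ('v, 'k::field) mpol) \<Rightarrow> 'v set \<Rightarrow> 'v \<Rightarrow>
    (('v, 'k) mpol fract \<Rightarrow> ('v, 'k) mpol fract) \<Rightarrow> bool" where
  "is_yderiv u T j \<delta> \<longleftrightarrow>
     (\<forall>a b. \<delta> (a + b) = \<delta> a + \<delta> b) \<and> (\<forall>a b. \<delta> (a * b) = a * \<delta> b + \<delta> a * b) \<and>
     (\<forall>c. \<delta> (Fract (pconst c) 1) = 0) \<and>
     (\<forall>i\<in>T. \<delta> (Fract (u i) 1) = 0) \<and>
     (\<forall>l. l \<notin> T \<longrightarrow> \<delta> (Fract (u l) 1) = (if l = j then 1 else 0))"

definition yderiv :: "('v::linorder \<Rightarrow> ('v, 'k::field) mpol) \<Rightarrow> 'v set \<Rightarrow> 'v \<Rightarrow>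
    ('v, 'k) mpol fract \<Rightarrow> ('v, 'k) mpol fract" where
  "yderiv u T j = (THE \<delta>. is_yderiv u T j \<delta>)"

definition ydpow :: "('v::linorder \<Rightarrow> ('v, 'k::field) mpol) \<Rightarrow> 'v set \<Rightarrow> ('v \<Rightarrow>\<^sub>0 nat) \<Rightarrow>
    ('v, 'k) mpol fract \<Rightarrow> ('v, 'k) mpol fract" where
  "ydpow u T \<alpha> = foldr (\<lambda>j f. (yderiv u T j ^^ Poly_Mapping.lookup \<alpha> j) \<circ> f) (sorted_list_of_set (Poly_Mapping.keys \<alpha>)) id"

text \<open>Differential operators D = sum_alpha c_alpha partial_y^alpha. The coefficients
  c_alpha in the residue field kappa(M) = S/M are represented by elements of S
  (representatives); the operator is a finitely supported map alpha |-> c_alpha,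
  with alpha ranging over multi-indices in the y variables only.\<close>
type_synonym ('v, 'k) dop = "('v \<Rightarrow>\<^sub>0 nat) \<Rightarrow>\<^sub>0 ('v, 'k) mpol fract"

definition is_dop :: "('v::linorder \<Rightarrow> ('v, 'k::field) mpol) \<Rightarrow> 'v set \<Rightarrow> ('v, 'k) dop \<Rightarrow> bool" where
  "is_dop u T D \<longleftrightarrow> (\<forall>\<alpha>\<in>Poly_Mapping.keys D. Poly_Mapping.keys \<alpha> \<inter> T = {} \<and> Poly_Mapping.lookup D \<alpha> \<in> Sloc u T)"

definition dapply :: "('v::linorder \<Rightarrow> ('v, 'k::field) mpol) \<Rightarrow> 'v set \<Rightarrow> ('v, 'k) dop \<Rightarrow>
    ('v, 'k) mpol fract \<Rightarrow> ('v, 'k) mpol fract" where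
  "dapply u T D g = (\<Sum>\<alpha>\<in>Poly_Mapping.keys D. Poly_Mapping.lookup D \<alpha> * ydpow u T \<alpha> g)"

definition dual_space :: "('v::linorder \<Rightarrow> ('v, 'k::field) mpol) \<Rightarrow> 'v set \<Rightarrow>
    ('v, 'k) mpol fract set \<Rightarrow> ('v, 'k) mpol fract set \<Rightarrow> ('v, 'k) dop set" where
  "dual_space u T M J = {D. is_dop u T D \<and> (\<forall>g\<in>J. dapply u T D g \<in> M)}"

definition dscale :: "('v::linorder, 'k::field) mpol fract \<Rightarrow> ('v, 'k) dop \<Rightarrow> ('v, 'k) dop" where
  "dscale c D = Poly_Mapping.map (\<lambda>x. c * x) D"

text \<open>The cosets of the elements of A span the excess dual space
  E_M[J] = D_M[J] / D_M[J : M^infinity] over kappa(M).\<close>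
definition spans_excess :: "('v::linorder \<Rightarrow> ('v, 'k::field) mpol) \<Rightarrow> 'v set \<Rightarrow>
    ('v, 'k) mpol fract set \<Rightarrow> ('v, 'k) mpol fract set \<Rightarrow> ('v, 'k) dop set \<Rightarrow> bool" where
  "spans_excess u T M J A \<longleftrightarrow>
     (\<forall>D\<in>dual_space u T M J. \<exists>c. (\<forall>a\<in>A. c a \<in> Sloc u T) \<and>
        D - (\<Sum>a\<in>A. dscale (c a) a) \<in> dual_space u T M (saturation (Sloc u T) J M))"

definition excess_data :: "('v::linorder, 'k::field) mpol set \<Rightarrow> ('v, 'k) mpol set \<Rightarrow>
    ('v \<Rightarrow> ('v, 'k) mpol) \<Rightarrow> 'v set \<Rightarrow> ('v, 'k) dop set \<Rightarrow> bool" where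
  "excess_data I P u T A \<longleftrightarrow>
     finite A \<and> A \<subseteq> dual_space u T (ext_ideal u T P) (ext_ideal u T I) \<and>
     spans_excess u T (ext_ideal u T P) (ext_ideal u T I) A"

end

theory Submission
  imports "HOL-Library.FuncSet" "HOL-Computational_Algebra.Polynomial" Defs
begin

text \<open>
  For a prime \<open>P\<close> let \<open>loc I P\<close> be the contraction of \<open>I R\<^sub>P\<close> to \<open>R\<close>. An ideal is the intersection of
  its localizations at its associated primes, so if \<open>I \<noteq> I'\<close> there is a minimal \<open>P\<close> among the
  (finitely many) associated primes with \<open>loc I P \<noteq> loc I' P\<close>. Locally at \<open>P\<close> the saturations of \<open>I\<close> and
  \<open>I'\<close> by \<open>P\<close> are determined by the localizations at the smaller associated primes, hence they agree;
  a differential operator only sees the localization, so the dual spaces of the saturations agree, and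
  with the common spanning set of the excess dual spaces so do the dual spaces of \<open>I\<close> and \<open>I'\<close>.

  It remains to see that the dual space determines \<open>loc I P\<close>. If \<open>f \<notin> loc I P\<close>, Krull's intersection theorem
  gives \<open>L \<supseteq> I + P\<^sup>K\<close> with \<open>f \<notin> loc L P\<close>. In characteristic zero \<open>R\<^sub>P / L\<close> has a coefficient field \<open>F\<close>
  containing \<open>\<bbbK>(t)\<close>; pick an \<open>F\<close>-linear functional \<open>l\<close> that kills \<open>L\<close> with \<open>l f = 1\<close>. Writing \<open>y = \<eta> + z\<close>
  with \<open>\<eta>\<close> in \<open>F\<close> and \<open>z\<close> in the maximal ideal, Taylor expansion of \<open>g(\<eta> + z)\<close> exhibits \<open>l\<close> as the operator
  \<open>\<Sum>\<^sub>\<alpha> l(z\<^sup>\<alpha>)/\<alpha>! \<partial>\<^sup>\<alpha>\<close>, which lies in the dual space of \<open>I\<close> and does not kill \<open>f\<close>.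
\<close>

subsection \<open>Ideals in Noetherian rings\<close>

text \<open>Everything takes place inside the fraction field of R: R_P, its maximal ideal and
  extended ideals are subsets of it, and quotients are replaced by congruences. Linearity of
  functionals is therefore known only modulo the maximal ideal, which suffices because dual spaces
  test nothing finer. Two mismatches shape the argument. First, dual spaces live over S = K(t)R,
  while ideals are compared in R_P: an element of one saturation lies in the other only after
  multiplication by some s outside P. Operators are not R-linear, so s cannot be pulled out; but an
  operator of order below n satisfies a linear relation between its values at g, s g, ..., s^n g,
  and the coefficient at g is s^n up to sign. Second, the functional takes values in R_P, whereas
  operator coefficients must lie in S. There are finitely many of them, so a common denominator
  outside P clears them, and scaling by a unit of R_P preserves separation. Characteristic zero
  enters twice: it makes minimal relations over the residue field separable, and it makes alpha!
  invertible.\<close>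

lemma is_idealI:
  assumes "0 \<in> I" "\<And>a b. a \<in> I \<Longrightarrow> b \<in> I \<Longrightarrow> a + b \<in> I" "\<And>r a. a \<in> I \<Longrightarrow> r * a \<in> I"
  shows "is_ideal I"
  using assms by (auto simp: is_ideal_def)

lemma ideal_zero: "is_ideal I \<Longrightarrow> 0 \<in> I"
  and ideal_add: "is_ideal I \<Longrightarrow> a \<in> I \<Longrightarrow> b \<in> I \<Longrightarrow> a + b \<in> I"
  and ideal_mult: "is_ideal I \<Longrightarrow> a \<in> I \<Longrightarrow> r * a \<in> I"
  by (auto simp: is_ideal_def)

lemma ideal_mult_right: "is_ideal I \<Longrightarrow> a \<in> I \<Longrightarrow> a * r \<in> I"
  by (metis ideal_mult mult.commute)

lemma ideal_diff: "is_ideal I \<Longrightarrow> a \<in> I \<Longrightarrow> b \<in> I \<Longrightarrow> a - b \<in> I"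
  using ideal_add[of I a "- 1 * b"] ideal_mult[of I b "- 1"] by simp

lemma prime_is_ideal: "is_prime_ideal P \<Longrightarrow> is_ideal P"
  and prime_mult: "is_prime_ideal P \<Longrightarrow> a \<notin> P \<Longrightarrow> b \<notin> P \<Longrightarrow> a * b \<notin> P"
  by (auto simp: is_prime_ideal_def)

lemma prime_one: "is_prime_ideal P \<Longrightarrow> 1 \<notin> P"
  unfolding is_prime_ideal_def by (metis UNIV_eq_I ideal_mult mult.right_neutral)

lemma prime_power: "is_prime_ideal P \<Longrightarrow> a \<notin> P \<Longrightarrow> a ^ n \<notin> P"
  by (induction n) (auto simp: prime_one prime_mult)

lemma prime_prod:
  assumes "is_prime_ideal P" "finite B" "\<And>b. b \<in> B \<Longrightarrow> s b \<notin> P"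
  shows "prod s B \<notin> P"
  using assms(2,3) by (induction B) (auto simp: prime_one prime_mult assms(1))

lemma colon_ideal:
  assumes "is_ideal I" shows "is_ideal {q. q * g \<in> I}"
  using assms by (intro is_idealI) (auto simp: ideal_zero ideal_add ideal_mult distrib_right mult.assoc)

lemma sum_principal_ideal:
  assumes "is_ideal I" shows "is_ideal {a + r * g | a r. a \<in> I}"
proof (rule is_idealI)
  show "0 \<in> {a + r * g | a r. a \<in> I}"
    using ideal_zero[OF assms] by (metis (mono_tags, lifting) CollectI add_0 mult_zero_left)
  fix x assume "x \<in> {a + r * g | a r. a \<in> I}"
  then obtain a r where x: "x = a + r * g" "a \<in> I" by auto
  show "c * x \<in> {a + r * g | a r. a \<in> I}" for c
    using x ideal_mult[OF assms, of a c] by (smt (verit) CollectI distrib_left mult.assoc)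
  fix y assume "y \<in> {a + r * g | a r. a \<in> I}"
  then obtain b s where y: "y = b + s * g" "b \<in> I" by auto
  show "x + y \<in> {a + r * g | a r. a \<in> I}"
    using x y ideal_add[OF assms, of a b]
    by (smt (verit) CollectI add.assoc add.left_commute distrib_right)
qed

section \<open>Localization at a prime and iterated colon ideals\<close>

definition loc :: "'a::comm_ring_1 set \<Rightarrow> 'a set \<Rightarrow> 'a set" where
  "loc I P = {g. \<exists>s. s \<notin> P \<and> s * g \<in> I}"

text \<open>This is I : P^N. The power of P enters through products of N elements, the encoding that
  \<open>saturation\<close> uses, so no product of ideals has to be formed.\<close>

definition colpow :: "'a::comm_ring_1 set \<Rightarrow> 'a set \<Rightarrow> nat \<Rightarrow> 'a set" where
  "colpow I P N = {x. \<forall>qs. length qs = N \<longrightarrow> set qs \<subseteq> P \<longrightarrow> x * prod_list qs \<in> I}"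

lemma loc_ideal:
  assumes "is_ideal I" "is_prime_ideal P" shows "is_ideal (loc I P)"
proof (rule is_idealI)
  show "0 \<in> loc I P" using assms prime_one[OF assms(2)] by (auto simp: loc_def ideal_zero)
  fix a assume "a \<in> loc I P"
  then obtain s where s: "s \<notin> P" "s * a \<in> I" by (auto simp: loc_def)
  show "r * a \<in> loc I P" for r
    using s ideal_mult[OF assms(1), of "s * a" r] by (auto simp: loc_def mult_ac)
  fix b assume "b \<in> loc I P"
  then obtain t where t: "t \<notin> P" "t * b \<in> I" by (auto simp: loc_def)
  have "(s * t) * (a + b) = t * (s * a) + s * (t * b)" by (simp add: algebra_simps)
  also have "\<dots> \<in> I" using s(2) t(2) by (simp add: assms ideal_add ideal_mult)
  finally show "a + b \<in> loc I P" using prime_mult[OF assms(2) s(1) t(1)] by (auto simp: loc_def)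
qed

lemma subset_loc: "is_prime_ideal P \<Longrightarrow> I \<subseteq> loc I P"
  using prime_one by (force simp: loc_def)

lemma loc_cancel:
  assumes "is_prime_ideal P" "s \<notin> P" "s * g \<in> loc I P" shows "g \<in> loc I P"
  using assms prime_mult[OF assms(1)] unfolding loc_def by (auto simp: mult.assoc[symmetric])

lemma colpow_0 [simp]: "colpow I P 0 = I"
  by (auto simp: colpow_def)

lemma colpow_Suc: "colpow I P (Suc N) = {x. \<forall>q\<in>P. x * q \<in> colpow I P N}"
proof (intro equalityI subsetI)
  fix x assume x: "x \<in> colpow I P (Suc N)"
  have "x * q * prod_list qs \<in> I" if "q \<in> P" "set qs \<subseteq> P" "length qs = N" for q qs
  proof -
    have "x * prod_list (q # qs) \<in> I" using x that unfolding colpow_def by (auto simp del: prod_list.Cons)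
    then show ?thesis by (simp add: mult.assoc)
  qed
  then show "x \<in> {x. \<forall>q\<in>P. x * q \<in> colpow I P N}" by (auto simp: colpow_def)
qed (auto simp: colpow_def length_Suc_conv mult.assoc[symmetric])

lemma colpow_ideal: "is_ideal I \<Longrightarrow> is_ideal (colpow I P N)"
  by (intro is_idealI) (auto simp: colpow_def ideal_zero ideal_add ideal_mult distrib_right mult.assoc)

lemma colpow_subset_Suc: "is_ideal I \<Longrightarrow> colpow I P N \<subseteq> colpow I P (Suc N)"
  using ideal_mult_right[OF colpow_ideal] by (auto simp: colpow_Suc)

lemma colpow_mono: "is_ideal I \<Longrightarrow> m \<le> n \<Longrightarrow> colpow I P m \<subseteq> colpow I P n"
  by (rule lift_Suc_mono_le[of "colpow I P"]) (auto dest: colpow_subset_Suc)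

text \<open>Generation is expressed by minimality: every ideal containing \<open>B\<close> contains
  \<open>J\<close>. Facts about a generated ideal are then proved by exhibiting a suitable ideal,
  with no linear combinations.\<close>

definition noetherian :: "'a::comm_ring_1 itself \<Rightarrow> bool" where
  "noetherian _ \<longleftrightarrow> (\<forall>J::'a set. is_ideal J \<longrightarrow>
     (\<exists>B. finite B \<and> B \<subseteq> J \<and> (\<forall>J'. is_ideal J' \<longrightarrow> B \<subseteq> J' \<longrightarrow> J \<subseteq> J')))"

locale noetherian_ring =
  fixes ty :: "'a::comm_ring_1 itself"
  assumes noetherian: "noetherian TYPE('a)"
begin

lemma finitely_generated:
  assumes "is_ideal (J::'a set)"
  obtains B where "finite B" "B \<subseteq> J" "\<And>J'. is_ideal J' \<Longrightarrow> B \<subseteq> J' \<Longrightarrow> J \<subseteq> J'"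
  using noetherian assms unfolding noetherian_def by metis

text \<open>A finite generating set of the union of a chain already lies in one member, so the union
  is that member and Zorn's lemma applies.\<close>

lemma maximal_ideal_in:
  assumes "\<C> \<noteq> {}" "\<And>J. J \<in> \<C> \<Longrightarrow> is_ideal (J::'a set)"
  obtains J where "J \<in> \<C>" "\<And>J'. J' \<in> \<C> \<Longrightarrow> J \<subseteq> J' \<Longrightarrow> J' = J"
proof -
  have "\<exists>M\<in>\<C>. \<forall>X\<in>\<C>. M \<subseteq> X \<longrightarrow> X = M"
  proof (rule subset_Zorn_nonempty[OF assms(1)])
    fix C assume C: "C \<noteq> {}" "subset.chain \<C> C"
    have ch: "X \<in> \<C>" "X \<subseteq> Y \<or> Y \<subseteq> X" if "X \<in> C" "Y \<in> C" for X Y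
      using C that by (auto simp: subset.chain_def)
    have id: "is_ideal (\<Union>C)"
    proof (rule is_idealI)
      show "0 \<in> \<Union>C" using C ch assms(2) ideal_zero by fastforce
      show "r * a \<in> \<Union>C" if "a \<in> \<Union>C" for r a
        using that ch assms(2) ideal_mult by blast
      fix a b assume "a \<in> \<Union>C" "b \<in> \<Union>C"
      then obtain X Y where "a \<in> X" "X \<in> C" "b \<in> Y" "Y \<in> C" by auto
      then show "a + b \<in> \<Union>C"
        using ch[of X Y] ch[of Y X] assms(2) ideal_add by (metis UnionI subsetD)
    qed
    obtain B where B: "finite B" "B \<subseteq> \<Union>C" "\<And>J'. is_ideal J' \<Longrightarrow> B \<subseteq> J' \<Longrightarrow> \<Union>C \<subseteq> J'"
      using finitely_generated[OF id] by metis
    obtain X where "X \<in> C" "B \<subseteq> X"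
      using finite_subset_Union_chain[OF B(1,2) C] by metis
    then have "\<Union>C = X" using B(3)[of X] assms(2) ch by blast
    then show "\<Union>C \<in> \<C>" using \<open>X \<in> C\<close> ch by auto
  qed
  then show ?thesis using that by metis
qed

lemma chain_stabilizes:
  assumes "\<And>n. is_ideal (C n :: 'a set)" "\<And>n. C n \<subseteq> C (Suc n)"
  obtains N where "C (Suc N) = C N"
proof -
  obtain J where "J \<in> range C" "\<And>J'. J' \<in> range C \<Longrightarrow> J \<subseteq> J' \<Longrightarrow> J' = J"
    using maximal_ideal_in[of "range C"] assms(1) by blast
  moreover from this obtain N where "J = C N" by auto
  ultimately have "C (Suc N) = C N" using assms(2)[of N] by simp
  then show ?thesis by (rule that)
qed

text \<open>A maximal element among the proper colon ideals I : (r f) is prime: if b lies outside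
  it, passing from r f to b r f can only enlarge the colon, hence leaves it unchanged.\<close>

lemma ex_prime_colon:
  assumes I: "is_ideal (I::'a set)" and f: "f \<notin> I"
  obtains r where "is_prime_ideal {q. q * (r * f) \<in> I}" "r * f \<notin> I"
proof -
  define \<C> where "\<C> = {{q. q * (r * f) \<in> I} | r. r * f \<notin> I}"
  have "\<C> \<noteq> {}" using f by (auto simp: \<C>_def intro: exI[of _ 1])
  moreover have "is_ideal J" if "J \<in> \<C>" for J using that colon_ideal[OF I] by (auto simp: \<C>_def)
  ultimately obtain J where J: "J \<in> \<C>" "\<And>J'. J' \<in> \<C> \<Longrightarrow> J \<subseteq> J' \<Longrightarrow> J' = J"
    using maximal_ideal_in by metis
  then obtain r where r: "J = {q. q * (r * f) \<in> I}" "r * f \<notin> I" by (auto simp: \<C>_def)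
  have "is_prime_ideal J" unfolding is_prime_ideal_def
  proof (intro conjI allI impI)
    show "is_ideal J" using r colon_ideal[OF I] by simp
    have "1 \<notin> J" using r by simp
    then show "J \<noteq> UNIV" by blast
    fix a b assume ab: "a * b \<in> J"
    show "a \<in> J \<or> b \<in> J"
    proof (rule disjCI)
      assume b: "b \<notin> J"
      let ?J = "{q. q * ((b * r) * f) \<in> I}"
      have "?J \<in> \<C>" using b r by (auto simp: \<C>_def mult.assoc intro!: exI[of _ "b * r"])
      moreover have "J \<subseteq> ?J"
        using r(1) ideal_mult[OF I, of _ b] by (auto simp: mult.left_commute[of _ b] mult.assoc)
      ultimately have "?J = J" using J(2) by simp
      moreover have "a \<in> ?J" using ab r by (simp add: mult.assoc)
      ultimately show "a \<in> J" by simp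
    qed
  qed
  then show ?thesis using that r by simp
qed

text \<open>Some f in \<open>I\<close> outside \<open>J\<close> would have a multiple r f whose
  annihilator modulo \<open>J\<close> is prime. Local equality at that prime yields s outside it
  with s f in \<open>J\<close>, yet such an s annihilates r f.\<close>

lemma loc_eq_on_Ass_subset:
  assumes "is_ideal (I::'a set)" "is_ideal J" "\<And>P. P \<in> Ass J \<Longrightarrow> loc I P = loc J P"
  shows "I \<subseteq> J"
proof (rule ccontr)
  assume "\<not> I \<subseteq> J"
  then obtain f where f: "f \<in> I" "f \<notin> J" by auto
  obtain r where r: "is_prime_ideal {q. q * (r * f) \<in> J}" "r * f \<notin> J"
    using ex_prime_colon[OF assms(2) f(2)] by metis
  let ?P = "{q. q * (r * f) \<in> J}"
  have "?P \<in> Ass J" using r by (auto simp: Ass_def)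
  then have "f \<in> loc J ?P" using subset_loc[OF r(1), of I] assms(3) f by blast
  then obtain s where s: "s \<notin> ?P" "s * f \<in> J" by (auto simp: loc_def)
  have "s * (r * f) \<in> J" using ideal_mult[OF assms(2) s(2), of r] by (simp add: mult_ac)
  with s show False by simp
qed

text \<open>Take \<open>J\<close> maximal among the ideals with infinitely many associated primes,
  and P = J : f. The multiples of f form a copy of R/P in R/J with quotient R/(J + (f)), so only P
  can be lost on passing to the strictly larger J + (f).\<close>

lemma finite_Ass:
  assumes "is_ideal (I::'a set)" shows "finite (Ass I)"
proof (rule ccontr)
  assume "infinite (Ass I)"
  then have "{I::'a set. is_ideal I \<and> infinite (Ass I)} \<noteq> {}" using assms by blast
  then obtain J where J: "is_ideal (J::'a set)" "infinite (Ass J)"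
    and mx: "\<And>J'. is_ideal J' \<Longrightarrow> infinite (Ass J') \<Longrightarrow> J \<subseteq> J' \<Longrightarrow> J' = J"
    using maximal_ideal_in[of "{I::'a set. is_ideal I \<and> infinite (Ass I)}"] by (smt (verit) mem_Collect_eq)
  obtain P where "P \<in> Ass J" using J(2) by fastforce
  then obtain f where P: "is_prime_ideal P" "P = {g. g * f \<in> J}" by (auto simp: Ass_def)
  have f: "f \<notin> J" using prime_one[OF P(1)] P(2) by simp
  let ?J = "{a + r * f | a r. a \<in> J}"
  have "Ass J \<subseteq> insert P (Ass ?J)"
  proof
    fix Q assume "Q \<in> Ass J"
    then obtain h where Q: "is_prime_ideal Q" "Q = {g. g * h \<in> J}" by (auto simp: Ass_def)
    show "Q \<in> insert P (Ass ?J)"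
    proof (cases "\<exists>x. x * h \<in> ?J \<and> x * h \<notin> J")
      \<comment> \<open>Here the copy of R/Q generated by h meets the copy of R/P. Nonzero elements
        of R/Q have annihilator Q and those of R/P have annihilator P, so P = Q.\<close>
      case True
      then obtain x a r where x: "x * h = a + r * f" "a \<in> J" "x * h \<notin> J" by auto
      have rf: "r * f \<notin> J" using x ideal_add[OF J(1)] by metis
      have "x \<notin> Q" "r \<notin> P" using Q P x rf by auto
      have "q \<in> P \<longleftrightarrow> q \<in> Q" for q
      proof -
        have "q \<in> Q \<longleftrightarrow> q * x \<in> Q"
          using \<open>x \<notin> Q\<close> Q(1) prime_mult ideal_mult_right prime_is_ideal by blast
        also have "\<dots> \<longleftrightarrow> q * a + q * r * f \<in> J"
          using x Q(2) by (simp add: mult.assoc distrib_left)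
        also have "\<dots> \<longleftrightarrow> q * r * f \<in> J"
          using ideal_add[OF J(1)] ideal_diff[OF J(1)] ideal_mult[OF J(1) x(2), of q] by (metis add_diff_cancel_left')
        also have "\<dots> \<longleftrightarrow> q * r \<in> P" using P by simp
        also have "\<dots> \<longleftrightarrow> q \<in> P"
          using \<open>r \<notin> P\<close> P(1) prime_mult ideal_mult_right prime_is_ideal by blast
        finally show ?thesis by simp
      qed
      then show ?thesis by auto
    next
      case False
      have "J \<subseteq> ?J" by (auto, metis add.right_neutral mult_zero_left)
      then have "Q = {g. g * h \<in> ?J}" using False Q(2) by blast
      then show ?thesis using Q(1) by (auto simp: Ass_def)
    qed
  qed
  then have "infinite (Ass ?J)" using J(2) finite_subset by auto
  moreover have "J \<subseteq> ?J" by (auto, metis add.right_neutral mult_zero_left)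
  ultimately have "?J = J" using mx sum_principal_ideal[OF J(1)] by blast
  moreover have "f \<in> ?J" using ideal_zero[OF J(1)] by (metis (mono_tags, lifting) CollectI add_0 mult_1)
  ultimately show False using f by simp
qed

text \<open>Forming the colon by \<open>Q\<close> commutes with localization because
  \<open>Q\<close> is finitely generated: the product of the denominators for the generators serves
  all of \<open>Q\<close>.\<close>

lemma common_denominator:
  assumes X: "is_ideal (X::'a set)" and P: "is_prime_ideal P" and Q: "is_ideal Q"
    and sub: "\<And>q. q \<in> Q \<Longrightarrow> q * g \<in> loc X P"
  obtains s where "s \<notin> P" "\<And>q. q \<in> Q \<Longrightarrow> q * (s * g) \<in> X"
proof -
  obtain B where B: "finite B" "B \<subseteq> Q" "\<And>J'. is_ideal J' \<Longrightarrow> B \<subseteq> J' \<Longrightarrow> Q \<subseteq> J'"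
    using finitely_generated[OF Q] by metis
  have "\<forall>b\<in>B. \<exists>s. s \<notin> P \<and> s * (b * g) \<in> X" using B(2) sub by (auto simp: loc_def)
  then obtain s where s: "\<And>b. b \<in> B \<Longrightarrow> s b \<notin> P \<and> s b * (b * g) \<in> X" by metis
  have "b * (prod s B * g) \<in> X" if "b \<in> B" for b
  proof -
    have "b * (prod s B * g) = prod s (B - {b}) * (s b * (b * g))"
      using prod.remove[OF B(1) that, of s] by (simp add: mult_ac)
    then show ?thesis using s that ideal_mult[OF X] by simp
  qed
  then have "Q \<subseteq> {q. q * (prod s B * g) \<in> X}" using B(3)[OF colon_ideal[OF X]] by blast
  moreover have "prod s B \<notin> P" using prime_prod[OF P B(1)] s by blast
  ultimately show ?thesis using that by blast
qed

text \<open>Clearing denominators turns a witness h modulo \<open>loc X P\<close> into a witness s h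
  modulo \<open>X\<close> with the same annihilator.\<close>

lemma Ass_loc:
  assumes X: "is_ideal (X::'a set)" and P: "is_prime_ideal P" and Q: "Q \<in> Ass (loc X P)"
  shows "Q \<in> Ass X" "Q \<subseteq> P"
proof -
  obtain h where Q': "is_prime_ideal Q" "Q = {g. g * h \<in> loc X P}" using Q by (auto simp: Ass_def)
  have h: "h \<notin> loc X P" using prime_one[OF Q'(1)] Q'(2) by simp
  then show "Q \<subseteq> P" using loc_cancel[OF P] Q'(2) by blast
  obtain s where s: "s \<notin> P" "\<And>q. q \<in> Q \<Longrightarrow> q * (s * h) \<in> X"
    using common_denominator[OF X P prime_is_ideal[OF Q'(1)]] Q'(2) by blast
  have "q \<in> Q" if "q * (s * h) \<in> X" for q
    using that s(1) loc_cancel[OF P s(1), of "q * h" X] subset_loc[OF P, of X] Q'(2) by (auto simp: mult_ac)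
  then have "Q = {g. g * (s * h) \<in> X}" using s(2) by blast
  then show "Q \<in> Ass X" using Q'(1) by (auto simp: Ass_def)
qed

lemma colpow_loc:
  assumes X: "is_ideal (X::'a set)" and P: "is_prime_ideal P"
  shows "colpow (loc X P) P N \<subseteq> loc (colpow X P N) P"
proof (induction N)
  case (Suc N)
  show ?case
  proof
    fix g assume g: "g \<in> colpow (loc X P) P (Suc N)"
    have "q * g \<in> loc (colpow X P N) P" if "q \<in> P" for q
      using g that Suc by (auto simp: colpow_Suc mult.commute)
    then obtain s where "s \<notin> P" "\<And>q. q \<in> P \<Longrightarrow> q * (s * g) \<in> colpow X P N"
      using common_denominator[OF colpow_ideal[OF X] P prime_is_ideal[OF P]] by blast
    then show "g \<in> loc (colpow X P (Suc N)) P" by (auto simp: loc_def colpow_Suc mult_ac)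
  qed
qed simp

text \<open>The saturation of X R_P by P has as associated primes only those of X strictly inside P,
  so membership can be checked there. The saturation is reached as a stationary colon C: a prime C :
  (r g) cannot contain P, since C : P = C.\<close>

lemma mem_saturation_if_mem_loc_below:
  assumes X: "is_ideal (X::'a set)" and P: "is_prime_ideal P"
    and g: "\<And>Q. Q \<in> Ass X \<Longrightarrow> Q \<subset> P \<Longrightarrow> g \<in> loc X Q"
  obtains s N where "s \<notin> P" "s * g \<in> colpow X P N"
proof -
  note L = loc_ideal[OF X P]
  obtain N where N: "colpow (loc X P) P (Suc N) = colpow (loc X P) P N"
    using chain_stabilizes[of "colpow (loc X P) P", OF colpow_ideal[OF L] colpow_subset_Suc[OF L]] by metis
  let ?C = "colpow (loc X P) P N"
  have "g \<in> ?C"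
  proof (rule ccontr)
    assume "g \<notin> ?C"
    then obtain r where r: "is_prime_ideal {q. q * (r * g) \<in> ?C}" "r * g \<notin> ?C"
      using ex_prime_colon[OF colpow_ideal[OF L]] by metis
    define Q where "Q = {q. q * (r * g) \<in> ?C}"
    have Qp: "is_prime_ideal Q" using r Q_def by simp
    have "r * g \<notin> colpow (loc X P) P (Suc N)" using N r by simp
    then obtain p where p: "p \<in> P" "p \<notin> Q" by (auto simp: colpow_Suc Q_def mult_ac)
    have LC: "loc X P \<subseteq> ?C" using colpow_mono[OF L, of 0 N P] by simp
    \<comment> \<open>Multiplication by p^N turns a witness modulo C into one modulo
      \<open>loc X P\<close>: the product of C and P^N lies in \<open>loc X P\<close>, and p^N can
      be cancelled because the prime Q does not contain p.\<close>
    have "Q = {q. q * (r * g * p ^ N) \<in> loc X P}"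
    proof (intro equalityI subsetI)
      fix q assume "q \<in> Q"
      then have "q * (r * g) \<in> ?C" by (simp add: Q_def)
      moreover have "length (replicate N p) = N" "set (replicate N p) \<subseteq> P" using p(1) by auto
      ultimately have "q * (r * g) * prod_list (replicate N p) \<in> loc X P"
        unfolding colpow_def mem_Collect_eq by blast
      then show "q \<in> {q. q * (r * g * p ^ N) \<in> loc X P}" by (simp add: mult.assoc)
    next
      fix q assume "q \<in> {q. q * (r * g * p ^ N) \<in> loc X P}"
      then have "q * p ^ N \<in> Q" using LC by (auto simp: Q_def mult_ac)
      then show "q \<in> Q" using prime_mult[OF Qp] prime_power[OF Qp p(2)] by blast
    qed
    then have "Q \<in> Ass (loc X P)" using Qp by (auto simp: Ass_def)
    then have "Q \<in> Ass X" "Q \<subset> P" using Ass_loc[OF X P] p by blast+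
    then obtain s where s: "s \<notin> Q" "s * g \<in> X" using g by (auto simp: loc_def)
    have "r * (s * g) \<in> ?C" using s(2) subset_loc[OF P] LC ideal_mult[OF colpow_ideal[OF L]] by blast
    then show False using s(1) by (simp add: Q_def mult_ac)
  qed
  then have "g \<in> loc (colpow X P N) P" using colpow_loc[OF X P] by blast
  then show ?thesis using that by (auto simp: loc_def)
qed

text \<open>The conclusion says that P^N lies in L, with one exponent although k depends on p.
  Uniformity comes from a stationary colon C: if C were proper, a prime colon C : r would contain P,
  so r would lie in C : P = C.\<close>

lemma ex_colpow_one:
  assumes L: "is_ideal (L::'a set)" and k: "\<And>p. p \<in> P \<Longrightarrow> \<exists>k. p ^ k \<in> L"
  obtains N where "1 \<in> colpow L P N"
proof -
  obtain N where N: "colpow L P (Suc N) = colpow L P N"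
    using chain_stabilizes[of "colpow L P", OF colpow_ideal[OF L] colpow_subset_Suc[OF L]] by metis
  have "1 \<in> colpow L P N"
  proof (rule ccontr)
    assume "1 \<notin> colpow L P N"
    then obtain r where r: "is_prime_ideal {q. q * (r * 1) \<in> colpow L P N}" "r * 1 \<notin> colpow L P N"
      using ex_prime_colon[OF colpow_ideal[OF L]] by metis
    have "p * r \<in> colpow L P N" if "p \<in> P" for p
    proof -
      obtain k where "p ^ k \<in> L" using k[OF \<open>p \<in> P\<close>] by auto
      then have "p ^ k * r \<in> colpow L P N"
        using colpow_mono[OF L, of 0 N P] ideal_mult_right[OF L] by auto
      then show ?thesis using prime_power[OF r(1), of p k] by auto
    qed
    then have "r \<in> colpow L P (Suc N)" by (auto simp: colpow_Suc mult_ac)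
    then show False using N r by simp
  qed
  then show ?thesis using that by blast
qed

text \<open>Enlarging the ideal so that it contains
  \<open>P f\<close> makes \<open>f\<close> a socle element, which forces a maximal such ideal to be \<open>P\<close>-primary.\<close>

lemma krull_separation:
  assumes I: "is_ideal (I::'a set)" and P: "is_prime_ideal P" and f: "f \<notin> loc I P"
  obtains L K where "is_ideal L" "I \<subseteq> L" "1 \<in> colpow L P K" "f \<notin> loc L P"
proof -
  define \<C> where "\<C> = {X. is_ideal X \<and> I \<subseteq> X \<and> (\<forall>p\<in>P. p * f \<in> X) \<and> f \<notin> loc X P}"
  note P' = prime_is_ideal[OF P]
  let ?X = "{a + p * f | a p. a \<in> I \<and> p \<in> P}"
  have "is_ideal ?X"
  proof (rule is_idealI)
    show "0 \<in> ?X" using ideal_zero[OF I] ideal_zero[OF P'] by force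
    fix x assume "x \<in> ?X"
    then obtain a p where x: "x = a + p * f" "a \<in> I" "p \<in> P" by auto
    show "c * x \<in> ?X" for c
      using x ideal_mult[OF I, of a c] ideal_mult[OF P', of p c]
      by (smt (verit) CollectI distrib_left mult.assoc)
    fix y assume "y \<in> ?X"
    then obtain b q where y: "y = b + q * f" "b \<in> I" "q \<in> P" by auto
    show "x + y \<in> ?X"
      using x y ideal_add[OF I, of a b] ideal_add[OF P', of p q]
      by (smt (verit) CollectI add.assoc add.left_commute distrib_right)
  qed
  moreover have "I \<subseteq> ?X" using ideal_zero[OF P'] by force
  moreover have "p * f \<in> ?X" if "p \<in> P" for p using that ideal_zero[OF I] by force
  \<comment> \<open>Nakayama's lemma by hand: s f = a + p f gives (s - p) f in \<open>I\<close>, and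
    s - p stays outside P.\<close>
  moreover have "f \<notin> loc ?X P"
  proof
    assume "f \<in> loc ?X P"
    then obtain s a p where s: "s \<notin> P" "s * f = a + p * f" "a \<in> I" "p \<in> P" by (auto simp: loc_def)
    have "(s - p) * f \<in> I" using s by (simp add: algebra_simps)
    moreover have "s - p \<notin> P" using ideal_add[OF P', of "s - p" p] s by auto
    ultimately show False using f by (auto simp: loc_def)
  qed
  ultimately have "\<C> \<noteq> {}" unfolding \<C>_def by blast
  then obtain L where "L \<in> \<C>" and mx: "\<And>J. J \<in> \<C> \<Longrightarrow> L \<subseteq> J \<Longrightarrow> J = L"
    using maximal_ideal_in[of \<C>] unfolding \<C>_def by (smt (verit) mem_Collect_eq)
  then have L: "is_ideal L" "I \<subseteq> L" "\<And>p. p \<in> P \<Longrightarrow> p * f \<in> L" "f \<notin> loc L P" by (auto simp: \<C>_def)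
  have "\<exists>k. p ^ k \<in> L" if p: "p \<in> P" for p
  proof -
    have "is_ideal {r. r * p ^ n \<in> L}" for n by (rule colon_ideal[OF L(1)])
    moreover have "{r. r * p ^ n \<in> L} \<subseteq> {r. r * p ^ Suc n \<in> L}" for n
      using ideal_mult[OF L(1), of _ p] by (auto simp: mult.left_commute[of _ p])
    ultimately obtain k where k: "{r. r * p ^ Suc k \<in> L} = {r. r * p ^ k \<in> L}"
      using chain_stabilizes[of "\<lambda>n. {r. r * p ^ n \<in> L}"] by metis
    let ?J = "{a + r * p ^ k | a r. a \<in> L}"
    have LJ: "L \<subseteq> ?J" by (auto, metis add.right_neutral mult_zero_left)
    have "f \<notin> loc ?J P"
    proof
      assume "f \<in> loc ?J P"
      then obtain s a r where s: "s \<notin> P" "s * f = a + r * p ^ k" "a \<in> L" by (auto simp: loc_def)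
      \<comment> \<open>Multiplying by p brings in p f, which lies in L. Stability of L : p^k then
        removes the extra factor p, so adding p^k to L does not capture f, and maximality puts p^k
        into L.\<close>
      have "r * p ^ Suc k = s * (p * f) - p * a"
        using arg_cong[OF s(2), of "\<lambda>x. p * x"] by (simp add: algebra_simps)
      also have "\<dots> \<in> L" using ideal_diff[OF L(1) ideal_mult[OF L(1) L(3)[OF p]] ideal_mult[OF L(1) s(3)]] .
      finally have "r \<in> {r. r * p ^ Suc k \<in> L}" by simp
      then have "r * p ^ k \<in> L" unfolding k by simp
      then have "s * f \<in> L" using s ideal_add[OF L(1)] by simp
      then show False using L(4) s(1) by (auto simp: loc_def)
    qed
    then have "?J \<in> \<C>" using L LJ sum_principal_ideal[OF L(1)] unfolding \<C>_def by blast
    then have "?J = L" using mx LJ by blast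
    moreover have "p ^ k \<in> ?J" using ideal_zero[OF L(1)] by (metis (mono_tags, lifting) CollectI add_0 mult_1)
    ultimately show ?thesis by auto
  qed
  then obtain K where "1 \<in> colpow L P K" using ex_colpow_one[OF L(1)] by blast
  then show ?thesis using that L by blast
qed

end

subsection \<open>The Hilbert basis theorem\<close>

text \<open>A monotone subsequence exists; if it decreases, it is constant from its minimum
  on.\<close>

lemma ex_incseq_subseq:
  fixes s :: "nat \<Rightarrow> nat"
  obtains f :: "nat \<Rightarrow> nat" where "strict_mono f" "incseq (s \<circ> f)"
proof -
  obtain f where f: "strict_mono f" "monoseq (\<lambda>n. s (f n))" using seq_monosub[of s] by blast
  show thesis
  proof (cases "incseq (\<lambda>n. s (f n))")
    case True
    then show ?thesis using that f by (simp add: comp_def)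
  next
    case False
    then have dec: "\<And>m n. m \<le> n \<Longrightarrow> s (f n) \<le> s (f m)"
      using f(2) by (auto simp: monoseq_def incseq_def)
    obtain N where N: "\<And>n. s (f N) \<le> s (f n)"
      using ex_has_least_nat[of "\<lambda>_. True" 0 "\<lambda>n. s (f n)"] by auto
    have "s (f (N + n)) = s (f N)" for n using dec[of N "N + n"] N[of "N + n"] by simp
    then have "incseq (s \<circ> (\<lambda>n. f (N + n)))" by (simp add: incseq_def)
    moreover have "strict_mono (\<lambda>n. f (N + n))" using f(1) by (simp add: strict_mono_def)
    ultimately show ?thesis using that by blast
  qed
qed

lemma dickson:
  fixes m :: "nat \<Rightarrow> 'v::finite \<Rightarrow> nat"
  obtains i j where "i < j" "\<And>v. m i v \<le> m j v"
proof -
  have "\<exists>f::nat \<Rightarrow> nat. strict_mono f \<and> (\<forall>v\<in>A. incseq (\<lambda>n. m (f n) v))" if "finite A" for A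
    using that
  proof (induction A)
    case empty
    then show ?case by (auto intro: exI[of _ id] simp: strict_mono_def)
  next
    case (insert a A)
    then obtain f :: "nat \<Rightarrow> nat" where f: "strict_mono f" "\<And>v. v \<in> A \<Longrightarrow> incseq (\<lambda>n. m (f n) v)" by auto
    obtain g :: "nat \<Rightarrow> nat" where g: "strict_mono g" "incseq ((\<lambda>n. m (f n) a) \<circ> g)"
      using ex_incseq_subseq by blast
    have "incseq (\<lambda>n. m (f (g n)) v)" if "v \<in> A" for v
      using f(2)[OF that] strict_mono_mono[OF g(1)] by (auto simp: incseq_def mono_def)
    then show ?case using g f(1) by (intro exI[of _ "f \<circ> g"]) (auto simp: comp_def strict_mono_def)
  qed
  from this[of UNIV] obtain f :: "nat \<Rightarrow> nat" where f: "strict_mono f" "\<And>v. incseq (\<lambda>n. m (f n) v)" by auto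
  show thesis
    by (rule that[of "f 0" "f 1"]) (use f in \<open>auto simp: strict_mono_def incseq_def\<close>)
qed

text \<open>The order on exponents is lexicographic, decided by the least variable where they
  differ. It extends divisibility of monomials, so Dickson's lemma makes it well-founded.\<close>

lemma monomial_le_if_pointwise_le:
  fixes a b :: "'v::{finite,linorder} \<Rightarrow>\<^sub>0 nat"
  assumes "\<And>v. Poly_Mapping.lookup a v \<le> Poly_Mapping.lookup b v" shows "a \<le> b"
proof (cases "a = b")
  case False
  let ?D = "{v. Poly_Mapping.lookup a v \<noteq> Poly_Mapping.lookup b v}"
  have "?D \<noteq> {}" using False by (auto intro: poly_mapping_eqI)
  then have "Min ?D \<in> ?D" by (intro Min_in) auto
  moreover have "Poly_Mapping.lookup a v = Poly_Mapping.lookup b v" if "v < Min ?D" for v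
    using that Min_le[of ?D v] by fastforce
  moreover have "Poly_Mapping.lookup a (Min ?D) < Poly_Mapping.lookup b (Min ?D)"
    using assms[of "Min ?D"] \<open>Min ?D \<in> ?D\<close> by (simp only: mem_Collect_eq)
  ultimately have "less_fun (Poly_Mapping.lookup a) (Poly_Mapping.lookup b)"
    unfolding less_fun_def by blast
  then show ?thesis by (simp add: less_eq_poly_mapping.rep_eq)
qed simp

lemma wf_monomial_less: "wf {(a, b::'v::{finite,linorder} \<Rightarrow>\<^sub>0 nat). a < b}"
  unfolding wf_iff_no_infinite_down_chain
proof
  assume "\<exists>m::nat \<Rightarrow> 'v \<Rightarrow>\<^sub>0 nat. \<forall>i. (m (Suc i), m i) \<in> {(a, b). a < b}"
  then obtain m :: "nat \<Rightarrow> 'v \<Rightarrow>\<^sub>0 nat" where m: "\<And>i. m (Suc i) < m i" by auto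
  obtain i j where ij: "i < j" "\<And>v. Poly_Mapping.lookup (m i) v \<le> Poly_Mapping.lookup (m j) v"
    using dickson[of "\<lambda>n. Poly_Mapping.lookup (m n)"] by metis
  have "m j < m i" using ij(1) by (induction rule: less_Suc_induct) (auto intro: m less_trans)
  then show False using monomial_le_if_pointwise_le[OF ij(2)] by simp
qed

lemma poly_mapping_sum_single: "(\<Sum>m\<in>Poly_Mapping.keys F. Poly_Mapping.single m (Poly_Mapping.lookup F m)) = F"
proof (rule poly_mapping_eqI)
  fix k
  have "Poly_Mapping.lookup (\<Sum>m\<in>Poly_Mapping.keys F. Poly_Mapping.single m (Poly_Mapping.lookup F m)) k
      = (\<Sum>m\<in>Poly_Mapping.keys F. if m = k then Poly_Mapping.lookup F k else 0)"
    by (auto simp: lookup_sum lookup_single when_def intro!: sum.cong)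
  then show "Poly_Mapping.lookup (\<Sum>m\<in>Poly_Mapping.keys F. Poly_Mapping.single m (Poly_Mapping.lookup F m)) k = Poly_Mapping.lookup F k"
    by (simp add: in_keys_iff)
qed

lemma single_mult_eq_sum:
  fixes F :: "'m::comm_monoid_add \<Rightarrow>\<^sub>0 'k::comm_semiring_0"
  shows "Poly_Mapping.single d c * F = (\<Sum>m\<in>Poly_Mapping.keys F. Poly_Mapping.single (d + m) (c * Poly_Mapping.lookup F m))"
proof -
  have "Poly_Mapping.single d c * F
      = Poly_Mapping.single d c * (\<Sum>m\<in>Poly_Mapping.keys F. Poly_Mapping.single m (Poly_Mapping.lookup F m))"
    by (simp only: poly_mapping_sum_single)
  then show ?thesis by (simp only: sum_distrib_left mult_single)
qed

lemma lookup_single_mult: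
  fixes F :: "'m::cancel_comm_monoid_add \<Rightarrow>\<^sub>0 'k::comm_semiring_0"
  shows "Poly_Mapping.lookup (Poly_Mapping.single d c * F) (d + k) = c * Poly_Mapping.lookup F k"
  by (simp add: single_mult_eq_sum lookup_sum lookup_single when_def in_keys_iff)

text \<open>A Groebner-style argument. If J were not finitely generated, choose f n in J outside the
  ideal of its predecessors with least leading monomial. By Dickson's lemma some leading monomial
  divides a later one, and cancelling produces a smaller candidate at the later stage.\<close>

lemma noetherian_mpol: "noetherian TYPE(('v::{finite,linorder}, 'k::field) mpol)"
  unfolding noetherian_def
proof (intro allI impI)
  fix J :: "('v, 'k) mpol set"
  assume J: "is_ideal J"
  define gen where "gen B = \<Inter>{J'. is_ideal J' \<and> B \<subseteq> J'}" for B :: "('v, 'k) mpol set"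
  have gen: "is_ideal (gen B)" "B \<subseteq> gen B" for B
    unfolding gen_def by (auto simp: is_ideal_def)
  show "\<exists>B. finite B \<and> B \<subseteq> J \<and> (\<forall>J'. is_ideal J' \<longrightarrow> B \<subseteq> J' \<longrightarrow> J \<subseteq> J')"
  proof (rule ccontr)
    assume neg: "\<nexists>B. finite B \<and> B \<subseteq> J \<and> (\<forall>J'. is_ideal J' \<longrightarrow> B \<subseteq> J' \<longrightarrow> J \<subseteq> J')"
    have ex: "\<exists>g. g \<in> J \<and> g \<notin> gen B" if B: "finite B" "B \<subseteq> J" for B
    proof (rule ccontr)
      assume "\<nexists>g. g \<in> J \<and> g \<notin> gen B"
      then have "\<forall>J'. is_ideal J' \<longrightarrow> B \<subseteq> J' \<longrightarrow> J \<subseteq> J'" unfolding gen_def by blast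
      then show False using neg B by blast
    qed
    define lm where "lm F = Max (Poly_Mapping.keys F)" for F :: "('v, 'k) mpol"
    define Q where "Q f n r \<longleftrightarrow> r \<in> J \<and> r \<notin> gen (f ` {..<n}) \<and>
        (\<forall>g. g \<in> J \<longrightarrow> g \<notin> gen (f ` {..<n}) \<longrightarrow> \<not> lm g < lm r)" for f and n :: nat and r
    have "\<exists>f. \<forall>n::nat. Q f n (f n)"
    proof (rule dependent_wellorder_choice)
      fix r :: "('v, 'k) mpol" and f g :: "nat \<Rightarrow> ('v, 'k) mpol" and x :: nat
      assume "\<And>y. y < x \<Longrightarrow> f y = g y"
      then have "f ` {..<x} = g ` {..<x}" by (auto simp: image_iff)
      then show "Q f x r = Q g x r" by (simp add: Q_def)
    next
      fix x :: nat and f :: "nat \<Rightarrow> ('v, 'k) mpol"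
      assume "\<And>y. y < x \<Longrightarrow> Q f y (f y)"
      then have "f ` {..<x} \<subseteq> J" by (auto simp: Q_def)
      then obtain g where "g \<in> J \<and> g \<notin> gen (f ` {..<x})" using ex by blast
      then have "g \<in> {g \<in> J. g \<notin> gen (f ` {..<x})}" by simp
      from wfE_min[OF wf_inv_image[OF wf_monomial_less, of lm] this]
      show "\<exists>r. Q f x r" unfolding Q_def by (smt (verit) case_prod_conv in_inv_image mem_Collect_eq)
    qed
    then obtain f where f: "\<And>n. Q f n (f n)" by blast
    obtain i j where ij: "i < j" "\<And>v. Poly_Mapping.lookup (lm (f i)) v \<le> Poly_Mapping.lookup (lm (f j)) v"
      using dickson[of "\<lambda>n. Poly_Mapping.lookup (lm (f n))"] by metis
    define d where "d = lm (f j) - lm (f i)"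
    have d: "lm (f j) = d + lm (f i)"
      by (rule poly_mapping_eqI) (use ij(2) in \<open>simp add: d_def lookup_add lookup_minus\<close>)
    have lm_key: "lm (f n) \<in> Poly_Mapping.keys (f n)" for n
    proof -
      have "f n \<noteq> 0" using f[of n] ideal_zero[OF gen(1), of "f ` {..<n}"] by (auto simp: Q_def)
      then show ?thesis unfolding lm_def by (intro Max_in) auto
    qed
    define c where "c = Poly_Mapping.lookup (f j) (lm (f j)) / Poly_Mapping.lookup (f i) (lm (f i))"
    define g where "g = f j - Poly_Mapping.single d c * f i"
    have fi: "f i \<in> gen (f ` {..<j})" using ij(1) by (intro subsetD[OF gen(2)]) simp
    have gJ: "g \<in> J" unfolding g_def using f[of i] f[of j] J
      by (intro ideal_diff ideal_mult) (auto simp: Q_def)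
    have gn: "g \<notin> gen (f ` {..<j})"
    proof
      assume "g \<in> gen (f ` {..<j})"
      then have "g + Poly_Mapping.single d c * f i \<in> gen (f ` {..<j})"
        using fi by (intro ideal_add ideal_mult gen)
      then show False using f[of j] by (simp add: g_def Q_def)
    qed
    then have "g \<noteq> 0" using ideal_zero[OF gen(1), of "f ` {..<j}"] by auto
    then have "lm g \<in> Poly_Mapping.keys g" unfolding lm_def by (intro Max_in) auto
    moreover have "Poly_Mapping.lookup g (lm (f j)) = 0"
      using lm_key[of i] by (simp add: g_def lookup_minus d lookup_single_mult)
        (simp add: c_def d in_keys_iff)
    ultimately have ne: "lm g \<noteq> lm (f j)" by (auto simp: in_keys_iff)
    have "k \<le> lm (f j)" if "k \<in> Poly_Mapping.keys g" for k
    proof -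
      have "k \<in> Poly_Mapping.keys (f j) \<or> k \<in> Poly_Mapping.keys (Poly_Mapping.single d c * f i)"
        using that by (auto simp: g_def in_keys_iff lookup_minus)
      then show ?thesis
      proof
        assume "k \<in> Poly_Mapping.keys (f j)" then show ?thesis by (simp add: lm_def)
      next
        assume "k \<in> Poly_Mapping.keys (Poly_Mapping.single d c * f i)"
        then obtain l where l: "l \<in> Poly_Mapping.keys (f i)" "k = d + l"
          using keys_mult[of "Poly_Mapping.single d c" "f i"] by (auto split: if_splits)
        then have "l \<le> lm (f i)" by (simp add: lm_def)
        then show ?thesis using l d by (simp add: add_left_mono)
      qed
    qed
    with \<open>lm g \<in> Poly_Mapping.keys g\<close> ne have "lm g < lm (f j)" by fastforce
    then show False using f[of j] gJ gn by (auto simp: Q_def)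
  qed
qed

subsection \<open>Coefficient fields in characteristic zero\<close>

definition subring :: "'q::comm_ring_1 set \<Rightarrow> bool" where
  "subring A \<longleftrightarrow> 1 \<in> A \<and> (\<forall>a\<in>A. \<forall>b\<in>A. a - b \<in> A \<and> a * b \<in> A)"

lemma subring_one: "subring A \<Longrightarrow> 1 \<in> A"
  and subring_diff: "subring A \<Longrightarrow> a \<in> A \<Longrightarrow> b \<in> A \<Longrightarrow> a - b \<in> A"
  and subring_mult: "subring A \<Longrightarrow> a \<in> A \<Longrightarrow> b \<in> A \<Longrightarrow> a * b \<in> A"
  by (auto simp: subring_def)

lemma subring_zero: "subring A \<Longrightarrow> 0 \<in> A"
  using subring_diff[of A 1 1] subring_one by force

lemma subring_add: "subring A \<Longrightarrow> a \<in> A \<Longrightarrow> b \<in> A \<Longrightarrow> a + b \<in> A"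
  using subring_diff[of A a "0 - b"] subring_diff[of A 0 b] subring_zero by force

lemma subring_power: "subring A \<Longrightarrow> a \<in> A \<Longrightarrow> a ^ n \<in> A"
  by (induction n) (auto simp: subring_one subring_mult)

lemma subring_of_nat: "subring A \<Longrightarrow> of_nat n \<in> A"
  by (induction n) (auto simp: subring_zero subring_add subring_one)

lemma subring_sum: "subring A \<Longrightarrow> (\<And>i. i \<in> B \<Longrightarrow> g i \<in> A) \<Longrightarrow> sum g B \<in> A"
  by (induction B rule: infinite_finite_induct) (auto simp: subring_zero subring_add)

lemma subring_prod: "subring A \<Longrightarrow> (\<And>i. i \<in> B \<Longrightarrow> g i \<in> A) \<Longrightarrow> prod g B \<in> A"
  by (induction B rule: infinite_finite_induct) (auto simp: subring_one subring_mult)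

lemma subset_chain_two:
  assumes "subset.chain \<A> C" "a \<in> \<Union>C" "b \<in> \<Union>C"
  obtains X where "X \<in> C" "a \<in> X" "b \<in> X"
  using assms unfolding subset.chain_def by blast

lemma subring_Union_chain:
  assumes "C \<noteq> {}" "subset.chain \<A> C" "\<And>X. X \<in> C \<Longrightarrow> subring X"
  shows "subring (\<Union>C)"
  unfolding subring_def
proof (intro conjI ballI)
  show "1 \<in> \<Union>C" using assms(1,3) subring_one by blast
  fix a b assume "a \<in> \<Union>C" "b \<in> \<Union>C"
  then obtain X where "X \<in> C" "a \<in> X" "b \<in> X"
    using subset_chain_two[OF assms(2)] by blast
  then show "a - b \<in> \<Union>C" "a * b \<in> \<Union>C" using assms(3) subring_diff subring_mult by blast+
qed

abbreviation pol :: "'q::comm_ring_1 set \<Rightarrow> 'q poly set" where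
  "pol A \<equiv> {p. \<forall>i. coeff p i \<in> A}"

lemma pCons_in_pol: "pCons a p \<in> pol A \<longleftrightarrow> a \<in> A \<and> p \<in> pol A"
  by (auto simp: coeff_pCons split: nat.splits)

lemma poly_mem_subring:
  assumes "subring A" "x \<in> A" shows "p \<in> pol A \<Longrightarrow> poly p x \<in> A"
proof (induction p)
  case (pCons a p)
  then show ?case using pCons_in_pol[of a p A] assms by (auto simp: subring_add subring_mult)
qed (use assms in \<open>auto simp: subring_zero\<close>)

lemma pol_diff: "subring A \<Longrightarrow> p \<in> pol A \<Longrightarrow> q \<in> pol A \<Longrightarrow> p - q \<in> pol A"
  by (auto simp: subring_diff)

lemma pol_mult: "subring A \<Longrightarrow> p \<in> pol A \<Longrightarrow> q \<in> pol A \<Longrightarrow> p * q \<in> pol A"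
  by (auto simp: coeff_mult intro!: subring_sum subring_mult)

lemma pol_monom: "subring A \<Longrightarrow> a \<in> A \<Longrightarrow> monom a n \<in> pol A"
  by (auto simp: subring_zero)

lemma pol_pderiv: "subring A \<Longrightarrow> p \<in> pol A \<Longrightarrow> pderiv p \<in> pol A"
  by (auto simp: coeff_pderiv simp del: of_nat_Suc intro!: subring_mult subring_of_nat)

text \<open>The remainder stays in the subring, so that a Newton step can gain powers of h.\<close>

lemma poly_taylor2:
  assumes A: "subring A" "x \<in> A" "h \<in> A"
  shows "p \<in> pol A \<Longrightarrow> \<exists>r\<in>A. poly p (x + h) = poly p x + h * poly (pderiv p) x + h ^ 2 * r"
proof (induction p)
  case 0
  then show ?case using A by (auto intro: bexI[of _ 0] simp: subring_zero)
next
  case (pCons a p)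
  then have p: "p \<in> pol A" using pCons_in_pol by blast
  then obtain r where r: "r \<in> A" "poly p (x + h) = poly p x + h * poly (pderiv p) x + h ^ 2 * r"
    using pCons by blast
  have "poly (pCons a p) (x + h) = poly (pCons a p) x + h * poly (pderiv (pCons a p)) x
      + h ^ 2 * (poly (pderiv p) x + (x + h) * r)"
    unfolding poly_pCons pderiv_pCons r(2) by (simp add: algebra_simps power2_eq_square)
  moreover have "poly (pderiv p) x + (x + h) * r \<in> A"
    using A r p by (intro subring_add subring_mult poly_mem_subring pol_pderiv)
  ultimately show ?case by blast
qed

text \<open>The ring sits inside an ambient field, so inverses of units come from the field, and the
  residue field is replaced by congruence modulo \<open>M\<close>. In the application the field is
  the fraction field of R and the ring is R_P.\<close>

locale local_ring =
  fixes \<O> M :: "'q::field set"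
  assumes O: "subring \<O>" and M_sub: "M \<subseteq> \<O>"
    and M_add: "a \<in> M \<Longrightarrow> b \<in> M \<Longrightarrow> a + b \<in> M"
    and M_mult: "r \<in> \<O> \<Longrightarrow> a \<in> M \<Longrightarrow> r * a \<in> M"
    and M_one: "1 \<notin> M" and M_zero: "0 \<in> M"
    and inv: "a \<in> \<O> \<Longrightarrow> a \<notin> M \<Longrightarrow> inverse a \<in> \<O>"
begin

lemma M_diff: "a \<in> M \<Longrightarrow> b \<in> M \<Longrightarrow> a - b \<in> M"
  using M_add[of a "(0 - 1) * b"] M_mult[of "0 - 1" b] subring_diff[OF O, of 0 1] O
  by (simp add: subring_zero subring_one)

lemma M_prime: "a \<in> \<O> \<Longrightarrow> a \<notin> M \<Longrightarrow> a * b \<in> M \<Longrightarrow> b \<in> M"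
  using M_mult[OF inv[of a], of "a * b"] M_zero
  by (cases "a = 0") (auto simp: mult.assoc[symmetric])

lemma M_sum: "(\<And>i. i \<in> B \<Longrightarrow> g i \<in> M) \<Longrightarrow> sum g B \<in> M"
  by (induction B rule: infinite_finite_induct) (auto simp: M_zero M_add)

lemma M_cong_trans: "a - b \<in> M \<Longrightarrow> b - c \<in> M \<Longrightarrow> a - c \<in> M"
  using M_add[of "a - b" "b - c"] by simp

lemma M_cong_sym: "a - b \<in> M \<Longrightarrow> b - a \<in> M"
  using M_diff[OF M_zero, of "a - b"] by simp

lemma M_cong_mem: "a - b \<in> M \<Longrightarrow> a \<in> M \<longleftrightarrow> b \<in> M"
  using M_add[of "a - b" b] M_diff[of a "a - b"] by auto

lemma M_cong_mult:
  assumes "a - b \<in> M" "c - d \<in> M" "a \<in> \<O>" "d \<in> \<O>"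
  shows "a * c - b * d \<in> M"
proof -
  have "a * c - b * d = a * (c - d) + d * (a - b)" by (simp add: algebra_simps)
  then show ?thesis using assms by (simp add: M_add M_mult)
qed

lemma M_cong_power: "a - b \<in> M \<Longrightarrow> a \<in> \<O> \<Longrightarrow> b \<in> \<O> \<Longrightarrow> a ^ n - b ^ n \<in> M"
  by (induction n) (auto simp: M_zero intro!: M_cong_mult subring_power[OF O])

lemma M_cong_prod:
  assumes "\<And>i. i \<in> B \<Longrightarrow> a i - b i \<in> M" "\<And>i. i \<in> B \<Longrightarrow> a i \<in> \<O>" "\<And>i. i \<in> B \<Longrightarrow> b i \<in> \<O>"
  shows "prod a B - prod b B \<in> M"
  using assms by (induction B rule: infinite_finite_induct)
    (auto simp: M_zero intro!: M_cong_mult subring_prod[OF O])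

lemma M_cong_poly:
  assumes "x \<in> \<O>" "y \<in> \<O>" "x - y \<in> M"
  shows "p \<in> pol \<O> \<Longrightarrow> poly p x - poly p y \<in> M"
proof (induction p)
  case (pCons a p)
  then have "p \<in> pol \<O>" using pCons_in_pol by blast
  then show ?case using pCons assms M_cong_mult[of x y "poly p x" "poly p y"]
    by (simp add: poly_mem_subring[OF O])
qed (simp add: M_zero)

end

text \<open>Congruence modulo \<open>N\<close> stands for the quotient ring, whose maximal ideal is
  nil with exponent \<open>K\<close>. By \<open>char0\<close> the residue field has characteristic
  zero.\<close>

locale local_ring_quotient = local_ring +
  fixes N :: "'q::field set" and K :: nat
  assumes N_sub: "N \<subseteq> M"
    and N_add: "a \<in> N \<Longrightarrow> b \<in> N \<Longrightarrow> a + b \<in> N"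
    and N_mult: "r \<in> \<O> \<Longrightarrow> a \<in> N \<Longrightarrow> r * a \<in> N"
    and N_zero: "0 \<in> N"
    and N_power: "a \<in> M \<Longrightarrow> a ^ K \<in> N"
    and char0: "of_nat (Suc n) \<notin> M"
begin

lemma poly_mem_N:
  assumes "x \<in> \<O>" shows "p \<in> pol N \<Longrightarrow> poly p x \<in> N"
proof (induction p)
  case (pCons a p)
  then show ?case using pCons_in_pol[of a p N] assms by (auto simp: N_add N_mult)
qed (simp add: N_zero)

lemma poly_mem_M:
  assumes "x \<in> \<O>" shows "p \<in> pol M \<Longrightarrow> poly p x \<in> M"
proof (induction p)
  case (pCons a p)
  then show ?case using pCons_in_pol[of a p M] assms by (auto simp: M_add M_mult)
qed (simp add: M_zero)

text \<open>Hensel lifting by Newton's iteration. Finitely many rounds suffice because the K-th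
  power of G(theta) lies in \<open>N\<close>; each round need only gain one further power.\<close>

lemma newton_lift:
  assumes G: "G \<in> pol \<O>" and \<theta>: "\<theta> \<in> \<O>" "poly G \<theta> \<in> M" "poly (pderiv G) \<theta> \<notin> M"
  obtains x where "x \<in> \<O>" "x - \<theta> \<in> M" "poly G x \<in> N"
proof -
  have "\<exists>x r. x \<in> \<O> \<and> x - \<theta> \<in> M \<and> r \<in> \<O> \<and> poly G x = poly G \<theta> ^ Suc k * r" for k
  proof (induction k)
    case 0
    show ?case using \<theta> M_zero subring_one[OF O] by (intro exI[of _ \<theta>] exI[of _ 1]) auto
  next
    case (Suc k)
    then obtain x r where x: "x \<in> \<O>" "x - \<theta> \<in> M" "r \<in> \<O>" "poly G x = poly G \<theta> ^ Suc k * r" by blast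
    let ?d = "poly (pderiv G) x" and ?g = "poly G \<theta>"
    have G': "pderiv G \<in> pol \<O>" by (rule pol_pderiv[OF O G])
    have d: "?d \<notin> M" using M_cong_mem[OF M_cong_poly[OF x(1) \<theta>(1) x(2) G']] \<theta>(3) by simp
    then have "?d \<noteq> 0" using M_zero by auto
    have di: "inverse ?d \<in> \<O>" using d inv poly_mem_subring[OF O x(1) G'] by simp
    have g: "?g \<in> \<O>" using \<theta> M_sub by blast
    \<comment> \<open>The Newton step is h = -G(x)/G'(x); one factor G(theta) is split off so that h
      visibly lies in \<open>M\<close>.\<close>
    define c where "c = (0 - inverse ?d) * (?g ^ k * r)"
    have c: "c \<in> \<O>" unfolding c_def
      using di x(3) g O by (intro subring_mult subring_diff subring_power subring_zero)
    define h where "h = ?g * c"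
    have h: "h \<in> M" using M_mult[OF c \<theta>(2)] by (simp add: h_def mult.commute)
    have hd: "h * ?d = - poly G x" using \<open>?d \<noteq> 0\<close> by (simp add: h_def c_def x(4))
    obtain s where s: "s \<in> \<O>" "poly G (x + h) = poly G x + h * ?d + h ^ 2 * s"
      using poly_taylor2[OF O x(1) _ G, of h] h M_sub by blast
    have "poly G (x + h) = h ^ 2 * s" using s(2) hd by simp
    also have "\<dots> = ?g ^ Suc (Suc k) * ((inverse ?d) ^ 2 * ?g ^ k * r ^ 2 * s)"
      by (simp add: h_def c_def power2_eq_square algebra_simps)
    finally have "poly G (x + h) = ?g ^ Suc (Suc k) * ((inverse ?d) ^ 2 * ?g ^ k * r ^ 2 * s)" .
    moreover have "(inverse ?d) ^ 2 * ?g ^ k * r ^ 2 * s \<in> \<O>"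
      using di g x(3) s(1) O by (intro subring_mult subring_power)
    moreover have "x + h \<in> \<O>" using x(1) h M_sub by (intro subring_add[OF O]) auto
    moreover have "x + h - \<theta> \<in> M" using M_add[OF x(2) h] by (simp add: algebra_simps)
    ultimately show ?case by blast
  qed
  then obtain x r where x: "x \<in> \<O>" "x - \<theta> \<in> M" "r \<in> \<O>" "poly G x = poly G \<theta> ^ Suc K * r" by blast
  have "poly G x = (r * poly G \<theta>) * poly G \<theta> ^ K" using x(4) by (simp add: mult_ac)
  moreover have "r * poly G \<theta> \<in> \<O>" using M_mult[OF x(3) \<theta>(2)] M_sub by blast
  ultimately show ?thesis using that x(1,2) N_mult N_power[OF \<theta>(2)] by metis
qed

text \<open>A relation of minimal degree for \<open>\<theta>\<close> over the residue field of \<open>F\<close> is separable in characteristic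
  zero, so its root lifts; if there is no relation, any lift of \<open>\<theta>\<close> will do. "Degree" means the index of
  the last coefficient outside \<open>M\<close>, which avoids passing to the quotient.\<close>

lemma adjoin_lift:
  assumes F: "subring F" "F \<subseteq> \<O>" "F \<inter> M \<subseteq> N" "\<And>a. a \<in> F \<Longrightarrow> a \<notin> M \<Longrightarrow> inverse a \<in> F"
    and \<theta>: "\<theta> \<in> \<O>"
  obtains x where "x \<in> \<O>" "x - \<theta> \<in> M" "\<And>A. A \<in> pol F \<Longrightarrow> poly A x \<in> M \<Longrightarrow> poly A x \<in> N"
proof -
  define R where "R G d \<longleftrightarrow> G \<in> pol F \<and> poly G \<theta> \<in> M \<and> coeff G d \<notin> M \<and> (\<forall>i>d. coeff G i \<in> M)" for G d
  have FO: "A \<in> pol \<O>" if "A \<in> pol F" for A using that F(2) by auto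
  have top: "\<exists>d. R A d" if "A \<in> pol F" "poly A \<theta> \<in> M" "coeff A i \<notin> M" for A i
  proof -
    let ?S = "{i. coeff A i \<notin> M}"
    have fin: "finite ?S"
      by (rule finite_subset[of _ "{..degree A}"]) (use M_zero in \<open>auto intro: ccontr simp: coeff_eq_0\<close>)
    have "Max ?S \<in> ?S" using that(3) fin by (intro Max_in) auto
    moreover have "coeff A j \<in> M" if "j > Max ?S" for j using Max_ge[OF fin, of j] that by force
    ultimately have "R A (Max ?S)" using that(1,2) unfolding R_def by blast
    then show ?thesis by blast
  qed
  have coeffs: "poly A x \<in> N" if "A \<in> pol F" "A \<in> pol M" "x \<in> \<O>" for A x
    using that F(3) poly_mem_N[of x A] by auto
  show thesis
  proof (cases "\<exists>d G. R G d")
    case False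
    have "poly A \<theta> \<in> N" if "A \<in> pol F" "poly A \<theta> \<in> M" for A
      using coeffs[OF that(1) _ \<theta>] top[OF that] False by auto
    then show ?thesis using that[OF \<theta>] M_zero by simp
  next
    case True
    define d where "d = (LEAST d. \<exists>G. R G d)"
    have "\<exists>G. R G d" unfolding d_def using LeastI_ex[OF True] .
    then obtain G where "R G d" by blast
    then have G: "G \<in> pol F" "poly G \<theta> \<in> M" "coeff G d \<notin> M" "\<And>i. i > d \<Longrightarrow> coeff G i \<in> M"
      by (auto simp: R_def)
    have least: "d \<le> e" if "R A e" for A e unfolding d_def by (rule Least_le) (use that in blast)
    \<comment> \<open>With d = 0 all other coefficients lie in \<open>M\<close>, and then G(theta)
      in \<open>M\<close> forces the constant coefficient into \<open>M\<close> too.\<close>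
    have "d \<noteq> 0"
    proof
      assume d0: "d = 0"
      obtain a p where p: "G = pCons a p" by (cases G)
      have "coeff p i \<in> M" for i using G(4)[of "Suc i"] d0 p by simp
      then have "poly p \<theta> \<in> M" using poly_mem_M[OF \<theta>] by simp
      then have "a \<in> M" using G(2) M_diff[of "poly G \<theta>" "\<theta> * poly p \<theta>"] M_mult[OF \<theta>] p by simp
      then show False using G(3) d0 p by simp
    qed
    have "poly (pderiv G) \<theta> \<notin> M"
    proof
      assume "poly (pderiv G) \<theta> \<in> M"
      moreover have "coeff (pderiv G) (d - 1) \<notin> M"
        using \<open>d \<noteq> 0\<close> G(3) char0[of "d - 1"] M_prime[OF subring_of_nat[OF O], of d "coeff G d"]
        by (auto simp: coeff_pderiv simp del: of_nat_Suc)
      moreover have "coeff (pderiv G) i \<in> M" if "i > d - 1" for i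
        using that G(4)[of "Suc i"] M_mult[OF subring_of_nat[OF O]] by (auto simp: coeff_pderiv simp del: of_nat_Suc)
      ultimately have "R (pderiv G) (d - 1)" using pol_pderiv[OF F(1) G(1)] by (simp add: R_def)
      then show False using least \<open>d \<noteq> 0\<close> by fastforce
    qed
    then obtain x where x: "x \<in> \<O>" "x - \<theta> \<in> M" "poly G x \<in> N"
      using newton_lift[OF FO[OF G(1)] \<theta> G(2)] by blast
    \<comment> \<open>Division by G modulo \<open>M\<close>: coefficient d of G is invertible in F,
      and minimality gives d <= n whenever n is the top index of a coefficient outside
      \<open>M\<close>. The subtracted multiples of G vanish at x modulo \<open>N\<close>.\<close>
    have *: "poly A x \<in> N" if "A \<in> pol F" "\<And>i. i \<ge> n \<Longrightarrow> coeff A i \<in> M" "poly A \<theta> \<in> M" for A n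
      using that
    proof (induction n arbitrary: A)
      case 0
      then show ?case using coeffs[of A x] x(1) by auto
    next
      case (Suc n)
      show ?case
      proof (cases "coeff A n \<in> M")
        case True
        then have "coeff A i \<in> M" if "i \<ge> n" for i
          using that Suc.prems(2)[of i] by (cases "i = n") auto
        then show ?thesis using Suc by blast
      next
        case False
        have "coeff A i \<in> M" if "i > n" for i using that Suc.prems(2)[of i] by auto
        then have "R A n" using Suc.prems False by (simp add: R_def)
        then have "d \<le> n" by (rule least)
        define c where "c = coeff A n * inverse (coeff G d)"
        have c: "c \<in> F" unfolding c_def using Suc.prems(1) G(1,3) F(1,4) by (auto intro: subring_mult)
        let ?B = "A - monom c (n - d) * G"
        have co: "coeff (monom c (n - d) * G) i = c * coeff G (i - (n - d))" if "i \<ge> n" for i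
          using that by (simp add: coeff_monom_mult)
        have "poly ?B x \<in> N"
        proof (rule Suc.IH)
          show "?B \<in> pol F" using Suc.prems(1) G(1) c F(1) by (intro pol_diff pol_mult pol_monom)
          have "monom c (n - d) \<in> pol \<O>" using pol_monom[OF F(1) c] FO by blast
          then have "poly (monom c (n - d)) \<theta> * poly G \<theta> \<in> M"
            using G(2) M_mult poly_mem_subring[OF O \<theta>] by blast
          then show "poly ?B \<theta> \<in> M" using Suc.prems(3) M_diff by simp
          fix i assume i: "i \<ge> n"
          show "coeff ?B i \<in> M"
          proof (cases "i = n")
            case True
            have "coeff G d \<noteq> 0" using G(3) M_zero by auto
            then have "coeff ?B i = 0" using True \<open>d \<le> n\<close> co[OF i] by (simp add: c_def)
            then show ?thesis using M_zero by simp
          next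
            case False
            then have "coeff G (i - (n - d)) \<in> M" using i \<open>d \<le> n\<close> by (intro G(4)) auto
            then show ?thesis using co[OF i] Suc.prems(2)[of i] False i c F(2) M_mult M_diff by auto
          qed
        qed
        moreover have "poly (monom c (n - d)) x * poly G x \<in> N"
          using x(1,3) N_mult poly_mem_subring[OF O x(1)] FO pol_monom[OF F(1) c] by blast
        ultimately show ?thesis using N_add[of "poly ?B x" "poly (monom c (n - d)) x * poly G x"] by simp
      qed
    qed
    have "poly A x \<in> N" if A: "A \<in> pol F" "poly A x \<in> M" for A
    proof (rule *[OF A(1), of "Suc (degree A)"])
      show "poly A \<theta> \<in> M" using M_cong_mem[OF M_cong_poly[OF x(1) \<theta> x(2) FO[OF A(1)]]] A(2) by simp
    qed (simp add: coeff_eq_0 M_zero)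
    then show ?thesis using that x by blast
  qed
qed

text \<open>\<open>F \<inter> M \<subseteq> N\<close> says that modulo \<open>N\<close> the subring
  F injects into the residue field. A maximal such F absorbs its fractions with denominators outside
  \<open>M\<close> and the lifts provided by \<open>adjoin_lift\<close>, so it also maps onto the
  residue field.\<close>

lemma coefficient_field:
  assumes F0: "subring F0" "F0 \<subseteq> \<O>" "F0 \<inter> M \<subseteq> N"
  obtains F where "subring F" "F0 \<subseteq> F" "F \<subseteq> \<O>" "F \<inter> M \<subseteq> N"
    "\<And>a. a \<in> F \<Longrightarrow> a \<notin> M \<Longrightarrow> inverse a \<in> F" "\<And>\<theta>. \<theta> \<in> \<O> \<Longrightarrow> \<exists>\<eta>\<in>F. \<theta> - \<eta> \<in> M"
proof -
  define \<A> where "\<A> = {F. subring F \<and> F0 \<subseteq> F \<and> F \<subseteq> \<O> \<and> F \<inter> M \<subseteq> N}"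
  have "\<exists>F\<in>\<A>. \<forall>X\<in>\<A>. F \<subseteq> X \<longrightarrow> X = F"
  proof (rule subset_Zorn_nonempty)
    show "\<A> \<noteq> {}" using F0 by (auto simp: \<A>_def)
    fix C assume C: "C \<noteq> {}" "subset.chain \<A> C"
    then have "C \<subseteq> \<A>" by (auto simp: subset.chain_def)
    then show "\<Union>C \<in> \<A>"
      using subring_Union_chain[OF C] C(1) unfolding \<A>_def by blast
  qed
  then obtain F where "F \<in> \<A>" and mx: "\<And>X. X \<in> \<A> \<Longrightarrow> F \<subseteq> X \<Longrightarrow> X = F" by blast
  then have F: "subring F" "F0 \<subseteq> F" "F \<subseteq> \<O>" "F \<inter> M \<subseteq> N" by (auto simp: \<A>_def)
  have inv_F: "inverse a \<in> F" if a: "a \<in> F" "a \<notin> M" for a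
  proof -
    define X where "X = {b * inverse c | b c. b \<in> F \<and> c \<in> F \<and> c \<notin> M}"
    have XI: "b * inverse c \<in> X" if "b \<in> F" "c \<in> F" "c \<notin> M" for b c using that by (auto simp: X_def)
    have prime: "c * d \<notin> M" "c * d \<in> F" "c \<noteq> 0" "d \<noteq> 0"
      if "c \<in> F" "d \<in> F" "c \<notin> M" "d \<notin> M" for c d
      using M_prime[of c d] that F(3) M_zero subring_mult[OF F(1)] by auto
    have "subring X" unfolding subring_def
    proof (intro conjI ballI)
      show "1 \<in> X" using XI[of 1 1] subring_one[OF F(1)] M_one by simp
      fix x y assume "x \<in> X" "y \<in> X"
      then obtain b c b' c' where x: "x = b * inverse c" "b \<in> F" "c \<in> F" "c \<notin> M"
        and y: "y = b' * inverse c'" "b' \<in> F" "c' \<in> F" "c' \<notin> M" by (auto simp: X_def)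
      note cc = prime[OF x(3) y(3) x(4) y(4)]
      have "x - y = (b * c' - b' * c) * inverse (c * c')"
        using cc x y by (simp add: field_simps)
      moreover have "b * c' - b' * c \<in> F" "b * b' \<in> F" using x y F(1) by (auto intro: subring_diff subring_mult)
      ultimately show "x - y \<in> X" using XI cc by metis
      have "x * y = (b * b') * inverse (c * c')" using x y by (simp add: mult_ac)
      then show "x * y \<in> X" using XI cc \<open>b * b' \<in> F\<close> by metis
    qed
    moreover have "F \<subseteq> X" using XI[of _ 1] subring_one[OF F(1)] M_one by auto
    moreover have "X \<subseteq> \<O>" using inv F(3) subring_mult[OF O] unfolding X_def by blast
    moreover have "X \<inter> M \<subseteq> N"
    proof
      fix x assume "x \<in> X \<inter> M"
      then obtain b c where x: "x = b * inverse c" "b \<in> F" "c \<in> F" "c \<notin> M" "x \<in> M" by (auto simp: X_def)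
      have "c \<noteq> 0" using x M_zero by auto
      then have "b = c * x" using x(1) by simp
      then have "b \<in> N" using M_mult[of c x] x F(3,4) by blast
      then show "x \<in> N" using N_mult[of "inverse c" b] inv x F(3) by (auto simp: mult.commute)
    qed
    ultimately have "X = F" using mx F by (auto simp: \<A>_def)
    then show ?thesis using XI[OF subring_one[OF F(1)] a] by simp
  qed
  have "\<exists>\<eta>\<in>F. \<theta> - \<eta> \<in> M" if \<theta>: "\<theta> \<in> \<O>" for \<theta>
  proof -
    obtain x where x: "x \<in> \<O>" "x - \<theta> \<in> M" "\<And>A. A \<in> pol F \<Longrightarrow> poly A x \<in> M \<Longrightarrow> poly A x \<in> N"
      using adjoin_lift[OF F(1,3,4) inv_F \<theta>] by blast
    define X where "X = {poly A x | A. A \<in> pol F}"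
    have XI: "poly A x \<in> X" if "A \<in> pol F" for A using that by (auto simp: X_def)
    have "subring X" unfolding subring_def
    proof (intro conjI ballI)
      show "1 \<in> X" using XI[of 1] subring_one[OF F(1)] subring_zero[OF F(1)] by (simp add: coeff_1)
      fix a b assume "a \<in> X" "b \<in> X"
      then obtain A B where AB: "a = poly A x" "A \<in> pol F" "b = poly B x" "B \<in> pol F" by (auto simp: X_def)
      show "a - b \<in> X" using XI[of "A - B"] pol_diff[OF F(1) AB(2,4)] AB by simp
      show "a * b \<in> X" using XI[of "A * B"] pol_mult[OF F(1) AB(2,4)] AB by simp
    qed
    moreover have "F \<subseteq> X"
    proof
      fix a assume "a \<in> F"
      then show "a \<in> X" using XI[of "[:a:]"] pCons_in_pol[of a 0 F] subring_zero[OF F(1)] by simp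
    qed
    moreover have "X \<subseteq> \<O>" using poly_mem_subring[OF O x(1)] F(3) unfolding X_def by blast
    moreover have "X \<inter> M \<subseteq> N" using x(3) unfolding X_def by blast
    ultimately have "X = F" using mx F by (auto simp: \<A>_def)
    moreover have "x \<in> X"
      using XI[of "[:0, 1:]"] pCons_in_pol[of _ _ F] subring_zero[OF F(1)] subring_one[OF F(1)] by simp
    ultimately show ?thesis using x(2) M_cong_sym by blast
  qed
  then show ?thesis using that F inv_F by blast
qed

text \<open>A maximal F-submodule H that contains \<open>N\<close> but not f is a hyperplane: modulo
  H every element is a multiple of f, and the multiplier is the value of l. Multipliers are unique
  only modulo \<open>M\<close>, hence l is linear only modulo \<open>M\<close>.\<close>

lemma separating_functional:
  assumes F: "subring F" "F \<subseteq> \<O>" "F \<inter> M \<subseteq> N" "\<And>a. a \<in> F \<Longrightarrow> a \<notin> M \<Longrightarrow> inverse a \<in> F"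
    and f: "f \<in> \<O>" "f \<notin> N"
  obtains l where "\<And>x. x \<in> \<O> \<Longrightarrow> l x \<in> F"
    "\<And>x y. x \<in> \<O> \<Longrightarrow> y \<in> \<O> \<Longrightarrow> l (x + y) - (l x + l y) \<in> M"
    "\<And>c x. c \<in> F \<Longrightarrow> x \<in> \<O> \<Longrightarrow> l (c * x) - c * l x \<in> M"
    "\<And>x. x \<in> N \<Longrightarrow> l x \<in> M" "l f - 1 \<in> M"
proof -
  define \<A> where "\<A> = {H. N \<subseteq> H \<and> H \<subseteq> \<O> \<and> (\<forall>x\<in>H. \<forall>y\<in>H. x + y \<in> H) \<and> (\<forall>c\<in>F. \<forall>x\<in>H. c * x \<in> H) \<and> f \<notin> H}"
  have "\<exists>H\<in>\<A>. \<forall>X\<in>\<A>. H \<subseteq> X \<longrightarrow> X = H"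
  proof (rule subset_Zorn_nonempty)
    have "N \<in> \<A>" using N_sub M_sub N_add N_mult F(2) f(2) unfolding \<A>_def by blast
    then show "\<A> \<noteq> {}" by blast
    fix C assume C: "C \<noteq> {}" "subset.chain \<A> C"
    then have CA: "C \<subseteq> \<A>" by (auto simp: subset.chain_def)
    have "x + y \<in> \<Union>C" if xy: "x \<in> \<Union>C" "y \<in> \<Union>C" for x y
    proof -
      obtain X where "X \<in> C" "x \<in> X" "y \<in> X"
        using subset_chain_two[OF C(2) xy] by blast
      then show ?thesis using CA unfolding \<A>_def by blast
    qed
    then show "\<Union>C \<in> \<A>" using CA C(1) unfolding \<A>_def by blast
  qed
  then obtain H where "H \<in> \<A>" and mx: "\<And>X. X \<in> \<A> \<Longrightarrow> H \<subseteq> X \<Longrightarrow> X = H" by blast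
  then have H: "N \<subseteq> H" "H \<subseteq> \<O>" "\<And>x y. x \<in> H \<Longrightarrow> y \<in> H \<Longrightarrow> x + y \<in> H"
    "\<And>c x. c \<in> F \<Longrightarrow> x \<in> H \<Longrightarrow> c * x \<in> H" "f \<notin> H" by (auto simp: \<A>_def)
  have m1: "0 - 1 \<in> F" using F(1) by (intro subring_diff subring_zero subring_one)
  have H_diff: "x - y \<in> H" if "x \<in> H" "y \<in> H" for x y
    using H(3)[OF that(1) H(4)[OF m1 that(2)]] by simp
  have ex: "\<exists>c\<in>F. g - c * f \<in> H" if g: "g \<in> \<O>" for g
  proof (cases "g \<in> H")
    case True
    then show ?thesis using subring_zero[OF F(1)] by (intro bexI[of _ 0]) auto
  next
    case False
    define X where "X = {h + c * g | h c. h \<in> H \<and> c \<in> F}"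
    have XI: "h + c * g \<in> X" if "h \<in> H" "c \<in> F" for h c using that by (auto simp: X_def)
    have HX: "H \<subseteq> X" using XI[OF _ subring_zero[OF F(1)]] by auto
    have gX: "g \<in> X" using XI[of 0 1] N_zero H(1) subring_one[OF F(1)] by auto
    have "x + y \<in> X" if xy: "x \<in> X" "y \<in> X" for x y
    proof -
      obtain h c h' c' where "x = h + c * g" "h \<in> H" "c \<in> F" "y = h' + c' * g" "h' \<in> H" "c' \<in> F"
        using xy by (auto simp: X_def)
      then show ?thesis using XI[of "h + h'" "c + c'"] H(3) subring_add[OF F(1)] by (simp add: algebra_simps)
    qed
    moreover have "e * x \<in> X" if ex: "e \<in> F" "x \<in> X" for e x
    proof -
      obtain h c where "x = h + c * g" "h \<in> H" "c \<in> F" using ex by (auto simp: X_def)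
      then show ?thesis using XI[of "e * h" "e * c"] H(4) subring_mult[OF F(1)] ex by (simp add: algebra_simps)
    qed
    moreover have "X \<subseteq> \<O>"
      using H(2) F(2) g subring_add[OF O] subring_mult[OF O] unfolding X_def by blast
    moreover have "X \<noteq> H" using gX False by blast
    \<comment> \<open>H + F g is strictly larger than H, so it captures f. The coefficient c of g is
      invertible: otherwise c g would lie in \<open>N\<close>, and f in H.\<close>
    ultimately have "f \<in> X" using mx[of X] HX H(1) unfolding \<A>_def by blast
    then obtain h c where hc: "f = h + c * g" "h \<in> H" "c \<in> F" by (auto simp: X_def)
    have "c \<notin> M"
    proof
      assume "c \<in> M"
      then have "g * c \<in> N" using hc F(3) g N_mult by blast
      then have "c * g \<in> H" using H(1) by (auto simp: mult.commute)
      then show False using hc H(3,5) by blast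
    qed
    then have ic: "inverse c \<in> F" "c \<noteq> 0" using F(4) hc M_zero by auto
    have "g - inverse c * f = ((0 - 1) * inverse c) * h" using ic hc by (simp add: field_simps)
    also have "\<dots> \<in> H" using H(4) subring_mult[OF F(1) m1 ic(1)] hc(2) by blast
    finally show ?thesis using ic by blast
  qed
  define l where "l g = (SOME c. c \<in> F \<and> g - c * f \<in> H)" for g
  have l: "l g \<in> F" "g - l g * f \<in> H" if "g \<in> \<O>" for g
    using someI_ex[of "\<lambda>c. c \<in> F \<and> g - c * f \<in> H"] ex[OF that] unfolding l_def by blast+
  have uniq: "c - d \<in> M" if "c \<in> F" "d \<in> F" "g - c * f \<in> H" "g - d * f \<in> H" for c d g
  proof (rule ccontr)
    assume n: "c - d \<notin> M"
    have cd: "c - d \<in> F" using that F(1) by (simp add: subring_diff)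
    have "(c - d) * f \<in> H" using H_diff[OF that(4,3)] by (simp add: algebra_simps)
    then have "inverse (c - d) * ((c - d) * f) \<in> H" using H(4) F(4) n cd by blast
    moreover have "c - d \<noteq> 0" using n M_zero by auto
    ultimately show False using H(5) by (simp add: mult.assoc[symmetric] del: right_minus_eq)
  qed
  show thesis
  proof (rule that[of l])
    show "l x \<in> F" if "x \<in> \<O>" for x using l that by blast
    show "l (x + y) - (l x + l y) \<in> M" if xy: "x \<in> \<O>" "y \<in> \<O>" for x y
    proof (rule uniq[of _ _ "x + y"])
      show "x + y - (l x + l y) * f \<in> H"
        using H(3)[OF l(2)[OF xy(1)] l(2)[OF xy(2)]] by (simp add: algebra_simps)
    qed (use l xy O F(1) in \<open>auto intro: subring_add\<close>)
    show "l (c * x) - c * l x \<in> M" if cx: "c \<in> F" "x \<in> \<O>" for c x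
    proof (rule uniq[of _ _ "c * x"])
      show "c * x - c * l x * f \<in> H"
        using H(4)[OF cx(1) l(2)[OF cx(2)]] by (simp add: algebra_simps)
      show "l (c * x) \<in> F" "c * x - l (c * x) * f \<in> H"
        using l[of "c * x"] cx O F(2) by (auto intro: subring_mult)
    qed (use l cx F(1) in \<open>auto intro: subring_mult\<close>)
    show "l x \<in> M" if x: "x \<in> N" for x
    proof -
      have xO: "x \<in> \<O>" using x N_sub M_sub by blast
      show ?thesis using uniq[of "l x" 0 x] l[OF xO] x H(1) subring_zero[OF F(1)] by auto
    qed
    show "l f - 1 \<in> M" using uniq[of "l f" 1 f] l[OF f(1)] H(1) N_zero subring_one[OF F(1)] by auto
  qed
qed

end

subsection \<open>Substitution homomorphisms and derivations\<close>

lemma additive_ext: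
  fixes \<phi> \<psi> :: "('m \<Rightarrow>\<^sub>0 'k::comm_monoid_add) \<Rightarrow> 'b::ab_group_add"
  assumes "\<And>a b. \<phi> (a + b) = \<phi> a + \<phi> b" "\<And>a b. \<psi> (a + b) = \<psi> a + \<psi> b"
    and single: "\<And>m c. \<phi> (Poly_Mapping.single m c) = \<psi> (Poly_Mapping.single m c)"
  shows "\<phi> F = \<psi> F"
proof -
  have 0: "\<phi> 0 = 0" "\<psi> 0 = 0" using assms(1)[of 0 0] assms(2)[of 0 0] by auto
  have sum: "\<phi> (sum h X) = (\<Sum>x\<in>X. \<phi> (h x))" "\<psi> (sum h X) = (\<Sum>x\<in>X. \<psi> (h x))"
    if "finite X" for h and X :: "'m set"
    using that by (induction X) (auto simp: assms 0)
  have "\<phi> F = (\<Sum>m\<in>Poly_Mapping.keys F. \<phi> (Poly_Mapping.single m (Poly_Mapping.lookup F m)))"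
    by (subst poly_mapping_sum_single[symmetric]) (simp add: sum)
  also have "\<dots> = \<psi> F"
    by (subst (3) poly_mapping_sum_single[symmetric]) (simp add: sum single)
  finally show ?thesis .
qed

lemma pconst_0 [simp]: "pconst 0 = 0"
  and pconst_1 [simp]: "pconst (1::'k::comm_ring_1) = 1"
  and pconst_add: "pconst (c + d) = pconst c + pconst (d::'k)"
  and pconst_mult: "pconst (c * d) = pconst c * pconst (d::'k)"
  by (auto simp: pconst_def single_add mult_single)

text \<open>Exponents are plain functions and the product runs over all variables, so exponents can
  be updated pointwise and boxes of exponents are \<open>PiE\<close> sets.\<close>

abbreviation mon :: "('w::finite \<Rightarrow> 'a::comm_ring_1) \<Rightarrow> ('w \<Rightarrow> nat) \<Rightarrow> 'a" where
  "mon u m \<equiv> \<Prod>i\<in>UNIV. u i ^ m i"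

context
  fixes u :: "'w::finite \<Rightarrow> ('v, 'k::comm_ring_1) mpol"
begin

lemma peval_eq_sum:
  assumes "finite X" "Poly_Mapping.keys F \<subseteq> X"
  shows "peval u F = (\<Sum>m\<in>X. pconst (Poly_Mapping.lookup F m) * mon u (Poly_Mapping.lookup m))"
proof -
  have "(\<Prod>i\<in>Poly_Mapping.keys m. u i ^ Poly_Mapping.lookup m i) = mon u (Poly_Mapping.lookup m)" for m
    by (rule prod.mono_neutral_left) (auto simp: in_keys_iff)
  then have "peval u F = (\<Sum>m\<in>Poly_Mapping.keys F. pconst (Poly_Mapping.lookup F m) * mon u (Poly_Mapping.lookup m))"
    by (simp add: peval_def)
  also have "\<dots> = (\<Sum>m\<in>X. pconst (Poly_Mapping.lookup F m) * mon u (Poly_Mapping.lookup m))"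
    using assms by (intro sum.mono_neutral_left) (auto simp: in_keys_iff)
  finally show ?thesis .
qed

lemma peval_add: "peval u (F + G) = peval u F + peval u G"
proof -
  let ?X = "Poly_Mapping.keys F \<union> Poly_Mapping.keys G"
  have "Poly_Mapping.keys (F + G) \<subseteq> ?X" by (rule keys_add)
  then show ?thesis
    using peval_eq_sum[of ?X F] peval_eq_sum[of ?X G] peval_eq_sum[of ?X "F + G"]
    by (simp add: lookup_add pconst_add distrib_right sum.distrib)
qed

lemma peval_single: "peval u (Poly_Mapping.single m c) = pconst c * mon u (Poly_Mapping.lookup m)"
  using peval_eq_sum[of "{m}" "Poly_Mapping.single m c"] by simp

lemma peval_mult: "peval u (F * G) = peval u F * peval u G"
proof -
  have sg: "peval u (Poly_Mapping.single m c * Poly_Mapping.single n d)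
      = peval u (Poly_Mapping.single m c) * peval u (Poly_Mapping.single n d)" for m n c d
    by (simp add: mult_single peval_single pconst_mult lookup_add power_add prod.distrib mult_ac)
  have 1: "peval u (Poly_Mapping.single m c * G) = peval u (Poly_Mapping.single m c) * peval u G" for m c
    by (rule additive_ext[of "\<lambda>G. peval u (Poly_Mapping.single m c * G)"])
      (simp_all only: peval_add distrib_left sg)
  show ?thesis
    by (rule additive_ext[of "\<lambda>F. peval u (F * G)" "\<lambda>F. peval u F * peval u G"])
      (simp_all only: peval_add distrib_right 1)
qed

lemma peval_pconst [simp]: "peval u (pconst c) = pconst c"
  by (simp add: peval_single pconst_def[of c])

lemma peval_0 [simp]: "peval u 0 = 0"
  using peval_pconst[of 0] by simp

lemma peval_1 [simp]: "peval u 1 = 1"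
  using peval_pconst[of 1] by simp

lemma peval_var [simp]: "peval u (Poly_Mapping.single (Poly_Mapping.single i 1) 1) = u i"
proof -
  have "mon u (Poly_Mapping.lookup (Poly_Mapping.single i 1)) = (\<Prod>j\<in>UNIV. if j = i then u i else 1)"
    by (rule prod.cong) (auto simp: lookup_single when_def)
  then show ?thesis by (simp add: peval_single)
qed

end

section \<open>The embedding of a domain into its fraction field\<close>

abbreviation emb :: "'a::idom \<Rightarrow> 'a fract" where
  "emb a \<equiv> Fraction_Field.Fract a 1"

lemma emb_add: "emb (a + b) = emb a + emb b"
  and emb_mult: "emb (a * b) = emb a * emb b"
  and emb_diff: "emb (a - b) = emb a - emb b"
  and emb_0: "emb 0 = 0" and emb_1: "emb 1 = 1"
  and emb_eq_iff: "emb a = emb b \<longleftrightarrow> a = b"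
  by (auto simp: fract_collapse eq_fract)

lemma Fract_conv_emb: "Fraction_Field.Fract a b = emb a / emb b"
  by simp

text \<open>Fractions are kept as quotients of embedded elements so that field arithmetic applies;
  rules that merge them back into a single \<open>Fract\<close> are switched off.\<close>

declare add_fract [simp del] mult_fract [simp del] diff_fract [simp del]
  divide_fract [simp del] inverse_fract [simp del] minus_fract [simp del]

lemma emb_power: "emb (a ^ n) = emb a ^ n"
  by (induction n) (auto simp: emb_1 emb_mult)

lemma emb_sum: "emb (sum g X) = (\<Sum>x\<in>X. emb (g x))"
  by (induction X rule: infinite_finite_induct) (auto simp: emb_0 emb_add)

lemma emb_prod: "emb (prod g X) = (\<Prod>x\<in>X. emb (g x))"
  by (induction X rule: infinite_finite_induct) (auto simp: emb_1 emb_mult)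

lemma emb_mon: "emb (mon u m) = mon (\<lambda>i. emb (u i)) m"
  by (simp add: emb_prod emb_power)

lemma emb_peval_mem_subring:
  fixes u :: "'v::{finite,linorder} \<Rightarrow> ('v, 'k::field) mpol"
  assumes E: "subring E" and c: "\<And>c. emb (pconst c) \<in> E" and v: "\<And>i. i \<in> pvars F \<Longrightarrow> emb (u i) \<in> E"
  shows "emb (peval u F) \<in> E"
  unfolding peval_def emb_sum emb_mult emb_prod emb_power
proof (intro subring_sum subring_mult subring_prod E c subring_power v)
  fix m i assume "m \<in> Poly_Mapping.keys F" "i \<in> Poly_Mapping.keys m"
  then show "i \<in> pvars F" by (auto simp: pvars_def)
qed

section \<open>Derivations of a field\<close>

definition deriv :: "('q::field \<Rightarrow> 'q) \<Rightarrow> bool" where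
  "deriv \<delta> \<longleftrightarrow> (\<forall>a b. \<delta> (a + b) = \<delta> a + \<delta> b) \<and> (\<forall>a b. \<delta> (a * b) = a * \<delta> b + \<delta> a * b)"

context
  fixes \<delta> :: "'q::field \<Rightarrow> 'q"
  assumes \<delta>: "deriv \<delta>"
begin

lemma deriv_add: "\<delta> (a + b) = \<delta> a + \<delta> b"
  and deriv_mult: "\<delta> (a * b) = a * \<delta> b + \<delta> a * b"
  using \<delta> by (auto simp: deriv_def)

lemma deriv_0: "\<delta> 0 = 0" using deriv_add[of 0 0] by (metis add.right_neutral add_left_cancel)

lemma deriv_1: "\<delta> 1 = 0" using deriv_mult[of 1 1] by (metis add_cancel_right_right mult_1 mult_1_right)

lemma deriv_diff: "\<delta> (a - b) = \<delta> a - \<delta> b"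
  using deriv_add[of "a - b" b] by simp

lemma deriv_of_nat: "\<delta> (of_nat n) = 0"
  by (induction n) (auto simp: deriv_0 deriv_1 deriv_add)

lemma deriv_power: "\<delta> (a ^ n) = of_nat n * a ^ (n - 1) * \<delta> a"
proof (induction n)
  case (Suc n)
  then show ?case by (cases n) (auto simp: deriv_mult deriv_1 algebra_simps)
qed (simp add: deriv_1)

lemma deriv_inverse: "\<delta> (inverse b) = - (\<delta> b * inverse b * inverse b)"
proof (cases "b = 0")
  case False
  then have "0 = b * \<delta> (inverse b) + \<delta> b * inverse b"
    using deriv_mult[of b "inverse b"] deriv_1 by simp
  then have "b * \<delta> (inverse b) = - (\<delta> b * inverse b)" by (simp add: eq_neg_iff_add_eq_0)
  then show ?thesis using False by (simp add: field_simps)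
qed (simp add: deriv_0)

end

lemma deriv_eq_on_fract:
  fixes u :: "'v::{finite,linorder} \<Rightarrow> ('v, 'k::field) mpol"
  assumes d: "deriv \<delta>" "deriv \<epsilon>" and u: "surj (peval u)"
    and c: "\<And>c. \<delta> (emb (pconst c)) = \<epsilon> (emb (pconst c))" and v: "\<And>i. \<delta> (emb (u i)) = \<epsilon> (emb (u i))"
  shows "\<delta> = \<epsilon>"
proof
  fix x
  let ?E = "{x. \<delta> x = \<epsilon> x}"
  have E: "subring ?E"
    by (auto simp: subring_def deriv_1[OF d(1)] deriv_1[OF d(2)] deriv_diff[OF d(1)] deriv_diff[OF d(2)]
        deriv_mult[OF d(1)] deriv_mult[OF d(2)])
  have R: "emb f \<in> ?E" for f
  proof -
    obtain F where "f = peval u F" using u by (metis surjD)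
    then show ?thesis using emb_peval_mem_subring[OF E, of F u] c v by simp
  qed
  show "\<delta> x = \<epsilon> x"
  proof (cases x)
    case (Fract a b)
    then have x: "x = emb a * inverse (emb b)" by (simp add: Fract_conv_emb[of a b] divide_inverse)
    show ?thesis using R[of a] R[of b] unfolding x
      by (simp add: deriv_mult[OF d(1)] deriv_mult[OF d(2)] deriv_inverse[OF d(1)] deriv_inverse[OF d(2)])
  qed
qed

text \<open>The quotient rule in the form (da - x db)/b with x = a/b. Once x is fixed, independence
  of the representation is the derivative of a b' = a' b, divided by b b'.\<close>

lemma ex_deriv_extension:
  fixes d :: "'a::idom \<Rightarrow> 'a" and h :: "'a \<Rightarrow> 'q::field"
  assumes add: "\<And>a b. d (a + b) = d a + d b" and mult: "\<And>a b. d (a * b) = a * d b + d a * b"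
    and h_add: "\<And>a b. h (a + b) = h a + h b" and h_mult: "\<And>a b. h (a * b) = h a * h b"
    and h_1: "h 1 = 1" and h_0: "h 0 = 0" and h_inj: "\<And>a b. h a = h b \<Longrightarrow> a = b"
    and h_quot: "\<And>x. \<exists>a b. b \<noteq> 0 \<and> x = h a / h b"
  obtains \<delta> where "deriv \<delta>" "\<And>a. \<delta> (h a) = h (d a)"
proof -
  define e where "e a b = (h (d a) - h a / h b * h (d b)) / h b" for a b
  have nz: "h b \<noteq> 0" if "b \<noteq> 0" for b using h_inj[of b 0] h_0 that by auto
  have wd: "e a b = e a' b'" if b: "b \<noteq> 0" "b' \<noteq> 0" and eq: "h a / h b = h a' / h b'" for a b a' b'
  proof -
    note n = nz[OF b(1)] nz[OF b(2)]
    define x where "x = h a / h b"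
    have a: "h a = x * h b" "h a' = x * h b'" using n eq unfolding x_def by (auto simp: field_simps)
    have "h (a * b') = h (a' * b)" unfolding h_mult a by simp
    then have "h (d (a * b')) = h (d (a' * b))" using h_inj by metis
    then have eq': "x * h b * h (d b') + h (d a) * h b' = x * h b' * h (d b) + h (d a') * h b"
      unfolding mult h_add h_mult a .
    show ?thesis unfolding e_def eq[symmetric] x_def[symmetric]
      using n eq' by (simp add: frac_eq_eq algebra_simps)
  qed
  define \<delta> where "\<delta> x = (let p = SOME p. snd p \<noteq> 0 \<and> x = h (fst p) / h (snd p) in e (fst p) (snd p))" for x
  have \<delta>: "\<delta> (h a / h b) = e a b" if "b \<noteq> 0" for a b
  proof -
    let ?P = "\<lambda>p. snd p \<noteq> 0 \<and> h a / h b = h (fst p) / h (snd p)"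
    have "?P (a, b)" using that by simp
    then have "?P (Eps ?P)" by (rule someI)
    then show ?thesis unfolding \<delta>_def Let_def using wd[of b "snd (Eps ?P)" a "fst (Eps ?P)"] that by metis
  qed
  have d1: "d 1 = 0" using mult[of 1 1] by (metis add_cancel_right_right mult_1 mult_1_right)
  have "deriv \<delta>" unfolding deriv_def
  proof (intro conjI allI)
    fix x y
    obtain a b a' b' where x: "x = h a / h b" "b \<noteq> 0" and y: "y = h a' / h b'" "b' \<noteq> 0"
      using h_quot by metis
    note n = nz[OF x(2)] nz[OF y(2)]
    have bb: "b * b' \<noteq> 0" using x y by simp
    have "x + y = h (a * b' + a' * b) / h (b * b')"
      unfolding x y h_add h_mult using n by (simp add: add_frac_eq mult.commute)
    then have "\<delta> (x + y) = e (a * b' + a' * b) (b * b')" using \<delta>[OF bb] by simp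
    also have "\<dots> = e a b + e a' b'"
      unfolding e_def add mult h_add h_mult using n by (simp add: divide_simps) (simp add: algebra_simps)
    finally show "\<delta> (x + y) = \<delta> x + \<delta> y" using \<delta> x y by simp
    have "x * y = h (a * a') / h (b * b')" unfolding x y h_mult by simp
    then have "\<delta> (x * y) = e (a * a') (b * b')" using \<delta>[OF bb] by simp
    also have "\<dots> = h a / h b * e a' b' + e a b * (h a' / h b')"
      unfolding e_def mult h_add h_mult using n by (simp add: divide_simps) (simp add: algebra_simps)
    finally show "\<delta> (x * y) = x * \<delta> y + \<delta> x * y" using \<delta> x y by simp
  qed
  moreover have "\<delta> (h a) = h (d a)" for a
    using \<delta>[of 1 a] by (simp add: h_1 h_0 e_def d1)
  ultimately show ?thesis using that by blast
qed

lemma ex_deriv_fract: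
  fixes d :: "'a::idom \<Rightarrow> 'a"
  assumes "\<And>a b. d (a + b) = d a + d b" "\<And>a b. d (a * b) = a * d b + d a * b"
  obtains \<delta> where "deriv \<delta>" "\<And>a. \<delta> (emb a) = emb (d a)"
proof (rule ex_deriv_extension[of d emb])
  fix x :: "'a fract"
  show "\<exists>a b. b \<noteq> 0 \<and> x = emb a / emb b"
    using Fract_cases[of x] Fract_conv_emb by metis
qed (simp_all add: assms emb_add emb_mult emb_0 emb_1 emb_eq_iff that)

text \<open>Truncated subtraction of exponents is harmless: when the exponent of j is 0, so is the
  new coefficient.\<close>

definition pd :: "'w \<Rightarrow> ('w, 'k::comm_ring_1) mpol \<Rightarrow> ('w, 'k) mpol" where
  "pd j F = (\<Sum>m\<in>Poly_Mapping.keys F.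
     Poly_Mapping.single (m - Poly_Mapping.single j 1) (of_nat (Poly_Mapping.lookup m j) * Poly_Mapping.lookup F m))"

lemma pd_add: "pd j (F + G) = pd j F + pd j G"
proof -
  let ?X = "Poly_Mapping.keys F \<union> Poly_Mapping.keys G"
  have pd: "pd j H = (\<Sum>m\<in>?X. Poly_Mapping.single (m - Poly_Mapping.single j 1)
      (of_nat (Poly_Mapping.lookup m j) * Poly_Mapping.lookup H m))" if "Poly_Mapping.keys H \<subseteq> ?X" for H
    unfolding pd_def using that by (intro sum.mono_neutral_left) (auto simp: in_keys_iff)
  show ?thesis using pd[of F] pd[of G] pd[of "F + G"] keys_add[of F G]
    by (simp add: lookup_add distrib_left single_add sum.distrib)
qed

lemma pd_single: "pd j (Poly_Mapping.single m c) =
    Poly_Mapping.single (m - Poly_Mapping.single j 1) (of_nat (Poly_Mapping.lookup m j) * c)"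
  by (cases "c = 0") (auto simp: pd_def)

lemma pd_mult: "pd j (F * G) = F * pd j G + pd j F * G"
proof -
  have sg: "pd j (Poly_Mapping.single m c * Poly_Mapping.single n d)
      = Poly_Mapping.single m c * pd j (Poly_Mapping.single n d) + pd j (Poly_Mapping.single m c) * Poly_Mapping.single n d"
    for m n c d
  proof -
    let ?e = "Poly_Mapping.single j (1::nat)"
    have 1: "Poly_Mapping.single (m + (n - ?e)) (c * (of_nat (Poly_Mapping.lookup n j) * d))
        = Poly_Mapping.single (m + n - ?e) (c * (of_nat (Poly_Mapping.lookup n j) * d))"
    proof (cases "Poly_Mapping.lookup n j = 0")
      case False
      then have "m + (n - ?e) = m + n - ?e"
        by (intro poly_mapping_eqI) (auto simp: lookup_add lookup_minus lookup_single when_def)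
      then show ?thesis by simp
    qed simp
    have 2: "Poly_Mapping.single (m - ?e + n) (of_nat (Poly_Mapping.lookup m j) * c * d)
        = Poly_Mapping.single (m + n - ?e) (of_nat (Poly_Mapping.lookup m j) * c * d)"
    proof (cases "Poly_Mapping.lookup m j = 0")
      case False
      then have "m - ?e + n = m + n - ?e"
        by (intro poly_mapping_eqI) (auto simp: lookup_add lookup_minus lookup_single when_def)
      then show ?thesis by simp
    qed simp
    show ?thesis
      unfolding mult_single pd_single 1 2 single_add[symmetric] lookup_add
      by (simp add: algebra_simps)
  qed
  have 1: "pd j (Poly_Mapping.single m c * G) = Poly_Mapping.single m c * pd j G + pd j (Poly_Mapping.single m c) * G" for m c
    by (rule additive_ext[of "\<lambda>G. pd j (Poly_Mapping.single m c * G)"])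
      (simp_all only: pd_add distrib_left sg add_ac)
  show ?thesis
    by (rule additive_ext[of "\<lambda>F. pd j (F * G)" "\<lambda>F. F * pd j G + pd j F * G"])
      (simp_all only: 1 pd_add distrib_right add_ac)
qed

text \<open>Formal differentiation, carried over by the coordinate automorphism and extended to
  fractions, gives existence. A derivation is determined by its values on generators, which gives
  uniqueness and makes the definite description in \<open>yderiv\<close> meaningful.\<close>

lemma is_yderiv_yderiv:
  fixes u :: "'v::{finite,linorder} \<Rightarrow> ('v, 'k::field) mpol"
  assumes u: "coord_system u" and j: "j \<notin> T"
  shows "is_yderiv u T j (yderiv u T j)"
proof -
  have bij: "bij (peval u)" using u by (simp add: coord_system_def)
  define w where "w = inv (peval u)"
  have pw: "peval u (w f) = f" and wp: "w (peval u F) = F" for f F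
    unfolding w_def using bij by (auto simp: bij_def surj_f_inv_f)
  define d where "d f = peval u (pd j (w f))" for f
  have w_add: "w (f + g) = w f + w g" and w_mult: "w (f * g) = w f * w g" for f g
    using wp[of "w f + w g"] wp[of "w f * w g"] by (simp_all add: peval_add peval_mult pw)
  obtain \<delta> where \<delta>: "deriv \<delta>" "\<And>a. \<delta> (emb a) = emb (d a)"
    using ex_deriv_fract[of d] by (auto simp: d_def w_add w_mult pd_add pd_mult peval_add peval_mult pw)
  have dc: "d (pconst c) = 0" for c
  proof -
    have "w (pconst c) = pconst c" using wp[of "pconst c"] by simp
    then show ?thesis by (simp add: d_def pconst_def[of c] pd_single)
  qed
  have du: "d (u l) = (if l = j then 1 else 0)" for l
  proof -
    have "w (u l) = Poly_Mapping.single (Poly_Mapping.single l 1) 1"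
      using wp[of "Poly_Mapping.single (Poly_Mapping.single l 1) 1"] by (simp only: peval_var)
    then show ?thesis by (auto simp: d_def pd_single lookup_single when_def)
  qed
  have ex: "is_yderiv u T j \<delta>" unfolding is_yderiv_def
  proof (intro conjI)
    show "\<forall>a b. \<delta> (a + b) = \<delta> a + \<delta> b" using \<delta>(1) by (simp add: deriv_add)
    show "\<forall>a b. \<delta> (a * b) = a * \<delta> b + \<delta> a * b" using \<delta>(1) by (simp add: deriv_mult)
    show "\<forall>c. \<delta> (Fraction_Field.Fract (pconst c) 1) = 0" by (simp add: \<delta>(2) dc emb_0)
    show "\<forall>i\<in>T. \<delta> (Fraction_Field.Fract (u i) 1) = 0" using j by (auto simp: \<delta>(2) du emb_0)
    show "\<forall>l. l \<notin> T \<longrightarrow> \<delta> (Fraction_Field.Fract (u l) 1) = (if l = j then 1 else 0)"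
      by (simp add: \<delta>(2) du emb_0 emb_1)
  qed
  have "\<epsilon> = \<delta>" if \<epsilon>: "is_yderiv u T j \<epsilon>" for \<epsilon>
  proof (rule deriv_eq_on_fract[where u = u])
    show "deriv \<epsilon>" using \<epsilon> by (simp add: is_yderiv_def deriv_def)
    show "deriv \<delta>" by (rule \<delta>(1))
    show "surj (peval u)" using bij by (rule bij_is_surj)
    show "\<epsilon> (emb (pconst c)) = \<delta> (emb (pconst c))" for c
      using \<epsilon> ex unfolding is_yderiv_def by simp
    show "\<epsilon> (emb (u i)) = \<delta> (emb (u i))" for i
      using \<epsilon> ex unfolding is_yderiv_def by (cases "i \<in> T") auto
  qed
  then show ?thesis unfolding yderiv_def using ex by (metis theI)
qed

subsection \<open>Composites of partial derivatives\<close>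

text \<open>Words in the derivations, counted by length. The constructor adds the derivation that
  acts first, because \<open>dcomp_order\<close> applies the Leibniz rule to the innermost
  argument.\<close>

inductive dcomp :: "('q \<Rightarrow> 'q) set \<Rightarrow> nat \<Rightarrow> ('q \<Rightarrow> 'q) \<Rightarrow> bool" for Ds where
  dcomp_id: "dcomp Ds 0 id"
| dcomp_Suc: "\<delta> \<in> Ds \<Longrightarrow> dcomp Ds k \<Delta> \<Longrightarrow> dcomp Ds (Suc k) (\<Delta> \<circ> \<delta>)"

lemma dcomp_Suc_left: "dcomp Ds k \<Delta> \<Longrightarrow> \<epsilon> \<in> Ds \<Longrightarrow> dcomp Ds (Suc k) (\<epsilon> \<circ> \<Delta>)"
proof (induction rule: dcomp.induct)
  case dcomp_id
  then show ?case using dcomp.dcomp_Suc[OF _ dcomp.dcomp_id, of \<epsilon> Ds] by simp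
next
  case (dcomp_Suc \<delta> k \<Delta>)
  then show ?case using dcomp.dcomp_Suc[of \<delta> Ds "Suc k" "\<epsilon> \<circ> \<Delta>"] by (simp only: comp_assoc)
qed

lemma dcomp_funpow_left: "dcomp Ds k \<Delta> \<Longrightarrow> \<epsilon> \<in> Ds \<Longrightarrow> \<exists>k'. dcomp Ds k' (\<epsilon> ^^ n \<circ> \<Delta>)"
proof (induction n)
  case (Suc n)
  then obtain k' where "dcomp Ds k' (\<epsilon> ^^ n \<circ> \<Delta>)" by blast
  then show ?case using dcomp_Suc_left Suc.prems(2) by (metis comp_assoc funpow.simps(2))
qed auto

lemma dcomp_add:
  "dcomp Ds k \<Delta> \<Longrightarrow> (\<And>\<delta>. \<delta> \<in> Ds \<Longrightarrow> deriv \<delta>) \<Longrightarrow> \<Delta> (a + b) = \<Delta> a + \<Delta> b"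
  by (induction arbitrary: a b rule: dcomp.induct) (auto simp: deriv_add)

lemma dcomp_const_mult:
  "dcomp Ds k \<Delta> \<Longrightarrow> (\<And>\<delta>. \<delta> \<in> Ds \<Longrightarrow> deriv \<delta> \<and> \<delta> c = 0) \<Longrightarrow> \<Delta> (c * x) = c * \<Delta> x"
proof (induction arbitrary: x rule: dcomp.induct)
  case (dcomp_Suc \<delta> k \<Delta>)
  then have "deriv \<delta>" "\<delta> c = 0" by auto
  then have "\<delta> (c * x) = c * \<delta> x" by (simp add: deriv_mult)
  then show ?case using dcomp_Suc.IH dcomp_Suc.prems by simp
qed simp

text \<open>An operator of order \<open>k\<close> is annihilated by \<open>k + 1\<close> commutators with multiplication by \<open>s\<close>;
  the coefficients below are those of the iterated commutator.\<close>

lemma dcomp_order: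
  fixes s :: "'q::field"
  assumes "dcomp Ds k \<Delta>" "\<And>\<delta>. \<delta> \<in> Ds \<Longrightarrow> deriv \<delta>" "n > k" "degree p \<le> B" "[:- s, 1:] ^ n dvd p"
  shows "(\<Sum>j\<le>B. coeff p j * \<Delta> (s ^ j * g)) = 0"
  using assms
proof (induction arbitrary: g n p rule: dcomp.induct)
  case dcomp_id
  have "[:- s, 1:] dvd p" using dcomp_id.prems(2,4) by (metis dvd_power dvd_trans gr0I)
  then have "poly p s = 0" by (simp add: poly_eq_0_iff_dvd)
  have "(\<Sum>j\<le>B. coeff p j * (s ^ j * g)) = (\<Sum>j\<le>degree p. coeff p j * (s ^ j * g))"
    using dcomp_id.prems(3) by (intro sum.mono_neutral_right) (auto simp: coeff_eq_0)
  also have "\<dots> = poly p s * g"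
    by (simp add: poly_altdef sum_distrib_right mult.assoc)
  finally show ?case using \<open>poly p s = 0\<close> by simp
next
  case (dcomp_Suc \<delta> k \<Delta>)
  note d = dcomp_Suc.prems(1)[OF dcomp_Suc.hyps(1)]
  obtain n' where n': "n = Suc n'" using dcomp_Suc.prems(2) by (cases n) auto
  have dv: "[:- s, 1:] ^ n' dvd pderiv p"
  proof -
    obtain q where q: "p = [:- s, 1:] ^ Suc n' * q" using dcomp_Suc.prems(4) n' by (auto elim: dvdE)
    have "pderiv p = [:- s, 1:] ^ n' * (smult (of_nat (Suc n')) q + [:- s, 1:] * pderiv q)"
      unfolding q by (simp add: pderiv_mult pderiv_power_Suc pderiv_pCons algebra_simps del: power_Suc of_nat_Suc)
        (simp add: algebra_simps)
    then show ?thesis by simp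
  qed
  have degd: "degree (pderiv p) \<le> B" 
    using dcomp_Suc.prems(3) by (intro degree_le) (simp add: coeff_pderiv coeff_eq_0)
  \<comment> \<open>The Leibniz terms that differentiate s^j assemble to the derivative of p, with
    the derivative of s absorbed into g: one factor X - s and one derivation are lost together. The
    degree bound B stays fixed so that all sums have the same range.\<close>
  have 1: "(\<Sum>j\<le>B. coeff (pderiv p) j * \<Delta> (s ^ j * (\<delta> s * g))) = 0"
    using dcomp_Suc.IH[of n' "pderiv p"] dcomp_Suc.prems n' dv degd by simp
  have 2: "(\<Sum>j\<le>B. coeff p j * \<Delta> (s ^ j * \<delta> g)) = 0"
    using dcomp_Suc.IH[of n p] dcomp_Suc.prems by simp
  have zero: "\<Delta> 0 = 0" using dcomp_const_mult[OF dcomp_Suc.hyps(2), of 0 0] dcomp_Suc.prems(1) deriv_0 by fastforce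
  have nat: "\<Delta> (of_nat m * x) = of_nat m * \<Delta> x" for m x
    using dcomp_const_mult[OF dcomp_Suc.hyps(2)] dcomp_Suc.prems(1) deriv_of_nat by blast
  have tm: "\<Delta> (\<delta> (s ^ j * g)) = of_nat j * \<Delta> (s ^ (j - 1) * (\<delta> s * g)) + \<Delta> (s ^ j * \<delta> g)" for j
  proof -
    have "\<delta> (s ^ j * g) = of_nat j * (s ^ (j - 1) * (\<delta> s * g)) + s ^ j * \<delta> g"
      by (simp add: deriv_mult[OF d] deriv_power[OF d] algebra_simps)
    then show ?thesis using dcomp_add[OF dcomp_Suc.hyps(2) dcomp_Suc.prems(1)] nat by simp
  qed
  have "(\<Sum>j\<le>B. coeff p j * (of_nat j * \<Delta> (s ^ (j - 1) * (\<delta> s * g))))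
      = (\<Sum>j\<le>Suc B. coeff p j * (of_nat j * \<Delta> (s ^ (j - 1) * (\<delta> s * g))))"
    using dcomp_Suc.prems(3) by (simp add: coeff_eq_0)
  also have "\<dots> = (\<Sum>j\<le>B. coeff (pderiv p) j * \<Delta> (s ^ j * (\<delta> s * g)))"
    by (subst sum.atMost_Suc_shift) (simp add: coeff_pderiv mult_ac)
  finally have "(\<Sum>j\<le>B. coeff p j * (of_nat j * \<Delta> (s ^ (j - 1) * (\<delta> s * g)))) = 0" using 1 by simp
  then show ?case using 2 by (simp add: tm distrib_left sum.distrib)
qed

lemma deriv_mon:
  fixes U :: "'v::finite \<Rightarrow> 'q::field"
  assumes d: "deriv \<delta>" and U: "\<And>i. \<delta> (U i) = (if i = j then 1 else 0)"
  shows "\<delta> (mon U m) = of_nat (m j) * mon U (m(j := m j - 1))"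
proof -
  have other: "\<delta> (\<Prod>i\<in>X. U i ^ m i) = 0" if "finite X" "j \<notin> X" for X
    using that by (induction X) (auto simp: deriv_1[OF d] deriv_mult[OF d] deriv_power[OF d] U)
  have "mon U m = U j ^ m j * (\<Prod>i\<in>UNIV - {j}. U i ^ m i)"
    by (rule prod.remove) auto
  then have "\<delta> (mon U m) = of_nat (m j) * (U j ^ (m j - 1) * (\<Prod>i\<in>UNIV - {j}. U i ^ m i))"
    by (simp add: deriv_mult[OF d] other deriv_power[OF d] U)
  also have "U j ^ (m j - 1) * (\<Prod>i\<in>UNIV - {j}. U i ^ m i) = mon U (m(j := m j - 1))"
    using prod.remove[of UNIV j "\<lambda>i. U i ^ (m(j := m j - 1)) i"] by simp
  finally show ?thesis .
qed

text \<open>The falling factorial is written as a! times a binomial, which is right even when a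
  exceeds the exponent. The prefactor c lets derivatives in several variables be taken one after
  another.\<close>

lemma funpow_deriv_mon:
  fixes U :: "'v::finite \<Rightarrow> 'q::field"
  assumes d: "deriv \<delta>" and U: "\<And>i. \<delta> (U i) = (if i = j then 1 else 0)"
  shows "(\<delta> ^^ a) (of_nat c * mon U m) = of_nat (c * (fact a * (m j choose a))) * mon U (m(j := m j - a))"
proof (induction a)
  case (Suc a)
  have "(fact a * (m j choose a)) * (m j - a) = fact (Suc a) * (m j choose Suc a)"
  proof -
    have "(m j - a) * (m j choose a) = Suc a * (m j choose Suc a)"
      by (simp only: binomial_absorb_comp binomial_absorption)
    then have "fact a * ((m j - a) * (m j choose a)) = fact a * (Suc a * (m j choose Suc a))" by simp
    then show ?thesis by (simp only: fact_Suc of_nat_id mult_ac)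
  qed
  then have "c * (fact a * (m j choose a)) * (m j - a) = c * (fact (Suc a) * (m j choose Suc a))"
    by (simp only: mult.assoc)
  then have e: "of_nat (c * (fact a * (m j choose a))) * of_nat (m j - a)
      = (of_nat (c * (fact (Suc a) * (m j choose Suc a))) :: 'q)"
    by (simp only: of_nat_mult[symmetric])
  have "(\<delta> ^^ Suc a) (of_nat c * mon U m)
      = \<delta> (of_nat (c * (fact a * (m j choose a))) * mon U (m(j := m j - a)))"
    using Suc by simp
  also have "\<dots> = of_nat (c * (fact a * (m j choose a))) * (of_nat (m j - a) * mon U (m(j := m j - Suc a)))"
    unfolding deriv_mult[OF d] deriv_of_nat[OF d] deriv_mon[OF d U]
    by (simp del: fun_upd_apply of_nat_mult add: fun_upd_same)
  also have "\<dots> = of_nat (c * (fact (Suc a) * (m j choose Suc a))) * mon U (m(j := m j - Suc a))"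
    unfolding e[symmetric] by (simp only: mult.assoc)
  finally show ?case .
qed simp

section \<open>Differential operators in the coordinates (t, y)\<close>

locale coordinates =
  fixes u :: "'v::{finite,linorder} \<Rightarrow> ('v, 'k::field) mpol" and T :: "'v set"
  assumes coord: "coord_system u"
begin

abbreviation "U i \<equiv> emb (u i)"

lemma yderiv_deriv: "j \<notin> T \<Longrightarrow> deriv (yderiv u T j)"
  using is_yderiv_yderiv[OF coord] by (auto simp: is_yderiv_def deriv_def)

lemma yderiv_coord: "j \<notin> T \<Longrightarrow> yderiv u T j (U i) = (if i = j then 1 else 0)"
  using is_yderiv_yderiv[OF coord, of j T] unfolding is_yderiv_def by (cases "i \<in> T") auto

lemma yderiv_pconst: "j \<notin> T \<Longrightarrow> yderiv u T j (emb (pconst c)) = 0"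
  using is_yderiv_yderiv[OF coord, of j T] unfolding is_yderiv_def by auto

lemma mpol_cases: obtains F where "f = peval u F"
  using coord unfolding coord_system_def by (metis bij_pointE)

lemma Kt_subring: "subring (Kt u T)"
  unfolding subring_def
proof (intro conjI ballI)
  have pv: "pvars (1::('v, 'k) mpol) = {}" by (auto simp: pvars_def)
  then show "1 \<in> Kt u T" unfolding Kt_def by (auto intro!: exI[of _ 1])
  fix a b assume "a \<in> Kt u T" "b \<in> Kt u T"
  then obtain F G where FG: "a = peval u F" "pvars F \<subseteq> T" "b = peval u G" "pvars G \<subseteq> T" by (auto simp: Kt_def)
  have "peval u (F - G) = a - b" using peval_add[of u "F - G" G] FG by (simp add: algebra_simps)
  moreover have "pvars (F - G) \<subseteq> T" using FG keys_diff[of F G] unfolding pvars_def by blast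
  ultimately show "a - b \<in> Kt u T" unfolding Kt_def by (metis (mono_tags, lifting) mem_Collect_eq)
  have "pvars (F * G) \<subseteq> T"
  proof
    fix i assume "i \<in> pvars (F * G)"
    then obtain m where m: "m \<in> Poly_Mapping.keys (F * G)" "i \<in> Poly_Mapping.keys m" by (auto simp: pvars_def)
    obtain a b where ab: "m = a + b" "a \<in> Poly_Mapping.keys F" "b \<in> Poly_Mapping.keys G"
      using keys_mult[of F G] m(1) by blast
    then have "i \<in> Poly_Mapping.keys a \<or> i \<in> Poly_Mapping.keys b" using m(2) keys_add[of a b] by blast
    then show "i \<in> T" using FG ab by (auto simp: pvars_def)
  qed
  then show "a * b \<in> Kt u T" unfolding Kt_def using FG peval_mult[of u F G] by (metis (mono_tags, lifting) mem_Collect_eq)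
qed

lemma pconst_mem_Kt: "pconst c \<in> Kt u T"
proof -
  have "pvars (pconst c :: ('v, 'k) mpol) = {}" by (auto simp: pvars_def pconst_def split: if_splits)
  then show ?thesis unfolding Kt_def using peval_pconst[of u c] by (metis (mono_tags, lifting) empty_subsetI mem_Collect_eq)
qed

lemma u_mem_Kt: "i \<in> T \<Longrightarrow> u i \<in> Kt u T"
proof -
  assume "i \<in> T"
  then have "pvars (Poly_Mapping.single (Poly_Mapping.single i 1) 1 :: ('v, 'k) mpol) \<subseteq> T"
    by (auto simp: pvars_def)
  then show ?thesis unfolding Kt_def using peval_var[of u i] by (metis (mono_tags, lifting) mem_Collect_eq)
qed

lemma yderiv_Kt:
  assumes "j \<notin> T" "h \<in> Kt u T" shows "yderiv u T j (emb h) = 0"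
proof -
  note d = yderiv_deriv[OF assms(1)]
  obtain F where F: "h = peval u F" "pvars F \<subseteq> T" using assms(2) by (auto simp: Kt_def)
  have "subring {x. yderiv u T j x = 0}"
    by (auto simp: subring_def deriv_1[OF d] deriv_diff[OF d] deriv_mult[OF d])
  then have "emb (peval u F) \<in> {x. yderiv u T j x = 0}"
    by (rule emb_peval_mem_subring) (use F assms in \<open>auto simp: yderiv_pconst yderiv_coord\<close>)
  then show ?thesis using F by simp
qed

lemma yderiv_range_emb:
  assumes "j \<notin> T" "x \<in> range emb" shows "yderiv u T j x \<in> range emb"
proof -
  note d = yderiv_deriv[OF assms(1)]
  have R: "subring (range (emb :: ('v, 'k) mpol \<Rightarrow> _))"
    unfolding subring_def by (auto simp: emb_1[symmetric] emb_diff[symmetric] emb_mult[symmetric])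
  obtain f where f: "x = emb f" using assms(2) by blast
  obtain F where F: "f = peval u F" by (rule mpol_cases)
  let ?E = "{x \<in> range emb. yderiv u T j x \<in> range emb}"
  have "subring ?E"
    unfolding subring_def using R subring_one[OF R] subring_zero[OF R]
    by (auto simp: deriv_1[OF d] deriv_diff[OF d] deriv_mult[OF d] simp del: image_iff intro!: subring_diff subring_mult subring_add)
  then have "emb (peval u F) \<in> ?E"
    by (rule emb_peval_mem_subring)
      (use assms subring_one[OF R] subring_zero[OF R] in \<open>auto simp: yderiv_pconst yderiv_coord\<close>)
  then show ?thesis using F f by simp
qed

abbreviation "Ds \<equiv> {yderiv u T j | j. j \<notin> T}"

lemma Ds_deriv: "\<delta> \<in> Ds \<Longrightarrow> deriv \<delta>"
  using yderiv_deriv by blast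

lemma ydpow_dcomp:
  assumes "Poly_Mapping.keys \<alpha> \<inter> T = {}"
  shows "\<exists>k. dcomp Ds k (ydpow u T \<alpha>)"
proof -
  have "\<exists>k. dcomp Ds k (foldr (\<lambda>j f. (yderiv u T j ^^ Poly_Mapping.lookup \<alpha> j) \<circ> f) js id)"
    if "set js \<inter> T = {}" for js
    using that
  proof (induction js)
    case Nil
    show ?case using dcomp_id by (auto simp: id_def)
  next
    case (Cons j js)
    then obtain k where "dcomp Ds k (foldr (\<lambda>j f. (yderiv u T j ^^ Poly_Mapping.lookup \<alpha> j) \<circ> f) js id)" by fastforce
    moreover have "yderiv u T j \<in> Ds" using Cons.prems by auto
    ultimately have "\<exists>k. dcomp Ds k (yderiv u T j ^^ Poly_Mapping.lookup \<alpha> j \<circ>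
        foldr (\<lambda>j f. (yderiv u T j ^^ Poly_Mapping.lookup \<alpha> j) \<circ> f) js id)"
      by (rule dcomp_funpow_left)
    then show ?case unfolding foldr.simps(2) by (subst o_apply)
  qed
  then show ?thesis unfolding ydpow_def using assms by simp
qed

text \<open>Dividing by alpha! leaves exactly the binomials that occur when powers of eta + z are
  expanded, which is how operators are matched with Taylor coefficients.\<close>

lemma ydpow_mon:
  assumes "Poly_Mapping.keys \<alpha> \<inter> T = {}"
  shows "ydpow u T \<alpha> (mon U m) =
    of_nat (\<Prod>i\<in>UNIV. fact (Poly_Mapping.lookup \<alpha> i) * (m i choose Poly_Mapping.lookup \<alpha> i))
      * mon U (\<lambda>i. m i - Poly_Mapping.lookup \<alpha> i)"
proof -
  let ?a = "Poly_Mapping.lookup \<alpha>"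
  have "foldr (\<lambda>j f. (yderiv u T j ^^ ?a j) \<circ> f) js id (mon U m) =
      of_nat (\<Prod>i\<in>set js. fact (?a i) * (m i choose ?a i))
        * mon U (\<lambda>i. m i - (if i \<in> set js then ?a i else 0))"
    if "set js \<inter> T = {}" "distinct js" for js
    using that
  proof (induction js)
    case (Cons j js)
    have j: "j \<notin> T" "j \<notin> set js" using Cons.prems by auto
    let ?m = "\<lambda>i. m i - (if i \<in> set js then ?a i else 0)"
    let ?c = "\<Prod>i\<in>set js. fact (?a i) * (m i choose ?a i)"
    have IH: "foldr (\<lambda>j f. (yderiv u T j ^^ ?a j) \<circ> f) js id (mon U m) = of_nat ?c * mon U ?m"
      by (rule Cons.IH) (use Cons.prems in auto)
    have "foldr (\<lambda>j f. (yderiv u T j ^^ ?a j) \<circ> f) (j # js) id (mon U m)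
        = (yderiv u T j ^^ ?a j) (of_nat ?c * mon U ?m)"
      by (simp only: foldr.simps comp_apply IH)
    also have "\<dots> = of_nat (?c * (fact (?a j) * (?m j choose ?a j))) * mon U (?m(j := ?m j - ?a j))"
      by (rule funpow_deriv_mon[OF yderiv_deriv[OF j(1)] yderiv_coord[OF j(1)]])
    also have "?c * (fact (?a j) * (?m j choose ?a j)) = (\<Prod>i\<in>set (j # js). fact (?a i) * (m i choose ?a i))"
      using j by (simp add: mult.commute)
    also have "?m(j := ?m j - ?a j) = (\<lambda>i. m i - (if i \<in> set (j # js) then ?a i else 0))"
      using j by auto
    finally show ?case .
  qed simp
  from this[of "sorted_list_of_set (Poly_Mapping.keys \<alpha>)"]
  have "ydpow u T \<alpha> (mon U m) = of_nat (\<Prod>i\<in>Poly_Mapping.keys \<alpha>. fact (?a i) * (m i choose ?a i))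
        * mon U (\<lambda>i. m i - (if i \<in> Poly_Mapping.keys \<alpha> then ?a i else 0))"
    using assms by (simp add: ydpow_def)
  also have "(\<Prod>i\<in>Poly_Mapping.keys \<alpha>. fact (?a i) * (m i choose ?a i)) = (\<Prod>i\<in>UNIV. fact (?a i) * (m i choose ?a i))"
    by (rule prod.mono_neutral_left) (auto simp: in_keys_iff)
  also have "(\<lambda>i. m i - (if i \<in> Poly_Mapping.keys \<alpha> then ?a i else 0)) = (\<lambda>i. m i - ?a i)"
    by (auto simp: in_keys_iff)
  finally show ?thesis .
qed

lemma ydpow_add: "Poly_Mapping.keys \<alpha> \<inter> T = {} \<Longrightarrow> ydpow u T \<alpha> (x + y) = ydpow u T \<alpha> x + ydpow u T \<alpha> y"
  using ydpow_dcomp[of \<alpha>] dcomp_add[OF _ Ds_deriv] by blast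

lemma ydpow_const_mult:
  assumes "Poly_Mapping.keys \<alpha> \<inter> T = {}" "\<And>j. j \<notin> T \<Longrightarrow> yderiv u T j c = 0"
  shows "ydpow u T \<alpha> (c * x) = c * ydpow u T \<alpha> x"
proof -
  obtain k where k: "dcomp Ds k (ydpow u T \<alpha>)" using ydpow_dcomp[OF assms(1)] by blast
  show ?thesis by (rule dcomp_const_mult[OF k]) (use assms(2) yderiv_deriv in auto)
qed

lemma ydpow_range_emb:
  assumes "Poly_Mapping.keys \<alpha> \<inter> T = {}" shows "ydpow u T \<alpha> (emb f) \<in> range emb"
proof -
  have "\<Delta> x \<in> range emb" if "dcomp Ds k \<Delta>" "x \<in> range emb" for \<Delta> k x
    using that by (induction arbitrary: x rule: dcomp.induct) (auto simp: yderiv_range_emb simp del: image_iff)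
  then show ?thesis using ydpow_dcomp[OF assms] by blast
qed

lemma dapply_add:
  assumes "is_dop u T D" shows "dapply u T D (x + y) = dapply u T D x + dapply u T D y"
  unfolding dapply_def sum.distrib[symmetric]
  by (rule sum.cong) (use assms in \<open>auto simp: is_dop_def ydpow_add distrib_left\<close>)

lemma dapply_const_mult:
  assumes "is_dop u T D" "\<And>j. j \<notin> T \<Longrightarrow> yderiv u T j c = 0"
  shows "dapply u T D (c * x) = c * dapply u T D x"
  unfolding dapply_def sum_distrib_left
  by (rule sum.cong) (use assms in \<open>auto simp: is_dop_def ydpow_const_mult mult_ac\<close>)

text \<open>Operators are K(t)-linear, which reduces every test on an extended ideal to
  numerators.\<close>

lemma dapply_Kt_divide:
  assumes "is_dop u T D" "h \<in> Kt u T"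
  shows "dapply u T D (x / emb h) = dapply u T D x / emb h"
proof -
  have "yderiv u T j (inverse (emb h)) = 0" if "j \<notin> T" for j
    using deriv_inverse[OF yderiv_deriv[OF that]] yderiv_Kt[OF that assms(2)] by simp
  then have "dapply u T D (inverse (emb h) * x) = inverse (emb h) * dapply u T D x"
    by (rule dapply_const_mult[OF assms(1)])
  then show ?thesis by (simp add: divide_inverse mult.commute)
qed

lemma dapply_zero: "is_dop u T D \<Longrightarrow> dapply u T D 0 = 0"
  using dapply_add[of D 0 0] by (metis add.right_neutral add_left_cancel)

lemma dapply_sum: "is_dop u T D \<Longrightarrow> dapply u T D (sum g X) = (\<Sum>x\<in>X. dapply u T D (g x))"
  by (induction X rule: infinite_finite_induct) (auto simp: dapply_add dapply_zero)

lemma dapply_eq_sum: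
  assumes "finite X" "Poly_Mapping.keys D \<subseteq> X"
  shows "dapply u T D g = (\<Sum>\<alpha>\<in>X. Poly_Mapping.lookup D \<alpha> * ydpow u T \<alpha> g)"
  unfolding dapply_def using assms by (intro sum.mono_neutral_left) (auto simp: in_keys_iff)

lemma dapply_plus: "dapply u T (D + E) g = dapply u T D g + dapply u T E g"
proof -
  let ?X = "Poly_Mapping.keys D \<union> Poly_Mapping.keys E"
  show ?thesis using keys_add[of D E] dapply_eq_sum[of ?X D] dapply_eq_sum[of ?X E] dapply_eq_sum[of ?X "D + E"]
    by (simp add: lookup_add distrib_right sum.distrib)
qed

lemma lookup_dscale: "Poly_Mapping.lookup (dscale c D) \<alpha> = c * Poly_Mapping.lookup D \<alpha>"
  by (simp add: dscale_def map.rep_eq when_def)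

lemma dapply_dscale: "dapply u T (dscale c D) g = c * dapply u T D g"
proof -
  have "Poly_Mapping.keys (dscale c D) \<subseteq> Poly_Mapping.keys D" by (auto simp: in_keys_iff lookup_dscale)
  then show ?thesis using dapply_eq_sum[of "Poly_Mapping.keys D" "dscale c D"]
    by (simp add: dapply_def lookup_dscale sum_distrib_left mult.assoc)
qed

lemma Sloc_iff: "x \<in> Sloc u T \<longleftrightarrow> (\<exists>f h. x = emb f / emb h \<and> h \<in> Kt u T \<and> h \<noteq> 0)"
  by (auto simp: Sloc_def divide_fract)

lemma ext_ideal_iff: "x \<in> ext_ideal u T J \<longleftrightarrow> (\<exists>f h. x = emb f / emb h \<and> f \<in> J \<and> h \<in> Kt u T \<and> h \<noteq> 0)"
  by (auto simp: ext_ideal_def divide_fract)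

end

subsection \<open>Localization at a prime\<close>

context coordinates
begin

lemma Kt_mult: "a \<in> Kt u T \<Longrightarrow> b \<in> Kt u T \<Longrightarrow> a * b \<in> Kt u T"
  by (rule subring_mult[OF Kt_subring])

lemma Kt_one: "1 \<in> Kt u T"
  by (rule subring_one[OF Kt_subring])

lemma emb_nonzero: "h \<noteq> 0 \<Longrightarrow> emb (h::('v, 'k) mpol) \<noteq> 0"
  using emb_eq_iff[of h 0] by (simp add: emb_0)

lemma emb_in_Sloc: "emb f \<in> Sloc u T"
  unfolding Sloc_iff using Kt_one by (intro exI[of _ f] exI[of _ 1]) (auto simp: emb_1)

lemma emb_in_ext_ideal: "f \<in> J \<Longrightarrow> emb f \<in> ext_ideal u T J"
  unfolding ext_ideal_iff using Kt_one by (intro exI[of _ f] exI[of _ 1]) (auto simp: emb_1)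

lemma Sloc_mult: "x \<in> Sloc u T \<Longrightarrow> y \<in> Sloc u T \<Longrightarrow> x * y \<in> Sloc u T"
proof -
  assume "x \<in> Sloc u T" "y \<in> Sloc u T"
  then obtain f h f' h' where x: "x = emb f / emb h" "h \<in> Kt u T" "h \<noteq> 0"
    and y: "y = emb f' / emb h'" "h' \<in> Kt u T" "h' \<noteq> 0" unfolding Sloc_iff by blast
  have "x * y = emb (f * f') / emb (h * h')" using x y by (simp add: emb_mult)
  then show ?thesis unfolding Sloc_iff using x y Kt_mult[of h h'] by (metis no_zero_divisors)
qed

lemma Sloc_add: "x \<in> Sloc u T \<Longrightarrow> y \<in> Sloc u T \<Longrightarrow> x + y \<in> Sloc u T"
proof -
  assume "x \<in> Sloc u T" "y \<in> Sloc u T"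
  then obtain f h f' h' where x: "x = emb f / emb h" "h \<in> Kt u T" "h \<noteq> 0"
    and y: "y = emb f' / emb h'" "h' \<in> Kt u T" "h' \<noteq> 0" unfolding Sloc_iff by blast
  have "x + y = emb (f * h' + f' * h) / emb (h * h')"
    using x y emb_nonzero[of h] emb_nonzero[of h'] by (simp add: emb_mult emb_add add_frac_eq)
  then show ?thesis unfolding Sloc_iff using x y Kt_mult[of h h'] by (metis no_zero_divisors)
qed

lemma Sloc_sum: "(\<And>i. i \<in> X \<Longrightarrow> g i \<in> Sloc u T) \<Longrightarrow> sum g X \<in> Sloc u T"
  using emb_in_Sloc[of 0] by (induction X rule: infinite_finite_induct) (auto simp: Sloc_add emb_0)

lemma dapply_in_Sloc:
  assumes D: "is_dop u T D" and g: "g \<in> Sloc u T" shows "dapply u T D g \<in> Sloc u T"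
proof -
  obtain f h where x: "g = emb f / emb h" "h \<in> Kt u T" "h \<noteq> 0" using g unfolding Sloc_iff by blast
  have "dapply u T D (emb f) \<in> Sloc u T" unfolding dapply_def
  proof (intro Sloc_sum Sloc_mult)
    fix \<alpha> assume "\<alpha> \<in> Poly_Mapping.keys D"
    then have a: "Poly_Mapping.keys \<alpha> \<inter> T = {}" "Poly_Mapping.lookup D \<alpha> \<in> Sloc u T"
      using D by (auto simp: is_dop_def)
    show "Poly_Mapping.lookup D \<alpha> \<in> Sloc u T" by (rule a)
    show "ydpow u T \<alpha> (emb f) \<in> Sloc u T" using ydpow_range_emb[OF a(1), of f] emb_in_Sloc by auto
  qed
  moreover have "emb 1 / emb h \<in> Sloc u T" unfolding Sloc_iff using x by blast
  ultimately have "dapply u T D (emb f) * (emb 1 / emb h) \<in> Sloc u T" by (rule Sloc_mult)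
  then show ?thesis using dapply_Kt_divide[OF D x(2)] x(1) by (simp add: emb_1)
qed

lemma is_dop_add: "is_dop u T D \<Longrightarrow> is_dop u T E \<Longrightarrow> is_dop u T (D + E)"
proof -
  assume D: "is_dop u T D" "is_dop u T E"
  have z: "0 \<in> Sloc u T" using emb_in_Sloc[of 0] by (simp add: emb_0)
  have l: "Poly_Mapping.lookup F \<alpha> \<in> Sloc u T" if "is_dop u T F" for F \<alpha>
    using that z unfolding is_dop_def by (cases "\<alpha> \<in> Poly_Mapping.keys F") (auto simp: in_keys_iff)
  show ?thesis unfolding is_dop_def
  proof (intro ballI conjI)
    fix \<alpha> assume "\<alpha> \<in> Poly_Mapping.keys (D + E)"
    then have "\<alpha> \<in> Poly_Mapping.keys D \<or> \<alpha> \<in> Poly_Mapping.keys E" using keys_add[of D E] by blast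
    then show "Poly_Mapping.keys \<alpha> \<inter> T = {}" using D by (auto simp: is_dop_def)
    show "Poly_Mapping.lookup (D + E) \<alpha> \<in> Sloc u T" using l D by (simp add: lookup_add Sloc_add)
  qed
qed

lemma is_dop_dscale: "is_dop u T D \<Longrightarrow> c \<in> Sloc u T \<Longrightarrow> is_dop u T (dscale c D)"
  unfolding is_dop_def by (auto simp: in_keys_iff lookup_dscale Sloc_mult)

end

text \<open>\<open>Kt_P\<close> is the algebraic independence of t modulo P: K[t] meets P only in 0.
  Hence the denominators of S are units of R_P, and S lies inside R_P.\<close>

locale coordinates_prime = coordinates u T
  for u :: "'v::{finite,linorder} \<Rightarrow> ('v, 'k::field) mpol" and T +
  fixes P :: "('v, 'k) mpol set"
  assumes P: "is_prime_ideal P" and Kt_P: "h \<in> Kt u T \<Longrightarrow> h \<in> P \<Longrightarrow> h = 0"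
begin

lemma PI: "is_ideal P"
  by (rule prime_is_ideal[OF P])

lemma zero_P: "s \<notin> P \<Longrightarrow> s \<noteq> 0"
  using ideal_zero[OF PI] by auto

text \<open>The extension X R_P inside the fraction field; \<open>locI UNIV\<close> is R_P itself
  and \<open>locI P\<close> its maximal ideal.\<close>

definition locI :: "('v, 'k) mpol set \<Rightarrow> ('v, 'k) mpol fract set" where
  "locI X = {emb a / emb s | a s. a \<in> X \<and> s \<notin> P}"

lemma locI_I: "a \<in> X \<Longrightarrow> s \<notin> P \<Longrightarrow> emb a / emb s \<in> locI X"
  by (auto simp: locI_def)

lemma locI_E:
  assumes "x \<in> locI X"
  obtains a s where "x = emb a / emb s" "a \<in> X" "s \<notin> P" "emb s \<noteq> 0"
  using assms emb_nonzero zero_P unfolding locI_def by blast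

lemma divide_mem_locI_iff:
  assumes X: "is_ideal X" and s: "s \<notin> P"
  shows "emb a / emb s \<in> locI X \<longleftrightarrow> a \<in> loc X P"
proof
  note s' = emb_nonzero[OF zero_P[OF s]]
  assume "emb a / emb s \<in> locI X"
  then obtain b t where b: "emb a / emb s = emb b / emb t" "b \<in> X" "t \<notin> P" "emb t \<noteq> 0" by (rule locI_E)
  then have "emb (t * a) = emb (s * b)" using s' by (simp add: emb_mult frac_eq_eq mult.commute)
  then have "t * a = s * b" by (simp only: emb_eq_iff)
  then show "a \<in> loc X P" using b(2,3) ideal_mult[OF X] unfolding loc_def by auto
next
  assume "a \<in> loc X P"
  then obtain t where t: "t \<notin> P" "t * a \<in> X" by (auto simp: loc_def)
  have "emb a / emb s = emb (t * a) / emb (t * s)"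
    using emb_nonzero[OF zero_P[OF t(1)]] by (simp add: emb_mult)
  then show "emb a / emb s \<in> locI X" using locI_I[OF t(2) prime_mult[OF P t(1) s]] by simp
qed

lemma emb_mem_locI_iff: "is_ideal X \<Longrightarrow> emb a \<in> locI X \<longleftrightarrow> a \<in> loc X P"
  using divide_mem_locI_iff[of X 1 a] prime_one[OF P] by (simp add: emb_1)

lemma loc_P: "loc P P = P"
  using subset_loc[OF P, of P] prime_mult[OF P] by (auto simp: loc_def)

lemma emb_mem_locI_P: "emb a \<in> locI P \<longleftrightarrow> a \<in> P"
  using emb_mem_locI_iff[OF PI] loc_P by simp

lemma locI_add:
  assumes X: "is_ideal X" and "x \<in> locI X" "y \<in> locI X" shows "x + y \<in> locI X"
proof -
  obtain a s where x: "x = emb a / emb s" "a \<in> X" "s \<notin> P" "emb s \<noteq> 0" using assms(2) by (rule locI_E)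
  obtain b t where y: "y = emb b / emb t" "b \<in> X" "t \<notin> P" "emb t \<noteq> 0" using assms(3) by (rule locI_E)
  have "x + y = emb (a * t + b * s) / emb (s * t)"
    using x y by (simp add: emb_mult emb_add add_frac_eq)
  moreover have "a * t + b * s \<in> X" using x y by (intro ideal_add ideal_mult_right X)
  ultimately show ?thesis using locI_I prime_mult[OF P x(3) y(3)] by simp
qed

lemma locI_mult:
  assumes X: "is_ideal X" and "x \<in> locI UNIV" "y \<in> locI X" shows "x * y \<in> locI X"
proof -
  obtain a s where x: "x = emb a / emb s" "s \<notin> P" using assms(2) by (rule locI_E)
  obtain b t where y: "y = emb b / emb t" "b \<in> X" "t \<notin> P" using assms(3) by (rule locI_E)
  have "x * y = emb (a * b) / emb (s * t)" using x y by (simp add: emb_mult)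
  then show ?thesis using locI_I[OF ideal_mult[OF X y(2)] prime_mult[OF P x(2) y(3)]] by simp
qed

lemma UNIV_ideal: "is_ideal UNIV"
  by (auto simp: is_ideal_def)

lemma emb_in_O: "emb a \<in> locI UNIV"
  using locI_I[of a UNIV 1] prime_one[OF P] by (simp add: emb_1)

lemma locI_zero: "is_ideal X \<Longrightarrow> 0 \<in> locI X"
  using locI_I[OF ideal_zero prime_one[OF P], of X] by (simp add: emb_0)

lemma O_subring: "subring (locI UNIV)"
  unfolding subring_def
proof (intro conjI ballI)
  show "1 \<in> locI UNIV" using emb_in_O[of 1] by (simp add: emb_1)
  fix a b assume ab: "a \<in> locI UNIV" "b \<in> locI UNIV"
  show "a * b \<in> locI UNIV" by (rule locI_mult[OF UNIV_ideal ab])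
  have "emb (0 - 1) * b \<in> locI UNIV" by (rule locI_mult[OF UNIV_ideal emb_in_O ab(2)])
  then have "a + emb (0 - 1) * b \<in> locI UNIV" by (rule locI_add[OF UNIV_ideal ab(1)])
  then show "a - b \<in> locI UNIV" unfolding emb_diff emb_0 emb_1 by simp
qed

sublocale local_ring "locI UNIV" "locI P"
proof
  show "subring (locI UNIV)" by (rule O_subring)
  show "locI P \<subseteq> locI UNIV" by (auto simp: locI_def)
  show "1 \<notin> locI P" using emb_mem_locI_P[of 1] prime_one[OF P] by (simp add: emb_1)
  show "inverse a \<in> locI UNIV" if a: "a \<in> locI UNIV" "a \<notin> locI P" for a
  proof -
    obtain b s where x: "a = emb b / emb s" "s \<notin> P" using a(1) by (rule locI_E)
    then have "b \<notin> P" using a(2) locI_I by auto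
    then show ?thesis using locI_I[of s UNIV b] x by simp
  qed
qed (auto intro: locI_add locI_mult locI_zero PI)

lemma Kt_notin_P: "h \<in> Kt u T \<Longrightarrow> h \<noteq> 0 \<Longrightarrow> h \<notin> P"
  using Kt_P by blast

lemma ext_ideal_subset_locI: "ext_ideal u T J \<subseteq> locI J"
  unfolding locI_def using Kt_notin_P by (fastforce simp: ext_ideal_iff)

lemma Sloc_subset_O: "Sloc u T \<subseteq> locI UNIV"
  unfolding locI_def using Kt_notin_P by (fastforce simp: Sloc_iff)

text \<open>S meets P R_P exactly in P S, so dual spaces can be tested in R_P, where every element
  outside P is invertible.\<close>

lemma ext_ideal_P_iff:
  assumes "x \<in> Sloc u T" shows "x \<in> ext_ideal u T P \<longleftrightarrow> x \<in> locI P"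
proof
  obtain f h where x: "x = emb f / emb h" "h \<in> Kt u T" "h \<noteq> 0" using assms unfolding Sloc_iff by blast
  assume "x \<in> locI P"
  then have "f \<in> P" using divide_mem_locI_iff[OF PI Kt_notin_P[OF x(2,3)]] x(1) loc_P by simp
  then show "x \<in> ext_ideal u T P" unfolding ext_ideal_iff using x by blast
qed (use ext_ideal_subset_locI in blast)

lemma inverse_Kt_in_O: "h \<in> Kt u T \<Longrightarrow> h \<noteq> 0 \<Longrightarrow> inverse (emb h) \<in> locI UNIV"
  using locI_I[of 1 UNIV h] Kt_notin_P by (simp add: emb_1 divide_inverse)

lemma mem_dual_space_iff:
  assumes "J \<subseteq> Sloc u T"
  shows "D \<in> dual_space u T (ext_ideal u T P) J \<longleftrightarrow> is_dop u T D \<and> (\<forall>g\<in>J. dapply u T D g \<in> locI P)"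
  unfolding dual_space_def using assms dapply_in_Sloc ext_ideal_P_iff by blast

text \<open>This is the sense in which an operator sees only the localization. With n above all
  orders occurring in D, \<open>dcomp_order\<close> for p = (X - s)^n expresses
  \<open>coeff p 0\<close> times D(g) through the values of D at s g, ..., s^n g.\<close>

lemma dapply_locI_P_of_multiples:
  assumes D: "is_dop u T D" and s: "s \<notin> P"
    and m: "\<And>j. dapply u T D (emb s ^ Suc j * g) \<in> locI P"
  shows "dapply u T D g \<in> locI P"
proof -
  have "\<forall>\<alpha>\<in>Poly_Mapping.keys D. \<exists>k. dcomp Ds k (ydpow u T \<alpha>)"
    using D ydpow_dcomp by (auto simp: is_dop_def)
  from bchoice[OF this] obtain k where k: "\<And>\<alpha>. \<alpha> \<in> Poly_Mapping.keys D \<Longrightarrow> dcomp Ds (k \<alpha>) (ydpow u T \<alpha>)"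
    by blast
  define n where "n = Suc (\<Sum>\<alpha>\<in>Poly_Mapping.keys D. k \<alpha>)"
  have kn: "k \<alpha> < n" if "\<alpha> \<in> Poly_Mapping.keys D" for \<alpha>
    unfolding n_def using member_le_sum[OF that, of k] by simp
  let ?s = "emb s"
  define p where "p = [:- ?s, 1:] ^ n"
  let ?B = "degree p"
  have s_O: "0 - ?s \<in> locI UNIV" using emb_in_O[of "0 - s"] by (simp only: emb_diff emb_0)
  have p_O: "[:- ?s, 1:] ^ i \<in> pol (locI UNIV)" for i
  proof (induction i)
    case 0
    show ?case using subring_one[OF O] subring_zero[OF O] by (auto simp: coeff_1)
  next
    case (Suc i)
    have "[:- ?s, 1:] \<in> pol (locI UNIV)"
      using s_O subring_one[OF O] subring_zero[OF O] by (auto simp: coeff_pCons split: nat.splits)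
    from pol_mult[OF O this Suc] show ?case by (simp only: power_Suc)
  qed
  have "(\<Sum>j\<le>?B. coeff p j * dapply u T D (?s ^ j * g))
      = (\<Sum>\<alpha>\<in>Poly_Mapping.keys D. Poly_Mapping.lookup D \<alpha> * (\<Sum>j\<le>?B. coeff p j * ydpow u T \<alpha> (?s ^ j * g)))"
    unfolding dapply_def sum_distrib_left by (subst sum.swap) (simp add: mult_ac)
  also have "\<dots> = 0"
  proof (intro sum.neutral ballI)
    fix \<alpha> assume a: "\<alpha> \<in> Poly_Mapping.keys D"
    have "(\<Sum>j\<le>?B. coeff p j * ydpow u T \<alpha> (?s ^ j * g)) = 0"
      by (rule dcomp_order[OF k[OF a] Ds_deriv kn[OF a]]) (auto simp: p_def)
    then show "Poly_Mapping.lookup D \<alpha> * (\<Sum>j\<le>?B. coeff p j * ydpow u T \<alpha> (?s ^ j * g)) = 0" by simp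
  qed
  finally have "coeff p 0 * dapply u T D g + (\<Sum>j\<in>{..?B} - {0}. coeff p j * dapply u T D (?s ^ j * g)) = 0"
    by (subst (asm) sum.remove[of _ 0]) auto
  then have eq: "coeff p 0 * dapply u T D g = 0 - (\<Sum>j\<in>{..?B} - {0}. coeff p j * dapply u T D (?s ^ j * g))"
    by (simp add: eq_neg_iff_add_eq_0)
  have "coeff p 0 * dapply u T D g \<in> locI P" unfolding eq
  proof (intro M_diff M_zero M_sum)
    fix j assume "j \<in> {..?B} - {0}"
    then obtain i where "j = Suc i" by (cases j) auto
    then show "coeff p j * dapply u T D (?s ^ j * g) \<in> locI P"
      using M_mult[OF _ m[of i]] p_O[of n] unfolding p_def by blast
  qed
  \<comment> \<open>The constant coefficient is (-s)^n, a unit of R_P.\<close>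
  moreover have "coeff p 0 \<notin> locI P"
  proof -
    have "poly p 0 = emb ((0 - s) ^ n)"
      unfolding p_def emb_power emb_diff emb_0 by simp
    then have "coeff p 0 = emb ((0 - s) ^ n)" by (simp add: poly_0_coeff_0)
    moreover have "0 - s \<notin> P" using s ideal_diff[OF PI ideal_zero[OF PI], of "0 - s"] by auto
    ultimately show ?thesis using emb_mem_locI_P prime_power[OF P] by metis
  qed
  ultimately show ?thesis using M_prime p_O[of n] unfolding p_def by blast
qed

lemma finite_common_denominator:
  assumes "finite X" "X \<subseteq> locI UNIV"
  shows "\<exists>s. s \<notin> P \<and> (\<forall>x\<in>X. emb s * x \<in> range emb)"
  using assms
proof (induction X)
  case empty
  then show ?case using prime_one[OF P] by auto
next
  case (insert x X)
  then obtain s where s: "s \<notin> P" "\<And>y. y \<in> X \<Longrightarrow> emb s * y \<in> range emb" by auto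
  have "x \<in> locI UNIV" using insert.prems by auto
  then obtain a t where x: "x = emb a / emb t" "t \<notin> P" "emb t \<noteq> 0" by (rule locI_E)
  have "emb (s * t) * x = emb (s * a)" using x by (simp add: emb_mult)
  moreover have "emb (s * t) * y \<in> range emb" if y: "y \<in> X" for y
  proof -
    obtain b where "emb s * y = emb b" using s(2)[OF y] by auto
    then have "emb (s * t) * y = emb (t * b)" by (simp add: emb_mult mult_ac)
    then show ?thesis by blast
  qed
  ultimately show ?case using prime_mult[OF P s(1) x(2)] by (intro exI[of _ "s * t"]) auto
qed

end

subsection \<open>Separating operators\<close>

context local_ring_quotient
begin

lemma N_sum: "(\<And>i. i \<in> B \<Longrightarrow> g i \<in> N) \<Longrightarrow> sum g B \<in> N"
  by (induction B rule: infinite_finite_induct) (auto simp: N_zero N_add)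

lemma N_cong_prod:
  assumes "\<And>i. i \<in> B \<Longrightarrow> a i - b i \<in> N" "\<And>i. i \<in> B \<Longrightarrow> a i \<in> \<O>" "\<And>i. i \<in> B \<Longrightarrow> b i \<in> \<O>"
  shows "prod a B - prod b B \<in> N"
  using assms
proof (induction B rule: infinite_finite_induct)
  case (insert i B)
  have "prod a (insert i B) - prod b (insert i B) = a i * (prod a B - prod b B) + prod b B * (a i - b i)"
    using insert.hyps by (simp add: algebra_simps)
  moreover have "prod b B \<in> \<O>" using insert.prems by (intro subring_prod[OF O]) auto
  ultimately show ?case using insert by (simp add: N_add N_mult)
qed (auto simp: N_zero)

text \<open>The cut-off k does not depend on m, so one finite set of multi-indices, and hence one
  operator, serves all monomials.\<close>

lemma truncated_binomial:
  assumes "e \<in> \<O>" "z \<in> \<O>" "z ^ k \<in> N"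
  shows "(e + z) ^ m - (\<Sum>a<k. of_nat (m choose a) * e ^ (m - a) * z ^ a) \<in> N"
proof -
  let ?t = "\<lambda>a. of_nat (m choose a) * e ^ (m - a) * z ^ a"
  have "(e + z) ^ m = (\<Sum>a\<le>m. ?t a)"
    using binomial_ring[of z e m] by (simp add: add.commute mult_ac)
  \<comment> \<open>This range covers both the indices up to m and those below k; the terms beyond m
    vanish with their binomials.\<close>
  also have "\<dots> = (\<Sum>a<Suc m + k. ?t a)"
    by (rule sum.mono_neutral_left) (auto simp: binomial_eq_0)
  also have "\<dots> = (\<Sum>a<k. ?t a) + (\<Sum>a\<in>{..<Suc m + k} - {..<k}. ?t a)"
    by (subst sum.subset_diff[of "{..<k}"]) (auto simp: add.commute)
  finally have "(e + z) ^ m - (\<Sum>a<k. ?t a) = (\<Sum>a\<in>{..<Suc m + k} - {..<k}. ?t a)" by simp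
  moreover have "?t a \<in> N" if a: "a \<in> {..<Suc m + k} - {..<k}" for a
  proof -
    have "z ^ a = z ^ (a - k) * z ^ k" using a by (simp flip: power_add)
    then have "?t a = (of_nat (m choose a) * e ^ (m - a) * z ^ (a - k)) * z ^ k" by simp
    also have "\<dots> \<in> N"
      by (intro N_mult assms subring_mult subring_of_nat subring_power O)
    finally show ?thesis .
  qed
  ultimately show ?thesis by (simp only: N_sum)
qed

end

locale coordinates_prime_char0 = coordinates_prime u T P
  for u :: "'v::{finite,linorder} \<Rightarrow> ('v, 'k::field_char_0) mpol" and T P
begin

lemma of_nat_notin_M: "of_nat (Suc n) \<notin> locI P"
proof
  assume "of_nat (Suc n) \<in> locI P"
  then have "emb (of_nat (Suc n)) \<in> locI P" by (simp only: of_nat_fract)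
  then have "of_nat (Suc n) \<in> P" by (simp only: emb_mem_locI_P)
  then have "pconst (1 / of_nat (Suc n)) * of_nat (Suc n) \<in> P" by (rule ideal_mult[OF PI])
  also have "pconst (1 / of_nat (Suc n)) * of_nat (Suc n) = (pconst (1 / of_nat (Suc n) * of_nat (Suc n)) :: ('v, 'k) mpol)"
    by (simp only: pconst_mult) (simp add: pconst_def del: of_nat_Suc)
  also have "\<dots> = 1" by (simp del: of_nat_Suc)
  finally show False using prime_one[OF P] by simp
qed

text \<open>The operator D is built so that on all of R it agrees modulo \<open>locI P\<close> with
  s times the functional, for some s outside P.\<close>

lemma separating_operator:
  assumes I: "is_ideal I" and f: "f \<notin> loc I P"
  obtains D where "D \<in> dual_space u T (ext_ideal u T P) (ext_ideal u T I)"
    "dapply u T D (emb f) \<notin> ext_ideal u T P"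
proof -
  interpret noetherian_ring "TYPE(('v, 'k) mpol)" by standard (rule noetherian_mpol)
  obtain L K where L: "is_ideal L" "I \<subseteq> L" "1 \<in> colpow L P K" "f \<notin> loc L P"
    using krull_separation[OF I P f] by blast
  let ?O = "locI UNIV" and ?M = "locI P" and ?N = "locI L"
  have LP: "L \<subseteq> P" using L(4) ideal_mult_right[OF L(1)] unfolding loc_def by blast
  interpret Q: local_ring_quotient ?O ?M ?N K
  proof
    show "?N \<subseteq> ?M" using LP by (auto simp: locI_def)
    show "a ^ K \<in> ?N" if a: "a \<in> ?M" for a
    proof -
      obtain p s where x: "a = emb p / emb s" "p \<in> P" "s \<notin> P" using a by (rule locI_E)
      have "length (replicate K p) = K" "set (replicate K p) \<subseteq> P" using x by auto
      then have "1 * prod_list (replicate K p) \<in> L" using L(3) unfolding colpow_def mem_Collect_eq by blast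
      then have "p ^ K \<in> L" by simp
      moreover have "a ^ K = emb (p ^ K) / emb (s ^ K)" using x(1) by (simp add: power_divide emb_power)
      ultimately show ?thesis using locI_I prime_power[OF P x(3)] by simp
    qed
    show "of_nat (Suc n) \<notin> ?M" for n by (rule of_nat_notin_M)
  qed (auto intro: locI_add locI_mult locI_zero L)
  have F0: "subring (emb ` Kt u T)" unfolding subring_def
  proof (intro conjI ballI)
    show "1 \<in> emb ` Kt u T" using Kt_one by (auto simp: emb_1[symmetric])
    fix a b assume "a \<in> emb ` Kt u T" "b \<in> emb ` Kt u T"
    then show "a - b \<in> emb ` Kt u T" "a * b \<in> emb ` Kt u T"
      using subring_diff[OF Kt_subring] Kt_mult by (auto simp: emb_diff[symmetric] emb_mult[symmetric])
  qed
  have F0_M: "emb ` Kt u T \<inter> ?M \<subseteq> ?N"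
  proof
    fix x assume "x \<in> emb ` Kt u T \<inter> ?M"
    then obtain h where "x = emb h" "h \<in> Kt u T" "h \<in> P" using emb_mem_locI_P by auto
    then have "x = 0" using Kt_P[of h] by (simp add: emb_0)
    then show "x \<in> ?N" using locI_zero[OF L(1)] by simp
  qed
  obtain F where F: "subring F" "emb ` Kt u T \<subseteq> F" "F \<subseteq> ?O" "F \<inter> ?M \<subseteq> ?N"
    "\<And>a. a \<in> F \<Longrightarrow> a \<notin> ?M \<Longrightarrow> inverse a \<in> F" "\<And>\<theta>. \<theta> \<in> ?O \<Longrightarrow> \<exists>\<eta>\<in>F. \<theta> - \<eta> \<in> ?M"
    using Q.coefficient_field[OF F0 _ F0_M] emb_in_O by blast
  have fN: "emb f \<notin> ?N" using emb_mem_locI_iff[OF L(1)] L(4) by simp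
  obtain l where l: "\<And>x. x \<in> ?O \<Longrightarrow> l x \<in> F"
    "\<And>x y. x \<in> ?O \<Longrightarrow> y \<in> ?O \<Longrightarrow> l (x + y) - (l x + l y) \<in> ?M"
    "\<And>c x. c \<in> F \<Longrightarrow> x \<in> ?O \<Longrightarrow> l (c * x) - c * l x \<in> ?M"
    "\<And>x. x \<in> ?N \<Longrightarrow> l x \<in> ?M" "l (emb f) - 1 \<in> ?M"
    using Q.separating_functional[OF F(1,3,4,5) emb_in_O fN] by blast
  have lO: "l x \<in> ?O" if "x \<in> ?O" for x using l(1)[OF that] F(3) by blast
  have l_sum: "l (sum g X) - (\<Sum>x\<in>X. l (g x)) \<in> ?M" if "\<And>x. x \<in> X \<Longrightarrow> g x \<in> ?O" for g and X :: "'x set"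
    using that
  proof (induction X rule: infinite_finite_induct)
    case (insert x X)
    have "l (g x + sum g X) - (l (g x) + l (sum g X)) \<in> ?M"
      using insert.prems by (intro l(2) subring_sum[OF O]) auto
    moreover have "l (sum g X) - (\<Sum>x\<in>X. l (g x)) \<in> ?M" using insert by auto
    ultimately have "(l (g x + sum g X) - (l (g x) + l (sum g X))) + (l (sum g X) - (\<Sum>x\<in>X. l (g x))) \<in> ?M"
      by (rule M_add)
    then show ?case using insert.hyps by (simp add: algebra_simps)
  qed (use l(4)[OF locI_zero[OF L(1)]] in auto)
  have l_cong: "l x - l y \<in> ?M" if xy: "x - y \<in> ?N" "x \<in> ?O" "y \<in> ?O" for x y
  proof -
    have "l (y + (x - y)) - (l y + l (x - y)) \<in> ?M" using xy by (intro l(2) subring_diff[OF O])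
    then have "l (y + (x - y)) - (l y + l (x - y)) + l (x - y) \<in> ?M" using l(4)[OF xy(1)] by (rule M_add)
    then show ?thesis by (simp add: algebra_simps)
  qed
  have "\<forall>i. \<exists>\<eta>. \<eta> \<in> F \<and> U i - \<eta> \<in> ?M \<and> (i \<in> T \<longrightarrow> \<eta> = U i)"
  proof
    fix i
    show "\<exists>\<eta>. \<eta> \<in> F \<and> U i - \<eta> \<in> ?M \<and> (i \<in> T \<longrightarrow> \<eta> = U i)"
    proof (cases "i \<in> T")
      case True
      then show ?thesis using F(2) u_mem_Kt[OF True] M_zero by auto
    next
      case False
      then show ?thesis using F(6)[OF emb_in_O] by blast
    qed
  qed
  from choice[OF this] obtain \<eta> where \<eta>: "\<And>i. \<eta> i \<in> F" "\<And>i. U i - \<eta> i \<in> ?M" "\<And>i. i \<in> T \<Longrightarrow> \<eta> i = U i"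
    by blast
  define z where "z i = U i - \<eta> i" for i
  \<comment> \<open>For i in T the element z i is 0, so exponent 1 already suffices. This choice
    forces the multi-indices in \<open>\<Lambda>\<close> to vanish on T, as \<open>is_dop\<close>
    demands.\<close>
  define k where "k i = (if i \<in> T then 1 else K)" for i
  have zM: "z i \<in> ?M" for i unfolding z_def by (rule \<eta>)
  have zO: "z i \<in> ?O" for i using zM M_sub by blast
  have \<eta>O: "\<eta> i \<in> ?O" for i using \<eta>(1) F(3) by blast
  have zk: "z i ^ k i \<in> ?N" for i
    using Q.N_power[OF zM] \<eta>(3)[of i] locI_zero[OF L(1)] by (auto simp: k_def z_def)
  define \<Lambda> where "\<Lambda> = PiE UNIV (\<lambda>i. {..<k i})"
  have fin: "finite \<Lambda>" unfolding \<Lambda>_def by (intro finite_PiE) auto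
  \<comment> \<open>These coefficients lie in F, so l passes through them and only its values at
    monomials in z remain.\<close>
  define b where "b m \<alpha> = (\<Prod>i\<in>UNIV. of_nat (m i choose \<alpha> i) * \<eta> i ^ (m i - \<alpha> i))" for m \<alpha> :: "'v \<Rightarrow> nat"
  have bF: "b m \<alpha> \<in> F" for m \<alpha>
    unfolding b_def by (intro subring_prod subring_mult subring_of_nat subring_power F \<eta>)
  have zzO: "mon z \<alpha> \<in> ?O" for \<alpha> by (intro subring_prod subring_power O zO)
  have UO: "mon U m \<in> ?O" for m by (intro subring_prod subring_power O emb_in_O)
  have l_mon: "l (mon U m) - (\<Sum>\<alpha>\<in>\<Lambda>. b m \<alpha> * l (mon z \<alpha>)) \<in> ?M" for m
  proof -
    have t: "(\<Sum>a<k i. of_nat (m i choose a) * \<eta> i ^ (m i - a) * z i ^ a) \<in> ?O" for i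
      by (intro subring_sum subring_mult subring_of_nat subring_power O zO \<eta>O)
    have "U i ^ m i - (\<Sum>a<k i. of_nat (m i choose a) * \<eta> i ^ (m i - a) * z i ^ a) \<in> ?N" for i
      using Q.truncated_binomial[OF \<eta>O[of i] zO[of i] zk[of i], of "m i"] by (simp add: z_def)
    then have "mon U m - (\<Prod>i\<in>UNIV. \<Sum>a<k i. of_nat (m i choose a) * \<eta> i ^ (m i - a) * z i ^ a) \<in> ?N"
      by (intro Q.N_cong_prod t subring_power O emb_in_O)
    also have "(\<Prod>i\<in>UNIV. \<Sum>a<k i. of_nat (m i choose a) * \<eta> i ^ (m i - a) * z i ^ a)
        = (\<Sum>\<alpha>\<in>\<Lambda>. \<Prod>i\<in>UNIV. of_nat (m i choose \<alpha> i) * \<eta> i ^ (m i - \<alpha> i) * z i ^ \<alpha> i)"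
      unfolding \<Lambda>_def by (rule prod_sum_PiE) auto
    also have "\<dots> = (\<Sum>\<alpha>\<in>\<Lambda>. b m \<alpha> * mon z \<alpha>)" by (simp add: b_def prod.distrib)
    finally have N: "mon U m - (\<Sum>\<alpha>\<in>\<Lambda>. b m \<alpha> * mon z \<alpha>) \<in> ?N" .
    have bO: "b m \<alpha> * mon z \<alpha> \<in> ?O" for \<alpha> using bF F(3) zzO by (intro subring_mult O) auto
    have "l (mon U m) - l (\<Sum>\<alpha>\<in>\<Lambda>. b m \<alpha> * mon z \<alpha>) \<in> ?M"
      by (rule l_cong[OF N UO]) (intro subring_sum O bO)
    moreover have "l (\<Sum>\<alpha>\<in>\<Lambda>. b m \<alpha> * mon z \<alpha>) - (\<Sum>\<alpha>\<in>\<Lambda>. l (b m \<alpha> * mon z \<alpha>)) \<in> ?M"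
      by (rule l_sum) (rule bO)
    moreover have "(\<Sum>\<alpha>\<in>\<Lambda>. l (b m \<alpha> * mon z \<alpha>)) - (\<Sum>\<alpha>\<in>\<Lambda>. b m \<alpha> * l (mon z \<alpha>)) \<in> ?M"
      unfolding sum_subtractf[symmetric] by (intro M_sum l(3) bF zzO)
    ultimately show ?thesis using M_cong_trans by blast
  qed
  define fa where "fa \<alpha> = (\<Prod>i\<in>UNIV. fact (\<alpha> i) :: nat)" for \<alpha> :: "'v \<Rightarrow> nat"
  have fa: "of_nat (fa \<alpha>) \<notin> ?M" for \<alpha>
  proof -
    have "fa \<alpha> \<noteq> 0" by (simp add: fa_def)
    then obtain n where "fa \<alpha> = Suc n" by (cases "fa \<alpha>") auto
    then show ?thesis using of_nat_notin_M by metis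
  qed
  then have fa0: "(of_nat (fa \<alpha>) :: ('v, 'k) mpol fract) \<noteq> 0" for \<alpha> using M_zero by metis
  \<comment> \<open>The Taylor coefficients lie in R_P, whereas an operator needs coefficients in S;
    a common denominator s turns them into polynomials.\<close>
  have "(\<lambda>\<alpha>. l (mon z \<alpha>) * inverse (of_nat (fa \<alpha>))) ` \<Lambda> \<subseteq> ?O"
    using lO[OF zzO] inv[OF subring_of_nat[OF O] fa] subring_mult[OF O] by blast
  from finite_common_denominator[OF finite_imageI[OF fin] this]
  obtain s where s: "s \<notin> P"
    and sx: "\<forall>x\<in>(\<lambda>\<alpha>. l (mon z \<alpha>) * inverse (of_nat (fa \<alpha>))) ` \<Lambda>. emb s * x \<in> range emb"
    by (elim exE conjE)
  define c where "c \<alpha> = emb s * (l (mon z \<alpha>) * inverse (of_nat (fa \<alpha>)))" for \<alpha>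
  have look: "Poly_Mapping.lookup (Abs_poly_mapping \<alpha>) = \<alpha>" for \<alpha> :: "'v \<Rightarrow> nat"
    by (rule lookup_Abs_poly_mapping) simp
  define D where "D = (\<Sum>\<alpha>\<in>\<Lambda>. Poly_Mapping.single (Abs_poly_mapping \<alpha>) (c \<alpha>))"
  have lookD: "Poly_Mapping.lookup D (Abs_poly_mapping \<alpha>) = c \<alpha>" if "\<alpha> \<in> \<Lambda>" for \<alpha>
  proof -
    have "Poly_Mapping.lookup D (Abs_poly_mapping \<alpha>) = (\<Sum>\<beta>\<in>\<Lambda>. if \<beta> = \<alpha> then c \<alpha> else 0)"
      unfolding D_def lookup_sum
    proof (rule sum.cong)
      fix \<beta>
      have "Abs_poly_mapping \<beta> = Abs_poly_mapping \<alpha> \<longleftrightarrow> \<beta> = \<alpha>" by (metis look)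
      then show "Poly_Mapping.lookup (Poly_Mapping.single (Abs_poly_mapping \<beta>) (c \<beta>)) (Abs_poly_mapping \<alpha>)
          = (if \<beta> = \<alpha> then c \<alpha> else 0)" by (auto simp: lookup_single when_def)
    qed simp
    then show ?thesis using fin that by simp
  qed
  have keysD: "Poly_Mapping.keys D \<subseteq> Abs_poly_mapping ` \<Lambda>"
    unfolding D_def using keys_sum[of "\<lambda>\<alpha>. Poly_Mapping.single (Abs_poly_mapping \<alpha>) (c \<alpha>)" \<Lambda>]
    by (auto split: if_splits)
  have keys_T: "Poly_Mapping.keys (Abs_poly_mapping \<alpha>) \<inter> T = {}" if "\<alpha> \<in> \<Lambda>" for \<alpha>
  proof -
    have "\<alpha> i = 0" if "i \<in> T" for i
    proof -
      have "\<alpha> i < k i" using \<open>\<alpha> \<in> \<Lambda>\<close> unfolding \<Lambda>_def by (auto simp: PiE_def Pi_def)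
      then show ?thesis using that by (simp add: k_def)
    qed
    then show ?thesis by (auto simp: in_keys_iff look)
  qed
  have dop: "is_dop u T D" unfolding is_dop_def
  proof
    fix \<beta> assume "\<beta> \<in> Poly_Mapping.keys D"
    then obtain \<alpha> where a: "\<alpha> \<in> \<Lambda>" "\<beta> = Abs_poly_mapping \<alpha>" using keysD by blast
    obtain r where "c \<alpha> = emb r" using bspec[OF sx imageI[OF a(1)]] unfolding c_def by blast
    then show "Poly_Mapping.keys \<beta> \<inter> T = {} \<and> Poly_Mapping.lookup D \<beta> \<in> Sloc u T"
      using keys_T[OF a(1)] lookD[OF a(1)] a(2) emb_in_Sloc by simp
  qed
  have D_mon: "dapply u T D (mon U m) - emb s * l (mon U m) \<in> ?M" for m
  proof -
    have "inj_on Abs_poly_mapping \<Lambda>" by (rule inj_onI) (metis look)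
    then have "dapply u T D (mon U m) = (\<Sum>\<alpha>\<in>\<Lambda>. c \<alpha> * ydpow u T (Abs_poly_mapping \<alpha>) (mon U m))"
      using dapply_eq_sum[OF finite_imageI[OF fin] keysD] lookD by (simp add: sum.reindex)
    also have "\<dots> = (\<Sum>\<alpha>\<in>\<Lambda>. emb s * (l (mon z \<alpha>) *
        (\<Prod>i\<in>UNIV. of_nat (m i choose \<alpha> i) * U i ^ (m i - \<alpha> i))))"
    proof (rule sum.cong)
      fix \<alpha> assume a: "\<alpha> \<in> \<Lambda>"
      have "ydpow u T (Abs_poly_mapping \<alpha>) (mon U m)
          = of_nat (fa \<alpha>) * (\<Prod>i\<in>UNIV. of_nat (m i choose \<alpha> i) * U i ^ (m i - \<alpha> i))"
        unfolding ydpow_mon[OF keys_T[OF a]] look fa_def by (simp add: prod.distrib mult.assoc)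
      then have "c \<alpha> * ydpow u T (Abs_poly_mapping \<alpha>) (mon U m)
          = emb s * (l (mon z \<alpha>) * (inverse (of_nat (fa \<alpha>)) * of_nat (fa \<alpha>)) *
             (\<Prod>i\<in>UNIV. of_nat (m i choose \<alpha> i) * U i ^ (m i - \<alpha> i)))"
        unfolding c_def by (simp only: mult.assoc)
      then show "c \<alpha> * ydpow u T (Abs_poly_mapping \<alpha>) (mon U m)
          = emb s * (l (mon z \<alpha>) * (\<Prod>i\<in>UNIV. of_nat (m i choose \<alpha> i) * U i ^ (m i - \<alpha> i)))"
        using fa0 by simp
    qed simp
    finally have D_eq: "dapply u T D (mon U m) = (\<Sum>\<alpha>\<in>\<Lambda>. emb s * (l (mon z \<alpha>) *
        (\<Prod>i\<in>UNIV. of_nat (m i choose \<alpha> i) * U i ^ (m i - \<alpha> i))))" .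
    \<comment> \<open>Modulo the maximal ideal the coordinates U agree with eta, so reducing a
      derivative of a monomial yields its Taylor coefficient at eta.\<close>
    have pb: "(\<Prod>i\<in>UNIV. of_nat (m i choose \<alpha> i) * U i ^ (m i - \<alpha> i)) - b m \<alpha> \<in> ?M" for \<alpha>
      unfolding b_def
      by (intro M_cong_prod M_cong_mult M_cong_power subring_mult subring_power subring_of_nat O emb_in_O \<eta>O \<eta>(2))
        (simp add: M_zero)
    have "emb s * (l (mon z \<alpha>) * (\<Prod>i\<in>UNIV. of_nat (m i choose \<alpha> i) * U i ^ (m i - \<alpha> i)))
        - emb s * (l (mon z \<alpha>) * b m \<alpha>) \<in> ?M" for \<alpha>
      unfolding right_diff_distrib[symmetric] by (intro M_mult emb_in_O lO zzO pb)
    then have 1: "dapply u T D (mon U m) - (\<Sum>\<alpha>\<in>\<Lambda>. emb s * (l (mon z \<alpha>) * b m \<alpha>)) \<in> ?M"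
      unfolding D_eq sum_subtractf[symmetric] by (intro M_sum)
    have 2: "(\<Sum>\<alpha>\<in>\<Lambda>. emb s * (l (mon z \<alpha>) * b m \<alpha>)) = emb s * (\<Sum>\<alpha>\<in>\<Lambda>. b m \<alpha> * l (mon z \<alpha>))"
      by (simp add: sum_distrib_left mult_ac)
    have 3: "emb s * (\<Sum>\<alpha>\<in>\<Lambda>. b m \<alpha> * l (mon z \<alpha>)) - emb s * l (mon U m) \<in> ?M"
      unfolding right_diff_distrib[symmetric] by (intro M_mult emb_in_O M_cong_sym[OF l_mon])
    show ?thesis using M_cong_trans[OF 1[unfolded 2] 3] .
  qed
  have D_emb: "dapply u T D (emb g) - emb s * l (emb g) \<in> ?M" for g
  proof -
    obtain G where G: "g = peval u G" by (rule mpol_cases)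
    let ?X = "Poly_Mapping.keys G"
    define C :: "_ \<Rightarrow> ('v, 'k) mpol fract" where "C m = emb (pconst (Poly_Mapping.lookup G m))" for m
    let ?mon = "\<lambda>m. mon U (Poly_Mapping.lookup m)"
    have g: "emb g = (\<Sum>m\<in>?X. C m * ?mon m)"
      unfolding G peval_eq_sum[OF finite_keys subset_refl] emb_sum emb_mult emb_mon C_def ..
    have CF: "C m \<in> F" for m unfolding C_def using F(2) pconst_mem_Kt by blast
    have CO: "C m \<in> ?O" for m unfolding C_def by (rule emb_in_O)
    have 0: "dapply u T D (emb g) = (\<Sum>m\<in>?X. C m * dapply u T D (?mon m))"
      unfolding g dapply_sum[OF dop]
      by (rule sum.cong) (auto simp: C_def dapply_const_mult[OF dop] yderiv_pconst)
    have 1: "(\<Sum>m\<in>?X. C m * dapply u T D (?mon m)) - (\<Sum>m\<in>?X. C m * (emb s * l (?mon m))) \<in> ?M"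
      unfolding sum_subtractf[symmetric] right_diff_distrib[symmetric] by (intro M_sum M_mult CO D_mon)
    have 2: "(\<Sum>m\<in>?X. C m * (emb s * l (?mon m))) = emb s * (\<Sum>m\<in>?X. C m * l (?mon m))"
      by (simp add: sum_distrib_left mult_ac)
    have 3: "emb s * (\<Sum>m\<in>?X. C m * l (?mon m)) - emb s * l (emb g) \<in> ?M"
    proof -
      have "l (emb g) - (\<Sum>m\<in>?X. l (C m * ?mon m)) \<in> ?M"
        unfolding g by (intro l_sum subring_mult O CO UO)
      moreover have "(\<Sum>m\<in>?X. l (C m * ?mon m)) - (\<Sum>m\<in>?X. C m * l (?mon m)) \<in> ?M"
        unfolding sum_subtractf[symmetric] by (intro M_sum l(3) CF UO)
      ultimately have "l (emb g) - (\<Sum>m\<in>?X. C m * l (?mon m)) \<in> ?M" by (rule M_cong_trans)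
      then show ?thesis unfolding right_diff_distrib[symmetric] by (rule M_mult[OF emb_in_O M_cong_sym])
    qed
    show ?thesis unfolding 0 using M_cong_trans[OF 1[unfolded 2] 3] .
  qed
  show thesis
  proof (rule that)
    have "ext_ideal u T I \<subseteq> Sloc u T" unfolding ext_ideal_def Sloc_def by blast
    moreover have "dapply u T D x \<in> ?M" if x: "x \<in> ext_ideal u T I" for x
    proof -
      obtain a h where a: "x = emb a / emb h" "a \<in> I" "h \<in> Kt u T" "h \<noteq> 0"
        using x unfolding ext_ideal_iff by blast
      have "emb a \<in> ?N" using a(2) L(2) subset_loc[OF P, of L] emb_mem_locI_iff[OF L(1)] by blast
      then have "emb s * l (emb a) \<in> ?M" by (intro M_mult emb_in_O l(4))
      then have "dapply u T D (emb a) \<in> ?M" using M_cong_mem[OF D_emb] by blast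
      then have "inverse (emb h) * dapply u T D (emb a) \<in> ?M"
        by (rule M_mult[OF inverse_Kt_in_O[OF a(3,4)]])
      then show ?thesis unfolding a(1) dapply_Kt_divide[OF dop a(3)] by (simp add: divide_inverse mult.commute)
    qed
    ultimately show "D \<in> dual_space u T (ext_ideal u T P) (ext_ideal u T I)"
      using mem_dual_space_iff dop by blast
    \<comment> \<open>Since l(f) is 1 modulo the maximal ideal, D(f) is congruent to s, which is a
      unit of R_P.\<close>
    have "emb s * l (emb f) - emb s \<in> ?M"
      using M_mult[OF emb_in_O l(5), of s] by (simp add: algebra_simps)
    then have "dapply u T D (emb f) - emb s \<in> ?M" using D_emb M_cong_trans by blast
    moreover have "emb s \<notin> ?M" using s emb_mem_locI_P by simp
    ultimately have "dapply u T D (emb f) \<notin> ?M" using M_cong_mem by blast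
    then show "dapply u T D (emb f) \<notin> ext_ideal u T P" using ext_ideal_subset_locI by blast
  qed
qed

end

subsection \<open>Recovering the ideal\<close>

context coordinates_prime_char0
begin

lemma prod_list_ext_ideal:
  assumes "set qs \<subseteq> ext_ideal u T P"
  obtains ps h where "length ps = length qs" "set ps \<subseteq> P" "h \<in> Kt u T" "h \<noteq> 0"
    "prod_list qs = emb (prod_list ps) / emb h"
proof -
  have "\<exists>ps h. length ps = length qs \<and> set ps \<subseteq> P \<and> h \<in> Kt u T \<and> h \<noteq> 0 \<and>
      prod_list qs = emb (prod_list ps) / emb h"
    using assms
  proof (induction qs)
    case Nil
    then show ?case using Kt_one by (intro exI[of _ "[]"] exI[of _ 1]) (auto simp: emb_1)
  next
    case (Cons q qs)
    then obtain ps h where IH: "length ps = length qs" "set ps \<subseteq> P" "h \<in> Kt u T" "h \<noteq> 0"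
      "prod_list qs = emb (prod_list ps) / emb h" by auto
    obtain p h' where q: "q = emb p / emb h'" "p \<in> P" "h' \<in> Kt u T" "h' \<noteq> 0"
      using Cons.prems by (auto simp: ext_ideal_iff)
    show ?case using IH q Kt_mult[OF q(3) IH(3)]
      by (intro exI[of _ "p # ps"] exI[of _ "h' * h"]) (auto simp: emb_mult)
  qed
  then show ?thesis using that by blast
qed

lemma ext_ideal_subset_Sloc: "ext_ideal u T J \<subseteq> Sloc u T"
  unfolding ext_ideal_def Sloc_def by blast

abbreviation "sat X \<equiv> saturation (Sloc u T) (ext_ideal u T X) (ext_ideal u T P)"

text \<open>For Q strictly inside P, some p in P is a unit at Q, so a numerator of
  \<open>sat X\<close> lies in \<open>loc X Q\<close>, hence in \<open>loc Y Q\<close>. Having this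
  at all such Q in \<open>Ass Y\<close> puts a multiple s a into some Y : P^N. There D is known to
  vanish modulo \<open>locI P\<close>, and s is then removed by
  \<open>dapply_locI_P_of_multiples\<close>.\<close>

lemma dual_space_saturation_mono:
  assumes X: "is_ideal X" and Y: "is_ideal Y"
    and eq: "\<And>Q. Q \<in> Ass Y \<Longrightarrow> Q \<subset> P \<Longrightarrow> loc X Q = loc Y Q"
    and D: "D \<in> dual_space u T (ext_ideal u T P) (sat Y)"
  shows "D \<in> dual_space u T (ext_ideal u T P) (sat X)"
proof -
  interpret noetherian_ring "TYPE(('v, 'k) mpol)" by standard (rule noetherian_mpol)
  have sS: "sat Z \<subseteq> Sloc u T" for Z by (auto simp: saturation_def)
  have dop: "is_dop u T D" using D by (simp add: dual_space_def)
  have "dapply u T D g \<in> locI P" if g: "g \<in> sat X" for g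
  proof -
    obtain a h where a: "g = emb a / emb h" "h \<in> Kt u T" "h \<noteq> 0"
      using subsetD[OF sS g] unfolding Sloc_iff by blast
    obtain m where m: "\<And>qs. length qs = m \<Longrightarrow> set qs \<subseteq> ext_ideal u T P \<Longrightarrow> g * prod_list qs \<in> ext_ideal u T X"
      using g unfolding saturation_def by blast
    have "a \<in> loc Y Q" if Q: "Q \<in> Ass Y" "Q \<subset> P" for Q
    proof -
      have Qp: "is_prime_ideal Q" using Q by (auto simp: Ass_def)
      obtain p where p: "p \<in> P" "p \<notin> Q" using Q by blast
      have "set (replicate m (emb p)) \<subseteq> ext_ideal u T P" using emb_in_ext_ideal[OF p(1)] by auto
      then have "g * prod_list (replicate m (emb p)) \<in> ext_ideal u T X" by (intro m) simp
      then have "g * emb p ^ m \<in> ext_ideal u T X" by simp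
      then obtain b h' where b: "g * emb p ^ m = emb b / emb h'" "b \<in> X" "h' \<in> Kt u T" "h' \<noteq> 0"
        unfolding ext_ideal_iff by blast
      have "emb (h' * p ^ m * a) = emb (h * b)"
        using b(1) a emb_nonzero[OF a(3)] emb_nonzero[OF b(4)]
        by (simp add: emb_mult emb_power frac_eq_eq mult_ac)
      then have "h' * p ^ m * a = h * b" by (simp only: emb_eq_iff)
      then have "h' * p ^ m * a \<in> X" using ideal_mult[OF X b(2)] by simp
      moreover have "h' * p ^ m \<notin> Q"
        using prime_mult[OF Qp _ prime_power[OF Qp p(2)]] Kt_notin_P[OF b(3,4)] Q(2) by blast
      ultimately show ?thesis using eq[OF Q] unfolding loc_def by blast
    qed
    then obtain s N where s: "s \<notin> P" "s * a \<in> colpow Y P N"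
      using mem_saturation_if_mem_loc_below[OF Y P] by blast
    have "dapply u T D (emb a) \<in> locI P"
    proof (rule dapply_locI_P_of_multiples[OF dop s(1)])
      fix j
      \<comment> \<open>Removing s requires all its positive powers, and the colon ideal contains
        each of these multiples of a.\<close>
      have x: "s ^ Suc j * a \<in> colpow Y P N"
        using ideal_mult[OF colpow_ideal[OF Y] s(2), of "s ^ j"] by (simp add: mult_ac)
      have "emb (s ^ Suc j * a) * prod_list qs \<in> ext_ideal u T Y"
        if qs: "length qs = N" "set qs \<subseteq> ext_ideal u T P" for qs
      proof -
        obtain ps h where ps: "length ps = length qs" "set ps \<subseteq> P" "h \<in> Kt u T" "h \<noteq> 0"
          "prod_list qs = emb (prod_list ps) / emb h"
          using prod_list_ext_ideal[OF qs(2)] by blast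
        have "s ^ Suc j * a * prod_list ps \<in> Y" using x ps(1,2) qs(1) unfolding colpow_def by auto
        moreover have "emb (s ^ Suc j * a) * prod_list qs = emb (s ^ Suc j * a * prod_list ps) / emb h"
          by (simp only: ps(5) emb_mult times_divide_eq_right)
        ultimately show ?thesis unfolding ext_ideal_iff using ps(3,4) by blast
      qed
      then have "emb (s ^ Suc j * a) \<in> sat Y"
        unfolding saturation_def using emb_in_Sloc by blast
      then have "dapply u T D (emb (s ^ Suc j * a)) \<in> locI P"
        using D mem_dual_space_iff[OF sS] by blast
      then show "dapply u T D (emb s ^ Suc j * emb a) \<in> locI P" by (simp only: emb_mult emb_power)
    qed
    then have "inverse (emb h) * dapply u T D (emb a) \<in> locI P"
      by (rule M_mult[OF inverse_Kt_in_O[OF a(2,3)]])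
    then show ?thesis unfolding a(1) dapply_Kt_divide[OF dop a(2)] by (simp add: divide_inverse mult.commute)
  qed
  then show ?thesis using mem_dual_space_iff[OF sS] dop by blast
qed

text \<open>The excess data for X split D into a combination of \<open>A\<close> and a remainder
  that is dual to \<open>sat X\<close>. The combination is dual to Y because \<open>A\<close>
  belongs to both ideals, and the remainder is dual to \<open>sat Y\<close>, which contains the
  extension of Y.\<close>

lemma dual_space_mono:
  assumes X: "is_ideal X" and Y: "is_ideal Y"
    and eq: "\<And>Q. Q \<in> Ass X \<Longrightarrow> Q \<subset> P \<Longrightarrow> loc Y Q = loc X Q"
    and A: "excess_data X P u T A" "excess_data Y P u T A"
  shows "dual_space u T (ext_ideal u T P) (ext_ideal u T X) \<subseteq> dual_space u T (ext_ideal u T P) (ext_ideal u T Y)"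
proof
  let ?dual = "dual_space u T (ext_ideal u T P) (ext_ideal u T Y)"
  note iff = mem_dual_space_iff[OF ext_ideal_subset_Sloc]
  fix D assume "D \<in> dual_space u T (ext_ideal u T P) (ext_ideal u T X)"
  then obtain c where c: "\<And>a. a \<in> A \<Longrightarrow> c a \<in> Sloc u T"
    "D - (\<Sum>a\<in>A. dscale (c a) a) \<in> dual_space u T (ext_ideal u T P) (sat X)"
    using A(1) unfolding excess_data_def spans_excess_def by blast
  have "D - (\<Sum>a\<in>A. dscale (c a) a) \<in> dual_space u T (ext_ideal u T P) (sat Y)"
    by (rule dual_space_saturation_mono[OF Y X eq c(2)])
  \<comment> \<open>Exponent 0 works: the only list of factors is empty.\<close>
  moreover have "ext_ideal u T Y \<subseteq> sat Y"
    unfolding saturation_def using ext_ideal_subset_Sloc by (auto intro!: exI[of _ 0])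
  ultimately have E: "D - (\<Sum>a\<in>A. dscale (c a) a) \<in> ?dual" unfolding dual_space_def by blast
  have add: "E + E' \<in> ?dual" if "E \<in> ?dual" "E' \<in> ?dual" for E E'
    using that unfolding iff by (auto simp: is_dop_add dapply_plus M_add)
  have scale: "dscale b E \<in> ?dual" if "E \<in> ?dual" "b \<in> Sloc u T" for b E
    using that Sloc_subset_O unfolding iff by (auto simp: is_dop_dscale dapply_dscale intro!: M_mult)
  have zero: "0 \<in> ?dual" unfolding iff by (auto simp: is_dop_def dapply_def M_zero)
  have "(\<Sum>a\<in>B. dscale (c a) a) \<in> ?dual" if "B \<subseteq> A" for B
    using that
  proof (induction B rule: infinite_finite_induct)
    case (insert a B)
    have "dscale (c a) a \<in> ?dual"
      by (rule scale) (use insert.prems c(1) A(2) in \<open>auto simp: excess_data_def\<close>)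
    then show ?case using insert add by simp
  qed (use zero in auto)
  then have "(D - (\<Sum>a\<in>A. dscale (c a) a)) + (\<Sum>a\<in>A. dscale (c a) a) \<in> ?dual" using add E by blast
  then show "D \<in> ?dual" by simp
qed

text \<open>Duality reverses inclusions: an operator that is dual to X but does not vanish at s f
  cannot be dual to Y, which contains s f.\<close>

lemma loc_mono_of_excess_data:
  assumes X: "is_ideal X" and Y: "is_ideal Y"
    and eq: "\<And>Q. Q \<in> Ass X \<Longrightarrow> Q \<subset> P \<Longrightarrow> loc Y Q = loc X Q"
    and A: "excess_data X P u T A" "excess_data Y P u T A"
  shows "loc Y P \<subseteq> loc X P"
proof
  fix f assume "f \<in> loc Y P"
  then obtain s where s: "s \<notin> P" "s * f \<in> Y" by (auto simp: loc_def)
  have "s * f \<in> loc X P"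
  proof (rule ccontr)
    assume "s * f \<notin> loc X P"
    then obtain D where D: "D \<in> dual_space u T (ext_ideal u T P) (ext_ideal u T X)"
      "dapply u T D (emb (s * f)) \<notin> ext_ideal u T P"
      using separating_operator[OF X] by blast
    then have "D \<in> dual_space u T (ext_ideal u T P) (ext_ideal u T Y)"
      using dual_space_mono[OF X Y eq A] by blast
    then show False using D(2) emb_in_ext_ideal[OF s(2)] unfolding dual_space_def by blast
  qed
  then show "f \<in> loc X P" by (rule loc_cancel[OF P s(1)])
qed

end

theorem theorem3p2:
  fixes I I' :: "('v::{finite,linorder}, 'k::field_char_0) mpol set"
    and u :: "('v, 'k) mpol set \<Rightarrow> 'v \<Rightarrow> ('v, 'k) mpol"
    and T :: "('v, 'k) mpol set \<Rightarrow> 'v set"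
    and A :: "('v, 'k) mpol set \<Rightarrow> ('v, 'k) dop set"
  assumes "is_ideal I" and "is_ideal I'"
    and "Ass I = Ass I'"
    and "\<And>P. P \<in> Ass I \<Longrightarrow> coord_system (u P) \<and> free_vars P (u P) (T P)"
    and "\<And>P. P \<in> Ass I \<Longrightarrow> excess_data I P (u P) (T P) (A P)"
    and "\<And>P. P \<in> Ass I' \<Longrightarrow> excess_data I' P (u P) (T P) (A P)"
  shows "I = I'"
proof -
  interpret noetherian_ring "TYPE(('v, 'k) mpol)" by standard (rule noetherian_mpol)
  have eq: "loc I P = loc I' P" if P: "P \<in> Ass I" for P
  proof (rule ccontr)
    assume neq: "loc I P \<noteq> loc I' P"
    let ?bad = "{P \<in> Ass I. loc I P \<noteq> loc I' P}"
    have "finite ?bad" using finite_Ass[OF assms(1)] by simp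
    moreover have "?bad \<noteq> {}" using P neq by blast
    ultimately have "\<exists>Q\<in>?bad. \<forall>Q'\<in>?bad. Q' \<subseteq> Q \<longrightarrow> Q = Q'" by (rule finite_has_minimal)
    then obtain Q where Q: "Q \<in> ?bad" and min: "\<And>Q'. Q' \<in> ?bad \<Longrightarrow> Q' \<subseteq> Q \<Longrightarrow> Q = Q'"
      by (elim bexE) (rule that, assumption, blast)
    have below: "loc I Q' = loc I' Q'" if "Q' \<in> Ass I" "Q' \<subset> Q" for Q'
      using min[of Q'] that by blast
    have QA: "Q \<in> Ass I" using Q by blast
    then have Q_prime: "is_prime_ideal Q" by (auto simp: Ass_def)
    interpret coordinates_prime_char0 "u Q" "T Q" Q
    proof
      show "coord_system (u Q)" using assms(4)[OF QA] by blast
      show "is_prime_ideal Q" by (rule Q_prime)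
      show "h = 0" if h: "h \<in> Kt (u Q) (T Q)" "h \<in> Q" for h
      proof (rule ccontr)
        assume "h \<noteq> 0"
        obtain F where F: "h = peval (u Q) F" "pvars F \<subseteq> T Q" using h(1) by (auto simp: Kt_def)
        have "F \<noteq> 0" using F(1) \<open>h \<noteq> 0\<close> by auto
        then show False using assms(4)[OF QA] F h(2) unfolding free_vars_def by blast
      qed
    qed
    \<comment> \<open>By minimality of Q the two ideals agree locally at every associated prime
      strictly inside Q, and equality of the sets of associated primes makes the argument symmetric
      in the two ideals.\<close>
    have "loc I' Q \<subseteq> loc I Q"
      using loc_mono_of_excess_data[OF assms(1,2)] below assms(5,6) QA assms(3) by metis
    moreover have "loc I Q \<subseteq> loc I' Q"
      using loc_mono_of_excess_data[OF assms(2,1)] below assms(5,6) QA assms(3) by metis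
    ultimately show False using Q by blast
  qed
  show ?thesis
    using loc_eq_on_Ass_subset[OF assms(1,2)] loc_eq_on_Ass_subset[OF assms(2,1)] eq assms(3)
    by (metis subset_antisym)
qed

end
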